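(* Let $\Omega\subset\mathbb{C}^n$, $n>1$, be a smoothly bounded pseudoconvex domain of finite type, and let $r$ be a smooth defining function of $\Omega$ on a neighbourhood $U$ of $b\Omega$. Then there exist $\alpha_0>0$, $C>0$ and $\delta_0>0$ such that, for every $0<\alpha<\alpha_0$ and every $f\in\mathcal{O}(\Omega)\cap\mathrm{Lip}_\alpha(\Omega)$, $$|f(P_\delta)-f(w)|\le C\,\|f\|_\alpha\, S(|P_\delta-w|)^\alpha$$ for all $P\in b\Omega$, all unit complex tangent vectors $\boldsymbol{v}\in\mathbb{T}_P(b\Omega)$, all $0<\delta<\delta_0$ and all $w\in\mathbb{D}(\delta)$, where $P_\delta$, $\mathbb{D}(\delta)$ and $S$ are the point, disc and function associated with $P$, $\boldsymbol{v}$ and $r$ (defined in the context).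
   Context: A smoothly bounded domain is a bounded domain with $C^\infty$ boundary $b\Omega$. $\mathcal{O}(\Omega)$ is the set of holomorphic functions on $\Omega$. For $0<\alpha<1$, $\mathrm{Lip}_\alpha(\Omega)$ is the set of $f:\Omega\to\mathbb{C}$ for which there is $C_f>0$ with $|f(x)-f(y)|\le C_f|x-y|^\alpha$ for all $x,y\in\Omega$, and $$\|f\|_\alpha=\|f\|_\infty+\sup_{x\ne y\in\Omega}\frac{|f(x)-f(y)|}{|x-y|^\alpha}.$$ For $P\in b\Omega$, $\boldsymbol{\nu}_P$ is the outward unit normal to $b\Omega$ at $P$ (viewed as a vector in $\mathbb{C}^n$), and $\mathbb{T}_P(b\Omega)$ is the set of unit vectors in the complex tangent space to $b\Omega$ at $P$. A smooth real-valued function $r$ on $U$ is a defining function if $\Omega\cap U=\{z\in U:r(z)<0\}$, $b\Omega\cap U=\{z\in U:r(z)=0\}$ and $\nabla r\ne0$ on $b\Omega$. For $P\in b\Omega$, $\boldsymbol{v}\in\mathbb{T}_P(b\Omega)$ and small $t>0$, define (in the coordinates of $\mathbb{C}^n$, up to translation and unitary change) $$P_t:=P-t\boldsymbol{\nu}_P,\qquad R(t):=\sup\{\rho>0: P_t+\zeta\boldsymbol{v}\in\Omega\cap U\text{ for all }\zeta\in\mathbb{C},\ |\zeta|\le\rho\},$$ $$\mathbb{D}(t):=\{P_t+\zeta\boldsymbol{v}:\zeta\in\mathbb{C},\ |\zeta|<R(t)\},\qquad S(t):=\sup\{r(P+\zeta\boldsymbol{v}):\zeta\in\mathbb{C},\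 |\zeta|\le t\}.$$ In the definition of $R$ (and hence $\mathbb{D}$) and $S$ based at $P$, $U$ may be replaced by a sufficiently small ball about $P$ of radius independent of $P$. Finite type (D'Angelo): for a smooth function $g$ near $0\in\mathbb{C}$, $\mathrm{ord}(g)$ is the order of vanishing of $g-g(0)$ at $0$; for a vector-valued $F=(f_1,\dots,f_n)$, $\mathrm{ord}(F)=\min_j\mathrm{ord}(f_j)$. The type of $P\in b\Omega$ is $\Delta(b\Omega,P)=\sup_F\mathrm{ord}(r\circ F)/\mathrm{ord}(F)$, the supremum being over holomorphic parametrizations $F$, defined near $0\in\mathbb{C}$, of possibly singular (nonconstant) holomorphic curves with $F(0)=P$; it does not depend on the choice of $r$. $\Omega$ is of finite type if $\Delta(b\Omega,P)<\infty$ for every $P\in b\Omega$. *)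

theory Defs
  imports "HOL-Analysis.Analysis" "HOL-Library.Extended_Real"
begin

(* Iterated directional derivatives over the reals; complex^'n is used as a real Euclidean space. *)

fun iter_deriv :: "'a list \<Rightarrow> ('a::real_normed_vector \<Rightarrow> 'b::real_normed_vector) \<Rightarrow> 'a \<Rightarrow> 'b" where
  "iter_deriv [] f = f"
| "iter_deriv (v # vs) f = iter_deriv vs (\<lambda>x. frechet_derivative f (at x) v)"

(* On an open subset of a Euclidean space this is the class C^infinity. *)
definition smooth_on :: "'a::real_normed_vector set \<Rightarrow> ('a \<Rightarrow> 'b::real_normed_vector) \<Rightarrow> bool" where
  "smooth_on U f \<longleftrightarrow> (\<forall>vs. \<forall>x\<in>U. iter_deriv vs f differentiable (at x))"

definition gradient :: "('a::real_inner \<Rightarrow> real) \<Rightarrow> 'a \<Rightarrow> 'a" where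
  "gradient r x = (THE D. GDERIV r x :> D)"

definition defining_function :: "(complex^'n) set \<Rightarrow> (complex^'n) set \<Rightarrow> (complex^'n \<Rightarrow> real) \<Rightarrow> bool" where
  "defining_function \<Omega> U r \<longleftrightarrow>
     open U \<and> smooth_on U r \<and>
     \<Omega> \<inter> U = {z \<in> U. r z < 0} \<and>
     frontier \<Omega> \<inter> U = {z \<in> U. r z = 0} \<and>
     (\<forall>z \<in> frontier \<Omega> \<inter> U. gradient r z \<noteq> 0)"

definition smoothly_bounded_domain :: "(complex^'n) set \<Rightarrow> bool" where
  "smoothly_bounded_domain \<Omega> \<longleftrightarrow>
     open \<Omega> \<and> connected \<Omega> \<and> \<Omega> \<noteq> {} \<and> bounded \<Omega> \<and>
     (\<forall>P \<in> frontier \<Omega>. \<exists>V r. P \<in> V \<and> defining_function \<Omega> V r)"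

(* The Wirtinger derivatives d/dz_j and d/d(conjugate z_j). *)

definition dz :: "'n \<Rightarrow> (complex^'n \<Rightarrow> complex) \<Rightarrow> complex^'n \<Rightarrow> complex" where
  "dz j g z = (frechet_derivative g (at z) (axis j 1)
               - \<i> * frechet_derivative g (at z) (axis j \<i>)) / 2"

definition dzbar :: "'n \<Rightarrow> (complex^'n \<Rightarrow> complex) \<Rightarrow> complex^'n \<Rightarrow> complex" where
  "dzbar j g z = (frechet_derivative g (at z) (axis j 1)
                  + \<i> * frechet_derivative g (at z) (axis j \<i>)) / 2"

(* In the next definitions the boundary geometry of the domain is expressed through a defining
   function r; at boundary points the results do not depend on which defining function is used. *)

definition outward_normal :: "(complex^'n \<Rightarrow> real) \<Rightarrow> complex^'n \<Rightarrow> complex^'n" where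
  "outward_normal r P = gradient r P /\<^sub>R norm (gradient r P)"

definition complex_tangent_space :: "(complex^'n \<Rightarrow> real) \<Rightarrow> complex^'n \<Rightarrow> (complex^'n) set" where
  "complex_tangent_space r P =
     {v. (\<Sum>j\<in>UNIV. dz j (\<lambda>z. complex_of_real (r z)) P * v $ j) = 0}"

definition unit_complex_tangents :: "(complex^'n \<Rightarrow> real) \<Rightarrow> complex^'n \<Rightarrow> (complex^'n) set" where
  "unit_complex_tangents r P = {v \<in> complex_tangent_space r P. norm v = 1}"

definition levi_form :: "(complex^'n \<Rightarrow> real) \<Rightarrow> complex^'n \<Rightarrow> complex^'n \<Rightarrow> complex" where
  "levi_form r P v =
     (\<Sum>j\<in>UNIV. \<Sum>k\<in>UNIV.
        dz j (dzbar k (\<lambda>z. complex_of_real (r z))) P * v $ j * cnj (v $ k))"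

(* Pseudoconvexity of a smoothly bounded domain in the sense of Levi. The Levi form of the smooth
   real function r is real, so Re only converts the type. *)
definition pseudoconvex :: "(complex^'n) set \<Rightarrow> (complex^'n \<Rightarrow> real) \<Rightarrow> bool" where
  "pseudoconvex \<Omega> r \<longleftrightarrow>
     (\<forall>P \<in> frontier \<Omega>. \<forall>v \<in> complex_tangent_space r P. 0 \<le> Re (levi_form r P v))"

(* Order of the lowest nonvanishing derivative of g - g 0 at 0; it is infinite if all of them
   vanish. Only meaningful for g smooth near 0. *)
definition vanishing_order :: "(complex \<Rightarrow> 'b::real_normed_vector) \<Rightarrow> enat" where
  "vanishing_order g =
     (INF vs \<in> {vs. iter_deriv vs (\<lambda>\<zeta>. g \<zeta> - g 0) 0 \<noteq> 0}. enat (length vs))"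

definition vanishing_order_vec :: "(complex \<Rightarrow> complex^'n) \<Rightarrow> enat" where
  "vanishing_order_vec F = (INF j. vanishing_order (\<lambda>\<zeta>. F \<zeta> $ j))"

(* Only the germ of F at 0 matters, hence nonconstancy is required of the germ. *)
definition holomorphic_curves_at :: "complex^'n \<Rightarrow> (complex \<Rightarrow> complex^'n) set" where
  "holomorphic_curves_at P =
     {F. (\<forall>j. (\<lambda>\<zeta>. F \<zeta> $ j) analytic_on {0}) \<and> F 0 = P \<and>
         \<not> (\<forall>\<^sub>F \<zeta> in nhds 0. F \<zeta> = P)}"

definition dangelo_type :: "(complex^'n \<Rightarrow> real) \<Rightarrow> complex^'n \<Rightarrow> ereal" where
  "dangelo_type r P =
     (SUP F \<in> holomorphic_curves_at P.
        ereal_of_enat (vanishing_order (r \<circ> F)) / ereal_of_enat (vanishing_order_vec F))"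

definition finite_type :: "(complex^'n) set \<Rightarrow> (complex^'n \<Rightarrow> real) \<Rightarrow> bool" where
  "finite_type \<Omega> r \<longleftrightarrow> (\<forall>P \<in> frontier \<Omega>. dangelo_type r P < \<infinity>)"

definition holomorphic_functions :: "(complex^'n) set \<Rightarrow> (complex^'n \<Rightarrow> complex) set" where
  "holomorphic_functions \<Omega> =
     {f. \<forall>z\<in>\<Omega>. \<exists>D. (f has_derivative D) (at z) \<and> (\<forall>c v. D (c *s v) = c * D v)}"

definition Lip :: "real \<Rightarrow> (complex^'n) set \<Rightarrow> (complex^'n \<Rightarrow> complex) set" where
  "Lip \<alpha> \<Omega> = {f. \<exists>C>0. \<forall>x\<in>\<Omega>. \<forall>y\<in>\<Omega>. norm (f x - f y) \<le> C * norm (x - y) powr \<alpha>}"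

definition Lip_norm :: "real \<Rightarrow> (complex^'n) set \<Rightarrow> (complex^'n \<Rightarrow> complex) \<Rightarrow> real" where
  "Lip_norm \<alpha> \<Omega> f =
     (SUP x\<in>\<Omega>. norm (f x)) +
     Sup {norm (f x - f y) / norm (x - y) powr \<alpha> | x y. x \<in> \<Omega> \<and> y \<in> \<Omega> \<and> x \<noteq> y}"

definition inner_point :: "(complex^'n \<Rightarrow> real) \<Rightarrow> complex^'n \<Rightarrow> real \<Rightarrow> complex^'n" where
  "inner_point r P t = P - t *\<^sub>R outward_normal r P"

(* The next definitions are intended for P on the boundary, v a unit complex tangent vector and t
   so small that inner_point r P t lies in the domain and in U and that, in max_r, the
   disc around P lies in U; both suprema are then taken over nonempty bounded sets. *)

definition disc_radius ::
  "(complex^'n) set \<Rightarrow> (complex^'n) set \<Rightarrow> (complex^'n \<Rightarrow> real) \<Rightarrow> complex^'n \<Rightarrow> complex^'n \<Rightarrow> real \<Rightarrow> real" where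
  "disc_radius \<Omega> U r P v t =
     Sup {\<rho>. \<rho> > 0 \<and> (\<forall>\<zeta>::complex. norm \<zeta> \<le> \<rho> \<longrightarrow> inner_point r P t + \<zeta> *s v \<in> \<Omega> \<inter> U)}"

definition tangent_disc ::
  "(complex^'n) set \<Rightarrow> (complex^'n) set \<Rightarrow> (complex^'n \<Rightarrow> real) \<Rightarrow> complex^'n \<Rightarrow> complex^'n \<Rightarrow> real \<Rightarrow> (complex^'n) set" where
  "tangent_disc \<Omega> U r P v t =
     {inner_point r P t + \<zeta> *s v | \<zeta>::complex. norm \<zeta> < disc_radius \<Omega> U r P v t}"

definition max_r :: "(complex^'n \<Rightarrow> real) \<Rightarrow> complex^'n \<Rightarrow> complex^'n \<Rightarrow> real \<Rightarrow> real" where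
  "max_r r P v t = Sup {r (P + \<zeta> *s v) | \<zeta>::complex. norm \<zeta> \<le> t}"

end

theory Submission
  imports Defs "HOL-Complex_Analysis.Conformal_Mappings"
begin

text \<open>Let \<open>g \<zeta> = r (P + \<zeta> v)\<close> be the restriction of the defining function to the complex line
  through a boundary point \<open>P\<close> in the direction \<open>v\<close>. The proof replaces the maximum \<open>S \<rho>\<close> of \<open>g\<close>
  over \<open>\<bar>\<zeta>\<bar> \<le> \<rho>\<close> by the gauge \<open>N \<rho> = \<Sum> \<bar>a\<^sub>i\<^sub>j\<bar> \<rho>^(i + j)\<close>, where \<open>a\<^sub>i\<^sub>j\<close> are the real Taylor
  coefficients of \<open>g\<close> of order less than some \<open>n\<close>. Unlike \<open>S\<close>, the gauge obviously satisfies a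
  doubling condition \<open>N (2 \<rho>) \<le> 2^n N \<rho>\<close>.

  \<^item> Finite type, tested on the complex line itself, says that some Taylor coefficient of \<open>g\<close> is
    nonzero. By compactness of the set of boundary points and unit vectors, one \<open>n\<close> and one
    positive lower bound for the coefficients work everywhere (\<open>uniform_finite_order\<close>).
  \<^item> Pseudoconvexity is a condition on complex tangent vectors at boundary points. Moving a point
    near the boundary onto it and projecting \<open>v\<close> onto the complex tangent space costs an error of
    size \<open>\<bar>r\<bar> + \<bar>\<partial>r(v)\<bar>\<close>, so \<open>\<Delta>g \<ge> - C (\<bar>g\<bar> + \<bar>\<nabla>g\<bar>)\<close> (\<open>levi_lower_bound\<close>).
  \<^item> Rescaled to the unit disc and divided by \<open>N \<rho>\<close>, \<open>g\<close> is close to a normalised polynomial that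
    vanishes at \<open>0\<close>, and its Laplacian is almost nonnegative. A subharmonic polynomial that vanishes at
    \<open>0\<close> and is not zero has a positive maximum on the disc; by compactness of the space
    of coefficients this maximum is bounded below (\<open>bipoly_max_or_laplacian\<close>). Hence \<open>S\<close> and
    \<open>N\<close> are comparable, uniformly in \<open>P\<close> and \<open>v\<close> (\<open>tangential_gauge\<close>).
  \<^item> By the upper bound for \<open>g\<close>, the disc of radius \<open>\<rho>\<close> in the direction \<open>v\<close> lies in \<open>\<Omega>\<close> once it is
    pushed inwards by a large multiple of \<open>N \<rho>\<close>. Put \<open>t = \<bar>\<zeta>\<bar>\<close> and let \<open>F\<^sub>k\<close> be \<open>f\<close> on the
    disc of radius \<open>2^(k + 1) t\<close> pushed inwards by \<open>h\<^sub>k\<close>, about \<open>N (2^(k + 1) t)\<close>. The Lipschitz condition bounds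
    \<open>F\<^sub>k - F\<^sub>k\<^sub>+\<^sub>1\<close> by a multiple of \<open>N (2^(k + 2) t)^\<alpha>\<close>, and the Schwarz lemma gains the factor \<open>2^(- k)\<close> for the
    variation of this difference between \<open>0\<close> and \<open>\<zeta>\<close>. Doubling and \<open>n \<alpha> < 1/2\<close> make the sum over \<open>k\<close>
    geometric, so \<open>f\<close> varies by at most a multiple of \<open>N t^\<alpha>\<close> (\<open>tangential_chain_estimate\<close>).

  The lower bound for the maximum of \<open>g\<close> also shows that the discs through points at depth \<open>\<delta>\<close>
  shrink with \<open>\<delta>\<close> (\<open>tangent_disc_small\<close>), so that every \<open>w\<close> in such a disc is covered by the chain.\<close>

section \<open>Iterated directional derivatives\<close>

lemma iter_deriv_append: "iter_deriv (us @ vs) f = iter_deriv vs (iter_deriv us f)"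
  by (induction us arbitrary: f) auto

lemma smooth_on_differentiable: "smooth_on U f \<Longrightarrow> x \<in> U \<Longrightarrow> f differentiable (at x)"
  unfolding smooth_on_def by (metis iter_deriv.simps(1))

lemma smooth_on_iter_deriv: "smooth_on U f \<Longrightarrow> smooth_on U (iter_deriv us f)"
  unfolding smooth_on_def by (metis iter_deriv_append)

lemma smooth_on_direction:
  "smooth_on U f \<Longrightarrow> smooth_on U (\<lambda>x. frechet_derivative f (at x) u)"
  using smooth_on_iter_deriv[of U f "[u]"] by simp

lemma iter_deriv_cong:
  assumes "open U" "\<And>x. x \<in> U \<Longrightarrow> f x = g x" "x \<in> U"
  shows "iter_deriv vs f x = iter_deriv vs g x"
  using assms(2,3)
proof (induction vs arbitrary: f g x)
  case (Cons v vs)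
  have "frechet_derivative f (at y) = frechet_derivative g (at y)" if "y \<in> U" for y
  proof -
    have "(f has_derivative F) (at y) \<longleftrightarrow> (g has_derivative F) (at y)" for F
      using has_derivative_transform_within_open[OF _ \<open>open U\<close> that] Cons.prems(1) by metis
    then show ?thesis
      unfolding frechet_derivative_def by simp
  qed
  then show ?case
    using Cons.IH[of "\<lambda>x. frechet_derivative f (at x) v" "\<lambda>x. frechet_derivative g (at x) v"]
      Cons.prems by simp
qed simp

lemma iter_deriv_sum:
  fixes f :: "'i \<Rightarrow> 'a::real_normed_vector \<Rightarrow> 'b::real_normed_vector"
  assumes "open U" "\<And>b. b \<in> B \<Longrightarrow> smooth_on U (f b)" "x \<in> U"
  shows "iter_deriv vs (\<lambda>x. \<Sum>b\<in>B. c b *\<^sub>R f b x) x = (\<Sum>b\<in>B. c b *\<^sub>R iter_deriv vs (f b) x)"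
  using assms(2,3)
proof (induction vs arbitrary: f x)
  case (Cons v vs)
  let ?D = "\<lambda>b x. frechet_derivative (f b) (at x) v"
  have "frechet_derivative (\<lambda>x. \<Sum>b\<in>B. c b *\<^sub>R f b x) (at y) v = (\<Sum>b\<in>B. c b *\<^sub>R ?D b y)"
    if "y \<in> U" for y
  proof -
    have "(f b has_derivative frechet_derivative (f b) (at y)) (at y)" if "b \<in> B" for b
      using smooth_on_differentiable[OF Cons.prems(1)[OF that] \<open>y \<in> U\<close>]
      by (simp only: frechet_derivative_works)
    then have "((\<lambda>x. \<Sum>b\<in>B. c b *\<^sub>R f b x) has_derivative
        (\<lambda>h. \<Sum>b\<in>B. c b *\<^sub>R frechet_derivative (f b) (at y) h)) (at y)"
      by (intro has_derivative_sum has_derivative_scaleR_right)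
    then show ?thesis
      by (metis (no_types, lifting) frechet_derivative_at)
  qed
  then have "iter_deriv (v # vs) (\<lambda>x. \<Sum>b\<in>B. c b *\<^sub>R f b x) x
      = iter_deriv vs (\<lambda>x. \<Sum>b\<in>B. c b *\<^sub>R ?D b x) x"
    unfolding iter_deriv.simps by (rule iter_deriv_cong[OF \<open>open U\<close> _ Cons.prems(2)])
  also have "\<dots> = (\<Sum>b\<in>B. c b *\<^sub>R iter_deriv vs (?D b) x)"
    using Cons by (simp add: smooth_on_direction)
  finally show ?case by simp
qed simp

text \<open>The directions of an iterated derivative will vary together with the point. Bounds and limits are
  reduced to derivatives along fixed basis vectors by expanding one direction at a time.\<close>

lemma iter_deriv_Cons_Basis:
  fixes f :: "'a::euclidean_space \<Rightarrow> 'b::real_normed_vector"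
  assumes "open U" "smooth_on U f" "x \<in> U"
  shows "iter_deriv (u # us) f x
    = (\<Sum>b\<in>Basis. (u \<bullet> b) *\<^sub>R iter_deriv us (\<lambda>x. frechet_derivative f (at x) b) x)"
proof -
  have "frechet_derivative f (at y) u = (\<Sum>b\<in>Basis. (u \<bullet> b) *\<^sub>R frechet_derivative f (at y) b)"
    if "y \<in> U" for y
  proof -
    have "linear (frechet_derivative f (at y))"
      using assms(2) that smooth_on_differentiable linear_frechet_derivative by blast
    then show ?thesis
      by (subst euclidean_representation[of u, symmetric]) (simp add: linear_sum linear_scale)
  qed
  then have "iter_deriv (u # us) f x
      = iter_deriv us (\<lambda>y. \<Sum>b\<in>Basis. (u \<bullet> b) *\<^sub>R frechet_derivative f (at y) b) x"
    unfolding iter_deriv.simps by (rule iter_deriv_cong[OF assms(1) _ assms(3)])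
  also have "\<dots> = (\<Sum>b\<in>Basis. (u \<bullet> b) *\<^sub>R iter_deriv us (\<lambda>x. frechet_derivative f (at x) b) x)"
    by (rule iter_deriv_sum) (use assms smooth_on_direction in auto)
  finally show ?thesis .
qed

lemma iter_deriv_bound_compact:
  fixes f :: "'a::euclidean_space \<Rightarrow> 'b::real_normed_vector"
  assumes "open U" "smooth_on U f" "compact K" "K \<subseteq> U"
  shows "\<exists>B>0. \<forall>x\<in>K. \<forall>us. length us = n \<longrightarrow> norm (iter_deriv us f x) \<le> B * prod_list (map norm us)"
  using assms(2)
proof (induction n arbitrary: f)
  case 0
  have "continuous_on K f"
    using 0 assms(4) smooth_on_differentiable
    by (meson continuous_at_imp_continuous_on differentiable_imp_continuous_within subsetD)
  then have "bounded (f ` K)"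
    using assms(3) compact_continuous_image compact_imp_bounded by blast
  then obtain B where "B > 0" "\<And>x. x \<in> K \<Longrightarrow> norm (f x) \<le> B"
    by (metis bounded_pos image_eqI)
  then show ?case by auto
next
  case (Suc n)
  let ?D = "\<lambda>b x. frechet_derivative f (at x) b"
  have "\<forall>b. \<exists>B>0. \<forall>x\<in>K. \<forall>us. length us = n \<longrightarrow>
      norm (iter_deriv us (?D b) x) \<le> B * prod_list (map norm us)"
    using Suc smooth_on_direction by blast
  then obtain B where B: "\<And>b. B b > 0" "\<And>b x us. x \<in> K \<Longrightarrow> length us = n \<Longrightarrow>
      norm (iter_deriv us (?D b) x) \<le> B b * prod_list (map norm us)"
    by metis
  have "norm (iter_deriv us f x) \<le> (\<Sum>b\<in>Basis. B b) * prod_list (map norm us)"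
    if "x \<in> K" and len: "length us = Suc n" for x us
  proof -
    obtain u vs where us: "us = u # vs" "length vs = n"
      using len by (metis length_Suc_conv)
    have "iter_deriv us f x = (\<Sum>b\<in>Basis. (u \<bullet> b) *\<^sub>R iter_deriv vs (?D b) x)"
      unfolding us using assms that Suc.prems by (intro iter_deriv_Cons_Basis[of U]) auto
    also have "norm \<dots> \<le> (\<Sum>b\<in>Basis. norm u * (B b * prod_list (map norm vs)))"
    proof (rule order_trans[OF norm_sum sum_mono])
      fix b :: 'a assume "b \<in> Basis"
      then show "norm ((u \<bullet> b) *\<^sub>R iter_deriv vs (?D b) x) \<le> norm u * (B b * prod_list (map norm vs))"
        unfolding norm_scaleR using B(2)[OF that(1) us(2)] Basis_le_norm[of b u]
        by (intro mult_mono) auto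
    qed
    also have "\<dots> = (\<Sum>b\<in>Basis. B b) * prod_list (map norm us)"
      by (simp add: us sum_distrib_left sum_distrib_right algebra_simps)
    finally show ?thesis .
  qed
  moreover have "(\<Sum>b\<in>(Basis::'a set). B b) > 0"
    using B(1) by (intro sum_pos) auto
  ultimately show ?case by blast
qed

text \<open>Joint continuity in the point and in the directions. The list of directions is given by a list of
  indices because the same moving vector occurs in it many times.\<close>

lemma iter_deriv_tendsto:
  fixes f :: "'a::euclidean_space \<Rightarrow> 'b::real_normed_vector"
  assumes "open U" "smooth_on U f" "x \<in> U" "(X \<longlongrightarrow> x) F" "\<And>i. (V i \<longlongrightarrow> L i) F"
  shows "((\<lambda>k. iter_deriv (map (\<lambda>i. V i k) ks) f (X k)) \<longlongrightarrow> iter_deriv (map L ks) f x) F"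
  using assms(2)
proof (induction ks arbitrary: f)
  case Nil
  then have "isCont f x"
    using assms(3) smooth_on_differentiable differentiable_imp_continuous_within by blast
  then show ?case
    using assms(4) isCont_tendsto_compose by auto
next
  case (Cons i ks)
  let ?D = "\<lambda>b x. frechet_derivative f (at x) b"
  have *: "iter_deriv (u # us) f y = (\<Sum>b\<in>Basis. (u \<bullet> b) *\<^sub>R iter_deriv us (?D b) y)" if "y \<in> U" for u us y
    using iter_deriv_Cons_Basis[OF assms(1) Cons.prems that] .
  have "((\<lambda>k. \<Sum>b\<in>Basis. (V i k \<bullet> b) *\<^sub>R iter_deriv (map (\<lambda>i. V i k) ks) (?D b) (X k))
      \<longlongrightarrow> (\<Sum>b\<in>Basis. (L i \<bullet> b) *\<^sub>R iter_deriv (map L ks) (?D b) x)) F"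
    using assms Cons smooth_on_direction
    by (intro tendsto_sum tendsto_scaleR tendsto_inner tendsto_const) blast+
  moreover have "\<forall>\<^sub>F k in F. X k \<in> U"
    using assms topological_tendstoD by blast
  ultimately show ?case
    using *[OF assms(3)]
    by (simp add: *[simplified] tendsto_cong[OF eventually_mono[OF _ *]] del: iter_deriv.simps)
qed

lemma line_deriv:
  fixes f :: "'a::real_normed_vector \<Rightarrow> real"
  assumes "f differentiable (at (x + s *\<^sub>R u))"
  shows "((\<lambda>s. f (x + s *\<^sub>R u)) has_real_derivative frechet_derivative f (at (x + s *\<^sub>R u)) u) (at s)"
proof -
  let ?F = "frechet_derivative f (at (x + s *\<^sub>R u))"
  have F: "(f has_derivative ?F) (at (x + s *\<^sub>R u))"
    using assms frechet_derivative_works by blast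
  have "((\<lambda>s. f (x + s *\<^sub>R u)) has_derivative (\<lambda>h. ?F (h *\<^sub>R u))) (at s)"
    by (rule has_derivative_compose[where g = f and f = "\<lambda>s. x + s *\<^sub>R u" and x = s, OF _ F]) (auto intro!: derivative_eq_intros)
  moreover have "?F (h *\<^sub>R u) = ?F u * h" for h
    using linear_scale[OF linear_frechet_derivative[OF assms]] by (simp add: mult.commute)
  ultimately show ?thesis
    unfolding has_field_derivative_def by simp
qed

lemma line_mvt:
  fixes f :: "'a::real_normed_vector \<Rightarrow> real"
  assumes "0 < h" "\<And>s. 0 \<le> s \<Longrightarrow> s \<le> h \<Longrightarrow> f differentiable (at (x + s *\<^sub>R u))"
  shows "\<exists>s. 0 < s \<and> s < h \<and> f (x + h *\<^sub>R u) - f x = h * frechet_derivative f (at (x + s *\<^sub>R u)) u"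
  using MVT2[OF assms(1), of "\<lambda>s. f (x + s *\<^sub>R u)" "\<lambda>s. frechet_derivative f (at (x + s *\<^sub>R u)) u"]
    line_deriv[OF assms(2)] by auto

text \<open>The second difference of \<open>f\<close> is symmetric in \<open>a\<close> and \<open>b\<close>, whereas the mean value theorem, applied
  first in one variable and then in the other, writes it as the mixed derivative in a given order at a nearby
  point. Letting \<open>h\<close> tend to zero shows that the order of differentiation does not matter.\<close>

lemma second_difference:
  fixes f :: "'a::real_normed_vector \<Rightarrow> real"
  assumes f: "smooth_on (ball x \<epsilon>) f" and h: "0 < h" "h * (norm a + norm b) < \<epsilon>"
  shows "\<exists>y. dist x y \<le> h * (norm a + norm b) \<and>
    f (x + h *\<^sub>R a + h *\<^sub>R b) - f (x + h *\<^sub>R a) - f (x + h *\<^sub>R b) + f x = h\<^sup>2 * iter_deriv [a, b] f y"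
proof -
  have near: "norm (s *\<^sub>R a + t *\<^sub>R b) \<le> h * (norm a + norm b)" if "0 \<le> s" "s \<le> h" "0 \<le> t" "t \<le> h" for s t
  proof -
    have "norm (s *\<^sub>R a + t *\<^sub>R b) \<le> s * norm a + t * norm b"
      by (rule order_trans[OF norm_triangle_ineq]) (use that in simp)
    also have "\<dots> \<le> h * norm a + h * norm b"
      using that by (intro add_mono mult_right_mono) auto
    finally show ?thesis by (simp add: algebra_simps)
  qed
  have mem: "x + s *\<^sub>R a + t *\<^sub>R b \<in> ball x \<epsilon>" if "0 \<le> s" "s \<le> h" "0 \<le> t" "t \<le> h" for s t
    using near[OF that] h(2) by (simp add: dist_norm add.assoc norm_minus_commute)
      (metis (no_types, opaque_lifting) add.commute diff_add_cancel add_uminus_conv_diff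
        minus_add_distrib norm_minus_cancel le_less_trans)
  define \<psi> where "\<psi> s = f (x + h *\<^sub>R b + s *\<^sub>R a) - f (x + s *\<^sub>R a)" for s
  let ?D = "\<lambda>y. frechet_derivative f (at y) a"
  have "((\<psi>) has_real_derivative ?D (x + h *\<^sub>R b + s *\<^sub>R a) - ?D (x + s *\<^sub>R a)) (at s)"
    if "0 \<le> s" "s \<le> h" for s
    unfolding \<psi>_def
    using mem[of s h] mem[of s 0] that h
    by (intro DERIV_diff line_deriv smooth_on_differentiable[OF f]) (auto simp: add_ac)
  from MVT2[OF h(1) this] obtain s where s: "0 < s" "s < h"
    "\<psi> h - \<psi> 0 = h * (?D (x + h *\<^sub>R b + s *\<^sub>R a) - ?D (x + s *\<^sub>R a))"
    by auto
  have "\<exists>t. 0 < t \<and> t < h \<and> ?D (x + s *\<^sub>R a + h *\<^sub>R b) - ?D (x + s *\<^sub>R a)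
      = h * frechet_derivative ?D (at (x + s *\<^sub>R a + t *\<^sub>R b)) b"
    using mem s by (intro line_mvt h(1) smooth_on_differentiable[OF smooth_on_direction[OF f]]) auto
  then obtain t where t: "0 < t" "t < h" "?D (x + s *\<^sub>R a + h *\<^sub>R b) - ?D (x + s *\<^sub>R a)
      = h * frechet_derivative ?D (at (x + s *\<^sub>R a + t *\<^sub>R b)) b"
    by auto
  have "dist x (x + s *\<^sub>R a + t *\<^sub>R b) \<le> h * (norm a + norm b)"
    using near[of s t] s t by (simp add: dist_norm add.assoc norm_minus_commute)
      (metis (no_types, opaque_lifting) add.commute add_uminus_conv_diff minus_add_distrib norm_minus_cancel)
  then show ?thesis
    using s(3) t(3) unfolding \<psi>_def
    by (intro exI[of _ "x + s *\<^sub>R a + t *\<^sub>R b"]) (simp add: power2_eq_square add_ac)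
qed

lemma iter_deriv_swap:
  fixes f :: "'a::real_normed_vector \<Rightarrow> real"
  assumes "open U" "smooth_on U f" "x \<in> U"
  shows "iter_deriv [a, b] f x = iter_deriv [b, a] f x"
proof -
  obtain \<epsilon> where \<epsilon>: "\<epsilon> > 0" "ball x \<epsilon> \<subseteq> U"
    using assms openE by blast
  have f: "smooth_on (ball x \<epsilon>) f"
    using \<epsilon>(2) assms(2) unfolding smooth_on_def by blast
  define d where "d = norm a + norm b"
  define h where "h n = \<epsilon> / (d + 1) / real (n + 2)" for n
  have d: "d \<ge> 0" by (simp add: d_def)
  have h: "h n > 0" "h n * d < \<epsilon>" for n
  proof -
    show "h n > 0" using \<epsilon>(1) d by (simp add: h_def)
    have "(d + 1) * real (n + 2) = d * real n + 2 * d + real n + 2"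
      by (simp add: algebra_simps)
    moreover have "d * real n \<ge> 0"
      using d by simp
    ultimately have "\<epsilon> * d < \<epsilon> * ((d + 1) * real (n + 2))"
      using \<epsilon>(1) d by (intro mult_strict_left_mono) linarith+
    then show "h n * d < \<epsilon>" using \<epsilon>(1) d by (simp add: h_def divide_simps mult_ac)
  qed
  have h0: "(\<lambda>n. h n * d) \<longlonglongrightarrow> 0"
    unfolding h_def using LIMSEQ_ignore_initial_segment[OF lim_const_over_n[of "\<epsilon> / (d+1)"], of 2]
    by (intro tendsto_mult_left_zero) simp
  have "\<forall>n. \<exists>y. dist x y \<le> h n * d \<and>
    f (x + h n *\<^sub>R a + h n *\<^sub>R b) - f (x + h n *\<^sub>R a) - f (x + h n *\<^sub>R b) + f x = (h n)\<^sup>2 * iter_deriv [a, b] f y"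
    using second_difference[OF f h(1), of _ a b] h(2) unfolding d_def by blast
  then obtain y where y: "\<And>n. dist x (y n) \<le> h n * d" "\<And>n.
    f (x + h n *\<^sub>R a + h n *\<^sub>R b) - f (x + h n *\<^sub>R a) - f (x + h n *\<^sub>R b) + f x = (h n)\<^sup>2 * iter_deriv [a, b] f (y n)"
    by metis
  have "\<forall>n. \<exists>y. dist x y \<le> h n * d \<and>
    f (x + h n *\<^sub>R b + h n *\<^sub>R a) - f (x + h n *\<^sub>R b) - f (x + h n *\<^sub>R a) + f x = (h n)\<^sup>2 * iter_deriv [b, a] f y"
    using second_difference[OF f h(1), of _ b a] h(2) unfolding d_def by (metis add.commute)
  then obtain z where z: "\<And>n. dist x (z n) \<le> h n * d" "\<And>n.
    f (x + h n *\<^sub>R b + h n *\<^sub>R a) - f (x + h n *\<^sub>R b) - f (x + h n *\<^sub>R a) + f x = (h n)\<^sup>2 * iter_deriv [b, a] f (z n)"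
    by metis
  have eq: "iter_deriv [a, b] f (y n) = iter_deriv [b, a] f (z n)" for n
  proof -
    have "(h n)\<^sup>2 * iter_deriv [a, b] f (y n) = (h n)\<^sup>2 * iter_deriv [b, a] f (z n)"
      unfolding y(2)[symmetric] z(2)[symmetric] by (simp add: add_ac)
    then show ?thesis using h(1)[of n] by simp
  qed
  have lim: "q \<longlonglongrightarrow> x" if "\<And>n. dist x (q n) \<le> h n * d" for q
    by (rule metric_tendsto_imp_tendsto[OF h0]) (use that in \<open>auto simp: dist_commute intro!: always_eventually order_trans[OF _ abs_ge_self]\<close>)
  have cont: "isCont (iter_deriv us f) x" for us
    using smooth_on_differentiable[OF smooth_on_iter_deriv[OF assms(2)] assms(3)]
      differentiable_imp_continuous_within by blast
  have "(\<lambda>n. iter_deriv [a, b] f (y n)) \<longlonglongrightarrow> iter_deriv [a, b] f x"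
    using isCont_tendsto_compose[OF cont lim] y(1) by blast
  moreover have "(\<lambda>n. iter_deriv [b, a] f (z n)) \<longlonglongrightarrow> iter_deriv [b, a] f x"
    using isCont_tendsto_compose[OF cont lim] z(1) by blast
  ultimately show ?thesis
    unfolding eq using LIMSEQ_unique by blast
qed

lemma iter_deriv_move:
  fixes f :: "'a::real_normed_vector \<Rightarrow> real"
  assumes "open U" "smooth_on U f" "x \<in> U"
  shows "iter_deriv (w # replicate i u @ vs) f x = iter_deriv (replicate i u @ w # vs) f x"
  using assms(2)
proof (induction i arbitrary: f)
  case (Suc i)
  let ?D = "\<lambda>u x. frechet_derivative f (at x) u"
  have "iter_deriv (w # replicate (Suc i) u @ vs) f x
      = iter_deriv (replicate i u @ vs) (iter_deriv [w, u] f) x"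
    by simp
  also have "\<dots> = iter_deriv (replicate i u @ vs) (iter_deriv [u, w] f) x"
    by (rule iter_deriv_cong[OF assms(1) _ assms(3)]) (rule iter_deriv_swap[OF assms(1) Suc.prems])
  also have "\<dots> = iter_deriv (w # replicate i u @ vs) (?D u) x"
    by simp
  also have "\<dots> = iter_deriv (replicate i u @ w # vs) (?D u) x"
    by (rule Suc.IH[OF smooth_on_direction[OF Suc.prems]])
  finally show ?case by simp
qed simp

text \<open>Every derivative in directions of the plane spanned by \<open>u\<close> and \<open>w\<close> is a combination of sorted ones.
  The induction passes to \<open>D\<^sub>u f\<close> and \<open>D\<^sub>w f\<close>; for the latter, \<open>w\<close> is moved past the \<open>u\<close>'s.\<close>

lemma iter_deriv_eq_0_if_plane_eq_0:
  fixes f :: "'a::real_normed_vector \<Rightarrow> real"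
  assumes "open U" "smooth_on U f" "x \<in> U"
    and "\<And>i j. iter_deriv (replicate i u @ replicate j w) f x = 0"
    and "\<And>v. v \<in> set vs \<Longrightarrow> \<exists>\<alpha> \<beta>. v = \<alpha> *\<^sub>R u + \<beta> *\<^sub>R w"
  shows "iter_deriv vs f x = 0"
  using assms(2,4,5)
proof (induction vs arbitrary: f)
  case Nil
  then show ?case using Nil(2)[of 0 0] by simp
next
  case (Cons v vs)
  obtain \<alpha> \<beta> where v: "v = \<alpha> *\<^sub>R u + \<beta> *\<^sub>R w"
    using Cons.prems(3)[of v] by auto
  let ?D = "\<lambda>u x. frechet_derivative f (at x) u"
  have D: "?D v y = (\<Sum>b\<in>{True, False}. (if b then \<alpha> else \<beta>) *\<^sub>R ?D (if b then u else w) y)" if "y \<in> U" for y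
    using linear_frechet_derivative[OF smooth_on_differentiable[OF Cons.prems(1) that]]
    by (simp add: v linear_add linear_scale)
  have "iter_deriv (replicate i u @ replicate j w) (?D u) x = 0" for i j
    using Cons.prems(2)[of "Suc i" j] by simp
  moreover have "iter_deriv (replicate i u @ replicate j w) (?D w) x = 0" for i j
    using Cons.prems(2)[of i "Suc j"] iter_deriv_move[OF assms(1) Cons.prems(1) assms(3), of w i u "replicate j w"]
    by simp
  ultimately have "iter_deriv vs (?D u) x = 0" "iter_deriv vs (?D w) x = 0"
    using Cons.prems by (auto intro!: Cons.IH smooth_on_direction)
  moreover have "iter_deriv (v # vs) f x
      = (\<Sum>b\<in>{True, False}. (if b then \<alpha> else \<beta>) *\<^sub>R iter_deriv vs (?D (if b then u else w)) x)"
    by (subst iter_deriv_sum[OF assms(1) _ assms(3), symmetric])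
      (use iter_deriv_cong[OF assms(1) D assms(3)] Cons.prems(1) in \<open>auto intro: smooth_on_direction\<close>)
  ultimately show ?case
    by simp
qed

section \<open>Taylor polynomials on planes\<close>

lemma complex_smult_eq: "\<zeta> *s v = Re \<zeta> *\<^sub>R v + Im \<zeta> *\<^sub>R (\<i> *s v)"
  for v :: "complex^'n"
  by (simp add: vec_eq_iff complex_eq_iff)

lemma norm_complex_smult: "norm (\<zeta> *s v) = norm \<zeta> * norm v"
  for v :: "complex^'n"
  by (simp add: norm_vec_def norm_mult L2_set_right_distrib)

lemma iter_deriv_complex_line:
  fixes r :: "complex^'n \<Rightarrow> real"
  assumes "open U" "smooth_on U r" "P + \<zeta> *s v \<in> U"
  shows "iter_deriv vs (\<lambda>\<zeta>. r (P + \<zeta> *s v)) \<zeta> = iter_deriv (map (\<lambda>c. c *s v) vs) r (P + \<zeta> *s v)"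
  using assms(2,3)
proof (induction vs arbitrary: r \<zeta>)
  case (Cons c vs)
  let ?V = "(\<lambda>\<zeta>. P + \<zeta> *s v) -` U"
  have lin: "bounded_linear (\<lambda>\<zeta>. \<zeta> *s v)"
    by (rule bounded_linear_intro[where K = "norm v"])
      (auto simp: norm_complex_smult vec_eq_iff algebra_simps)
  have V: "open ?V"
    by (intro open_vimage assms(1) continuous_intros bounded_linear.continuous_on[OF lin])
  have "frechet_derivative (\<lambda>\<zeta>. r (P + \<zeta> *s v)) (at \<xi>) c
      = frechet_derivative r (at (P + \<xi> *s v)) (c *s v)" if "\<xi> \<in> ?V" for \<xi>
  proof -
    have "(r has_derivative frechet_derivative r (at (P + \<xi> *s v))) (at (P + \<xi> *s v))"
      using smooth_on_differentiable[OF Cons.prems(1)] that by (simp add: frechet_derivative_works)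
    moreover have "((\<lambda>\<zeta>. P + \<zeta> *s v) has_derivative (\<lambda>\<zeta>. \<zeta> *s v)) (at \<xi>)"
      by (auto intro!: derivative_eq_intros bounded_linear.has_derivative[OF lin])
    ultimately have "((\<lambda>\<zeta>. r (P + \<zeta> *s v)) has_derivative
        (\<lambda>c. frechet_derivative r (at (P + \<xi> *s v)) (c *s v))) (at \<xi>)"
      using has_derivative_compose by blast
    then show ?thesis
      by (metis (no_types, lifting) frechet_derivative_at)
  qed
  then have "iter_deriv (c # vs) (\<lambda>\<zeta>. r (P + \<zeta> *s v)) \<zeta>
      = iter_deriv vs (\<lambda>\<xi>. frechet_derivative r (at (P + \<xi> *s v)) (c *s v)) \<zeta>"
    unfolding iter_deriv.simps by (intro iter_deriv_cong[OF V]) (use Cons.prems in auto)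
  also have "\<dots> = iter_deriv (map (\<lambda>c. c *s v) (c # vs)) r (P + \<zeta> *s v)"
    using Cons.IH[OF smooth_on_direction[OF Cons.prems(1)] Cons.prems(2)] by simp
  finally show ?case .
qed simp

lemma taylor_line:
  fixes f :: "'a::real_normed_vector \<Rightarrow> real"
  assumes "smooth_on U f"
    and U: "\<And>t. \<bar>t\<bar> \<le> \<bar>s\<bar> \<Longrightarrow> x + t *\<^sub>R u \<in> U"
    and B: "\<And>t. \<bar>t\<bar> \<le> \<bar>s\<bar> \<Longrightarrow> \<bar>iter_deriv (replicate n u) f (x + t *\<^sub>R u)\<bar> \<le> B"
  shows "\<bar>f (x + s *\<^sub>R u) - (\<Sum>k<n. iter_deriv (replicate k u) f x / fact k * s ^ k)\<bar> \<le> B * \<bar>s\<bar> ^ n"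
proof -
  let ?d = "\<lambda>k t. iter_deriv (replicate k u) f (x + t *\<^sub>R u)"
  have step: "iter_deriv (replicate (Suc k) u) f = (\<lambda>y. frechet_derivative (iter_deriv (replicate k u) f) (at y) u)" for k
    unfolding replicate_append_same[symmetric] replicate_Suc iter_deriv_append by simp
  have "DERIV (?d m) t :> ?d (Suc m) t" if "\<bar>t\<bar> \<le> \<bar>s\<bar>" for m t
    unfolding step
    by (intro line_deriv smooth_on_differentiable[OF smooth_on_iter_deriv[OF assms(1)]] U that)
  then obtain t where t: "\<bar>t\<bar> \<le> \<bar>s\<bar>"
    "f (x + s *\<^sub>R u) = (\<Sum>m<n. ?d m 0 / fact m * s ^ m) + ?d n t / fact n * s ^ n"
    using Maclaurin_bi_le[of ?d "\<lambda>t. f (x + t *\<^sub>R u)" n s] by auto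
  have "\<bar>?d n t / fact n * s ^ n\<bar> = \<bar>?d n t\<bar> / fact n * \<bar>s\<bar> ^ n"
    by (simp add: abs_mult power_abs)
  also have "\<dots> \<le> \<bar>?d n t\<bar> * \<bar>s\<bar> ^ n"
    by (intro mult_right_mono) (auto simp: divide_le_eq mult_le_cancel_left1 fact_ge_1)
  also have "\<dots> \<le> B * \<bar>s\<bar> ^ n"
    by (intro mult_right_mono B t(1)) auto
  finally show ?thesis
    using t(2) by simp
qed

text \<open>The Taylor coefficients at \<open>(0, 0)\<close> of \<open>f (x + s u + t w)\<close> as a function of \<open>(s, t)\<close>.\<close>

definition plane_coeff :: "('a::real_normed_vector \<Rightarrow> real) \<Rightarrow> 'a \<Rightarrow> 'a \<Rightarrow> 'a \<Rightarrow> nat \<Rightarrow> nat \<Rightarrow> real" where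
  "plane_coeff f x u w i j = iter_deriv (replicate i u @ replicate j w) f x / (fact i * fact j)"

text \<open>A polynomial in two variables is represented by its coefficient function; the polynomials, norms
  and sums below only see the triangle \<open>i + j < n\<close>, that is, degree less than \<open>n\<close>.\<close>

definition bipoly :: "nat \<Rightarrow> (nat \<Rightarrow> nat \<Rightarrow> real) \<Rightarrow> real \<Rightarrow> real \<Rightarrow> real" where
  "bipoly n b s t = (\<Sum>i<n. \<Sum>j<n-i. b i j * s ^ i * t ^ j)"

definition bipoly_norm :: "nat \<Rightarrow> (nat \<Rightarrow> nat \<Rightarrow> real) \<Rightarrow> real" where
  "bipoly_norm n b = (\<Sum>i<n. \<Sum>j<n-i. \<bar>b i j\<bar>)"

text \<open>The truncated exponents are harmless: where \<open>i - 2\<close> is not the true difference, the factor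
  \<open>i (i - 1)\<close> is zero.\<close>

definition bipoly_laplacian :: "nat \<Rightarrow> (nat \<Rightarrow> nat \<Rightarrow> real) \<Rightarrow> real \<Rightarrow> real \<Rightarrow> real" where
  "bipoly_laplacian n b s t = (\<Sum>i<n. \<Sum>j<n-i.
     b i j * (real i * real (i - 1) * s ^ (i - 2) * t ^ j + real j * real (j - 1) * s ^ i * t ^ (j - 2)))"

text \<open>Taylor's formula along \<open>u\<close> at the point \<open>x + t w\<close>, followed by Taylor's formula along \<open>w\<close> for each
  coefficient, up to the order that is still missing. The \<open>n + 1\<close> remainders all have total order \<open>n\<close>.\<close>

lemma taylor_plane:
  fixes f :: "'a::real_normed_vector \<Rightarrow> real"
  assumes f: "smooth_on U f"
    and U: "\<And>s t. \<bar>s\<bar> \<le> \<rho> \<Longrightarrow> \<bar>t\<bar> \<le> \<rho> \<Longrightarrow> x + s *\<^sub>R u + t *\<^sub>R w \<in> U"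
    and B: "\<And>i j s t. i + j = n \<Longrightarrow> \<bar>s\<bar> \<le> \<rho> \<Longrightarrow> \<bar>t\<bar> \<le> \<rho> \<Longrightarrow>
      \<bar>iter_deriv (replicate i u @ replicate j w) f (x + s *\<^sub>R u + t *\<^sub>R w)\<bar> \<le> B"
    and s: "\<bar>s\<bar> \<le> \<rho>" and t: "\<bar>t\<bar> \<le> \<rho>"
  shows "\<bar>f (x + s *\<^sub>R u + t *\<^sub>R w) - bipoly n (plane_coeff f x u w) s t\<bar> \<le> real (n + 1) * B * \<rho> ^ n"
proof -
  have \<rho>: "\<rho> \<ge> 0" using s by linarith
  have B0: "B \<ge> 0" using B[of 0 n 0 0] \<rho> by simp
  let ?h = "\<lambda>i. iter_deriv (replicate i u) f"
  let ?c = "plane_coeff f x u w"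
  have 1: "\<bar>f (x + t *\<^sub>R w + s *\<^sub>R u) - (\<Sum>i<n. ?h i (x + t *\<^sub>R w) / fact i * s ^ i)\<bar> \<le> B * \<bar>s\<bar> ^ n"
  proof (rule taylor_line[OF f])
    show "x + t *\<^sub>R w + \<sigma> *\<^sub>R u \<in> U" if "\<bar>\<sigma>\<bar> \<le> \<bar>s\<bar>" for \<sigma>
      using U[of \<sigma> t] that s t by (simp add: add_ac)
    show "\<bar>?h n (x + t *\<^sub>R w + \<sigma> *\<^sub>R u)\<bar> \<le> B" if "\<bar>\<sigma>\<bar> \<le> \<bar>s\<bar>" for \<sigma>
      using B[of n 0 \<sigma> t] that s t by (simp add: add_ac)
  qed
  have 2: "\<bar>?h i (x + t *\<^sub>R w) - (\<Sum>j<n-i. iter_deriv (replicate j w) (?h i) x / fact j * t ^ j)\<bar>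
      \<le> B * \<bar>t\<bar> ^ (n - i)" if "i < n" for i
  proof (rule taylor_line[OF smooth_on_iter_deriv[OF f]])
    show "x + \<tau> *\<^sub>R w \<in> U" if "\<bar>\<tau>\<bar> \<le> \<bar>t\<bar>" for \<tau>
      using U[of 0 \<tau>] that t \<rho> by simp
    show "\<bar>iter_deriv (replicate (n - i) w) (?h i) (x + \<tau> *\<^sub>R w)\<bar> \<le> B" if "\<bar>\<tau>\<bar> \<le> \<bar>t\<bar>" for \<tau>
      using B[of i "n - i" 0 \<tau>] that t \<rho> \<open>i < n\<close> by (simp add: iter_deriv_append)
  qed
  have 3: "\<bar>?h i (x + t *\<^sub>R w) / fact i * s ^ i - (\<Sum>j<n-i. ?c i j * s ^ i * t ^ j)\<bar> \<le> B * \<rho> ^ n"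
    if "i < n" for i
  proof -
    have "?h i (x + t *\<^sub>R w) / fact i * s ^ i - (\<Sum>j<n-i. ?c i j * s ^ i * t ^ j)
      = (?h i (x + t *\<^sub>R w) - (\<Sum>j<n-i. iter_deriv (replicate j w) (?h i) x / fact j * t ^ j)) * (s ^ i / fact i)"
      unfolding left_diff_distrib sum_distrib_right plane_coeff_def
      by (simp add: iter_deriv_append mult_ac)
    also have "\<bar>\<dots>\<bar> = \<bar>?h i (x + t *\<^sub>R w) - (\<Sum>j<n-i. iter_deriv (replicate j w) (?h i) x / fact j * t ^ j)\<bar> * (\<bar>s\<bar> ^ i / fact i)"
      by (simp add: abs_mult power_abs)
    also have "\<dots> \<le> (B * \<bar>t\<bar> ^ (n - i)) * (\<bar>s\<bar> ^ i)"
      by (intro mult_mono 2 that) (auto simp: divide_le_eq mult_le_cancel_left1 fact_ge_1 B0)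
    also have "\<dots> \<le> (B * \<rho> ^ (n - i)) * \<rho> ^ i"
      by (intro mult_mono power_mono s t) (auto simp: \<rho> B0)
    also have "\<dots> = B * \<rho> ^ n"
      using that by (simp add: mult.assoc flip: power_add)
    finally show ?thesis .
  qed
  have "\<bar>f (x + t *\<^sub>R w + s *\<^sub>R u) - bipoly n ?c s t\<bar>
      \<le> \<bar>f (x + t *\<^sub>R w + s *\<^sub>R u) - (\<Sum>i<n. ?h i (x + t *\<^sub>R w) / fact i * s ^ i)\<bar>
        + \<bar>\<Sum>i<n. ?h i (x + t *\<^sub>R w) / fact i * s ^ i - (\<Sum>j<n-i. ?c i j * s ^ i * t ^ j)\<bar>"
    unfolding bipoly_def sum_subtractf by linarith
  also have "\<dots> \<le> B * \<rho> ^ n + (\<Sum>i<n. B * \<rho> ^ n)"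
  proof (rule add_mono)
    show "\<bar>f (x + t *\<^sub>R w + s *\<^sub>R u) - (\<Sum>i<n. ?h i (x + t *\<^sub>R w) / fact i * s ^ i)\<bar> \<le> B * \<rho> ^ n"
      by (rule order_trans[OF 1]) (intro mult_left_mono power_mono s B0 abs_ge_zero)
    show "\<bar>\<Sum>i<n. ?h i (x + t *\<^sub>R w) / fact i * s ^ i - (\<Sum>j<n-i. ?c i j * s ^ i * t ^ j)\<bar> \<le> (\<Sum>i<n. B * \<rho> ^ n)"
      by (rule order_trans[OF sum_abs sum_mono]) (use 3 in auto)
  qed
  finally show ?thesis
    by (simp add: add_ac algebra_simps)
qed

lemma triangle_sum_shift1:
  fixes F :: "nat \<Rightarrow> nat \<Rightarrow> real"
  assumes "\<And>j. F 0 j = 0"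
  shows "(\<Sum>i<n. \<Sum>j<n-i. F i j) = (\<Sum>i<n-1. \<Sum>j<n-1-i. F (Suc i) j)"
  by (cases n) (simp_all add: sum.lessThan_Suc_shift assms del: sum.lessThan_Suc)

lemma triangle_sum_shift2:
  fixes F :: "nat \<Rightarrow> nat \<Rightarrow> real"
  assumes "\<And>i. F i 0 = 0"
  shows "(\<Sum>i<n. \<Sum>j<n-i. F i j) = (\<Sum>i<n-1. \<Sum>j<n-1-i. F i (Suc j))"
proof (cases n)
  case (Suc m)
  have "(\<Sum>j<Suc m-i. F i j) = (\<Sum>j<m-i. F i (Suc j))" if "i < Suc m" for i
    using that by (simp add: Suc_diff_le sum.lessThan_Suc_shift assms del: sum.lessThan_Suc)
  then show ?thesis by (simp add: Suc assms)
qed simp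

lemma plane_coeff_direction1:
  "plane_coeff (\<lambda>y. frechet_derivative f (at y) u) x u w i j = real (Suc i) * plane_coeff f x u w (Suc i) j"
  by (simp add: plane_coeff_def)

lemma plane_coeff_direction2:
  assumes "open U" "smooth_on U f" "x \<in> U"
  shows "plane_coeff (\<lambda>y. frechet_derivative f (at y) w) x u w i j = real (Suc j) * plane_coeff f x u w i (Suc j)"
  using iter_deriv_move[OF assms, of w i u "replicate j w"] by (simp add: plane_coeff_def)

text \<open>Taylor expansion commutes with the Laplacian. The order of differentiation in \<open>plane_coeff\<close> is \<open>u\<close>
  before \<open>w\<close>, so for the derivatives along \<open>w\<close> this rests on the symmetry of mixed derivatives.\<close>

lemma bipoly_laplacian_taylor:
  assumes "open U" "smooth_on U f" "x \<in> U"
  shows "bipoly (n-2) (plane_coeff (iter_deriv [u,u] f) x u w) s t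
       + bipoly (n-2) (plane_coeff (iter_deriv [w,w] f) x u w) s t
       = bipoly_laplacian n (plane_coeff f x u w) s t"
proof -
  let ?c = "plane_coeff f x u w"
  have 1: "plane_coeff (iter_deriv [u,u] f) x u w i j = real (i+2) * real (i+1) * ?c (i+2) j" for i j
    by (simp add: plane_coeff_direction1)
  have 2: "plane_coeff (iter_deriv [w,w] f) x u w i j = real (j+2) * real (j+1) * ?c i (j+2)" for i j
    by (simp add: plane_coeff_direction2[OF assms(1) smooth_on_direction[OF assms(2)] assms(3)]
      plane_coeff_direction2[OF assms])
  have "(\<Sum>i<n. \<Sum>j<n-i. ?c i j * (real i * real (i - 1) * s ^ (i - 2) * t ^ j))
      = bipoly (n-2) (plane_coeff (iter_deriv [u,u] f) x u w) s t"
    unfolding bipoly_def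
    by (subst triangle_sum_shift1, simp, subst triangle_sum_shift1, simp)
      (simp add: 1 mult_ac numeral_2_eq_2 diff_diff_left del: iter_deriv.simps of_nat_Suc)
  moreover have "(\<Sum>i<n. \<Sum>j<n-i. ?c i j * (real j * real (j - 1) * s ^ i * t ^ (j - 2)))
      = bipoly (n-2) (plane_coeff (iter_deriv [w,w] f) x u w) s t"
    unfolding bipoly_def
    by (subst triangle_sum_shift2, simp, subst triangle_sum_shift2, simp)
      (simp add: 2 mult_ac numeral_2_eq_2 diff_diff_left del: iter_deriv.simps of_nat_Suc)
  ultimately show ?thesis
    unfolding bipoly_laplacian_def distrib_left sum.distrib by simp
qed

lemma abs_bipoly_le:
  assumes "\<bar>s\<bar> \<le> \<rho>" "\<bar>t\<bar> \<le> \<rho>"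
  shows "\<bar>bipoly n b s t\<bar> \<le> bipoly_norm n (\<lambda>i j. b i j * \<rho> ^ (i + j))"
proof -
  have \<rho>: "\<rho> \<ge> 0" using assms by linarith
  have "\<bar>b i j * s ^ i * t ^ j\<bar> \<le> \<bar>b i j * \<rho> ^ (i + j)\<bar>" for i j
  proof -
    have "\<bar>b i j * s ^ i * t ^ j\<bar> = \<bar>b i j\<bar> * (\<bar>s\<bar> ^ i * \<bar>t\<bar> ^ j)"
      by (simp add: abs_mult power_abs)
    also have "\<dots> \<le> \<bar>b i j\<bar> * (\<rho> ^ i * \<rho> ^ j)"
      by (intro mult_left_mono mult_mono power_mono assms) (auto simp: \<rho>)
    finally show ?thesis
      by (simp add: power_add abs_mult \<rho>)
  qed
  then show ?thesis
    unfolding bipoly_def bipoly_norm_def by (intro order_trans[OF sum_abs sum_mono])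
qed

text \<open>At scale \<open>\<rho>\<close>, differentiation costs a factor \<open>n / \<rho>\<close> on the coefficients. This is what makes the
  gradient term in the differential inequality of lower order than the Laplacian.\<close>

lemma bipoly_norm_direction1:
  assumes "\<rho> \<ge> 0"
  shows "\<rho> * bipoly_norm (n-1) (\<lambda>i j. plane_coeff (\<lambda>y. frechet_derivative f (at y) u) x u w i j * \<rho> ^ (i + j))
    \<le> real n * bipoly_norm n (\<lambda>i j. plane_coeff f x u w i j * \<rho> ^ (i + j))"
proof -
  let ?c = "plane_coeff f x u w"
  have "\<rho> * bipoly_norm (n-1) (\<lambda>i j. plane_coeff (\<lambda>y. frechet_derivative f (at y) u) x u w i j * \<rho> ^ (i + j))
      = (\<Sum>i<n. \<Sum>j<n-i. real i * \<bar>?c i j * \<rho> ^ (i + j)\<bar>)"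
    unfolding bipoly_norm_def
    by (subst triangle_sum_shift1)
      (simp_all add: plane_coeff_direction1 abs_mult sum_distrib_left mult_ac assms)
  also have "\<dots> \<le> (\<Sum>i<n. \<Sum>j<n-i. real n * \<bar>?c i j * \<rho> ^ (i + j)\<bar>)"
    by (intro sum_mono mult_right_mono) auto
  finally show ?thesis
    by (simp add: bipoly_norm_def sum_distrib_left)
qed

lemma bipoly_norm_direction2:
  assumes "open U" "smooth_on U f" "x \<in> U" "\<rho> \<ge> 0"
  shows "\<rho> * bipoly_norm (n-1) (\<lambda>i j. plane_coeff (\<lambda>y. frechet_derivative f (at y) w) x u w i j * \<rho> ^ (i + j))
    \<le> real n * bipoly_norm n (\<lambda>i j. plane_coeff f x u w i j * \<rho> ^ (i + j))"
proof -
  let ?c = "plane_coeff f x u w"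
  have "\<rho> * bipoly_norm (n-1) (\<lambda>i j. plane_coeff (\<lambda>y. frechet_derivative f (at y) w) x u w i j * \<rho> ^ (i + j))
      = (\<Sum>i<n. \<Sum>j<n-i. real j * \<bar>?c i j * \<rho> ^ (i + j)\<bar>)"
    unfolding bipoly_norm_def
    by (subst triangle_sum_shift2)
      (simp_all add: plane_coeff_direction2[OF assms(1-3)] abs_mult sum_distrib_left mult_ac assms(4))
  also have "\<dots> \<le> (\<Sum>i<n. \<Sum>j<n-i. real n * \<bar>?c i j * \<rho> ^ (i + j)\<bar>)"
    by (intro sum_mono mult_right_mono) auto
  finally show ?thesis
    by (simp add: bipoly_norm_def sum_distrib_left)
qed

lemma bipoly_scale: "bipoly n (\<lambda>i j. b i j * \<rho> ^ (i + j)) s t = bipoly n b (\<rho> * s) (\<rho> * t)"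
  unfolding bipoly_def by (intro sum.cong refl) (simp add: power_add power_mult_distrib)

lemma bipoly_laplacian_scale:
  "bipoly_laplacian n (\<lambda>i j. b i j * \<rho> ^ (i + j)) s t = \<rho>\<^sup>2 * bipoly_laplacian n b (\<rho> * s) (\<rho> * t)"
proof -
  have *: "real i * real (i - 1) * (\<rho> ^ 2 * \<rho> ^ (i - 2)) = real i * real (i - 1) * \<rho> ^ i" for i
    by (cases i; cases "i - 1") (auto simp: power2_eq_square)
  have "b i j * \<rho> ^ (i + j) * (real i * real (i - 1) * s ^ (i - 2) * t ^ j + real j * real (j - 1) * s ^ i * t ^ (j - 2))
    = \<rho>\<^sup>2 * (b i j * (real i * real (i - 1) * (\<rho> * s) ^ (i - 2) * (\<rho> * t) ^ j
        + real j * real (j - 1) * (\<rho> * s) ^ i * (\<rho> * t) ^ (j - 2)))" for i j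
  proof -
    have "\<rho>\<^sup>2 * (b i j * (real i * real (i - 1) * (\<rho> * s) ^ (i - 2) * (\<rho> * t) ^ j
        + real j * real (j - 1) * (\<rho> * s) ^ i * (\<rho> * t) ^ (j - 2)))
      = b i j * ((real i * real (i - 1) * (\<rho> ^ 2 * \<rho> ^ (i - 2))) * \<rho> ^ j * s ^ (i - 2) * t ^ j
        + (real j * real (j - 1) * (\<rho> ^ 2 * \<rho> ^ (j - 2))) * \<rho> ^ i * s ^ i * t ^ (j - 2))"
      by (simp add: power_mult_distrib distrib_left mult_ac)
    then show ?thesis
      unfolding * by (simp add: power_add distrib_left mult_ac)
  qed
  then show ?thesis
    unfolding bipoly_laplacian_def sum_distrib_left by (intro sum.cong refl)
qed

section \<open>A quantitative maximum principle for polynomials in two variables\<close>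

lemma triangle_sum_by_degree:
  fixes F :: "nat \<Rightarrow> nat \<Rightarrow> real"
  shows "(\<Sum>i<n. \<Sum>j<n-i. F i j) = (\<Sum>d<n. \<Sum>i\<le>d. F i (d - i))"
proof -
  have "(\<Sum>i<n. \<Sum>j<n-i. F i j) = (\<Sum>(i,j)\<in>(SIGMA i:{..<n}. {..<n-i}). F i j)"
    by (rule sum.Sigma) auto
  also have "(SIGMA i:{..<n}. {..<n-i}) = {(i,j). i + j < n}"
    by auto
  finally show ?thesis
    by (simp add: sum.triangle_reindex)
qed

text \<open>Divide by \<open>\<rho>^d\<close> and let \<open>\<rho>\<close> tend to zero.\<close>

lemma lowest_coeff_nonpos:
  fixes c :: "nat \<Rightarrow> real"
  assumes le: "\<And>\<rho>. 0 < \<rho> \<Longrightarrow> \<rho> \<le> 1 \<Longrightarrow> (\<Sum>e<n. c e * \<rho> ^ e) \<le> 0"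
    and "\<And>e. e < d \<Longrightarrow> c e = 0" "d < n"
  shows "c d \<le> 0"
proof -
  define g where "g \<rho> = (\<Sum>e<n-d. c (d + e) * \<rho> ^ e)" for \<rho>
  have eq: "(\<Sum>e<n. c e * \<rho> ^ e) = \<rho> ^ d * g \<rho>" for \<rho>
  proof -
    have "{..<n} = {..<d} \<union> {d..<n}" using assms(3) by auto
    then have "(\<Sum>e<n. c e * \<rho> ^ e) = (\<Sum>e\<in>{d..<n}. c e * \<rho> ^ e)"
      by (simp add: sum.union_disjoint assms(2) ivl_disj_int)
    also have "\<dots> = (\<Sum>e\<in>{0..<n-d}. c (d + e) * \<rho> ^ (d + e))"
      using sum.shift_bounds_nat_ivl[of "\<lambda>e. c e * \<rho> ^ e" 0 d "n - d"] assms(3)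
      by (simp add: add.commute)
    finally show ?thesis
      by (simp add: g_def sum_distrib_left power_add mult_ac atLeast0LessThan)
  qed
  have "(g \<longlongrightarrow> g 0) (at_right 0)"
    unfolding g_def by (intro tendsto_intros)
  moreover have "\<forall>\<^sub>F \<rho> in at_right 0. g \<rho> \<le> 0"
    unfolding eventually_at_right_field
  proof (intro exI[of _ 1] conjI allI impI)
    fix \<rho> :: real assume "0 < \<rho>" "\<rho> < 1"
    then show "g \<rho> \<le> 0"
      using le[of \<rho>] zero_less_power[of \<rho> d] unfolding eq mult_le_0_iff by linarith
  qed simp
  ultimately have "g 0 \<le> 0"
    by (rule tendsto_upperbound) simp
  moreover have "g 0 = c d"
    using assms(3) by (cases "n - d") (simp_all add: g_def sum.lessThan_Suc_shift del: sum.lessThan_Suc)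
  ultimately show ?thesis by simp
qed

text \<open>The derivative \<open>q1\<close> is monotone and, by Rolle, has a zero in every period, so it vanishes.\<close>

lemma periodic_convex_imp_second_deriv_0:
  fixes q q1 q2 :: "real \<Rightarrow> real"
  assumes q: "\<And>x. (q has_real_derivative q1 x) (at x)"
    and q1: "\<And>x. (q1 has_real_derivative q2 x) (at x)"
    and "\<And>x. q2 x \<ge> 0" "p > 0" "\<And>x. q (x + p) = q x"
  shows "q2 x = 0"
proof -
  have mono: "q1 x \<le> q1 y" if "x \<le> y" for x y
    using DERIV_nonneg_imp_nondecreasing[OF that] q1 assms(3) by blast
  have zero: "\<exists>\<xi>. x < \<xi> \<and> \<xi> < x + p \<and> q1 \<xi> = 0" for x
    using MVT2[of x "x + p" q q1] q assms(4,5) by auto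
  have "q1 x = 0" for x
  proof -
    obtain \<xi> \<eta> where "\<xi> < x - p + p" "q1 \<xi> = 0" "x < \<eta>" "q1 \<eta> = 0"
      using zero[of x] zero[of "x - p"] by auto
    then show ?thesis
      using mono[of \<xi> x] mono[of x \<eta>] by simp
  qed
  then have "q1 = (\<lambda>x. 0)" by auto
  then show ?thesis
    using q1[of x] DERIV_unique DERIV_const by metis
qed

lemma bipoly_polar:
  "bipoly n b (\<rho> * cos \<theta>) (\<rho> * sin \<theta>) = (\<Sum>d<n. (\<Sum>i\<le>d. b i (d - i) * (cos \<theta> ^ i * sin \<theta> ^ (d - i))) * \<rho> ^ d)"
proof -
  have "bipoly n b (\<rho> * cos \<theta>) (\<rho> * sin \<theta>) = (\<Sum>d<n. \<Sum>i\<le>d. b i (d - i) * (\<rho> * cos \<theta>) ^ i * (\<rho> * sin \<theta>) ^ (d - i))"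
    unfolding bipoly_def by (rule triangle_sum_by_degree)
  also have "\<dots> = (\<Sum>d<n. (\<Sum>i\<le>d. b i (d - i) * (cos \<theta> ^ i * sin \<theta> ^ (d - i))) * \<rho> ^ d)"
    unfolding sum_distrib_right
  proof (intro sum.cong refl)
    fix d i :: nat assume "i \<in> {..d}"
    then have "\<rho> ^ d = \<rho> ^ i * \<rho> ^ (d - i)" by (simp flip: power_add)
    then show "b i (d - i) * (\<rho> * cos \<theta>) ^ i * (\<rho> * sin \<theta>) ^ (d - i) = b i (d - i) * (cos \<theta> ^ i * sin \<theta> ^ (d - i)) * \<rho> ^ d"
      by (simp add: power_mult_distrib mult_ac)
  qed
  finally show ?thesis .
qed

lemma bipoly_laplacian_polar:
  "\<rho>\<^sup>2 * bipoly_laplacian n b (\<rho> * cos \<theta>) (\<rho> * sin \<theta>) = (\<Sum>d<n. (\<Sum>i\<le>d. b i (d - i) *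
    (real i * real (i - 1) * cos \<theta> ^ (i - 2) * sin \<theta> ^ (d - i)
     + real (d - i) * real (d - i - 1) * cos \<theta> ^ i * sin \<theta> ^ (d - i - 2))) * \<rho> ^ d)"
  unfolding bipoly_laplacian_scale[symmetric] unfolding bipoly_laplacian_def triangle_sum_by_degree sum_distrib_right
  by (intro sum.cong refl) (simp add: mult_ac)

text \<open>The polar form of the Laplacian on the unit circle: if \<open>p\<close> is homogeneous of degree \<open>d\<close> and \<open>q\<close> is
  its restriction to the circle, then \<open>\<Delta>p = q'' + d\<^sup>2 q\<close> there.\<close>

lemma trig_monomial_derivs:
  fixes i j :: nat
  defines "m1 \<equiv> \<lambda>\<theta>::real. real j * (cos \<theta> ^ (i + 1) * sin \<theta> ^ (j - 1)) - real i * (cos \<theta> ^ (i - 1) * sin \<theta> ^ (j + 1))"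
  shows "((\<lambda>\<theta>. cos \<theta> ^ i * sin \<theta> ^ j) has_real_derivative m1 \<theta>) (at \<theta>)"
    and "(m1 has_real_derivative
      (real i * real (i - 1) * cos \<theta> ^ (i - 2) * sin \<theta> ^ j + real j * real (j - 1) * cos \<theta> ^ i * sin \<theta> ^ (j - 2)
       - (real (i + j))\<^sup>2 * (cos \<theta> ^ i * sin \<theta> ^ j))) (at \<theta>)"
proof -
  have d: "((\<lambda>\<theta>. cos \<theta> ^ i * sin \<theta> ^ j) has_real_derivative
      real j * (cos \<theta> ^ (i + 1) * sin \<theta> ^ (j - 1)) - real i * (cos \<theta> ^ (i - 1) * sin \<theta> ^ (j + 1))) (at \<theta>)" for i j and \<theta> :: real
    by (auto intro!: derivative_eq_intros simp: algebra_simps)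
  show "((\<lambda>\<theta>. cos \<theta> ^ i * sin \<theta> ^ j) has_real_derivative m1 \<theta>) (at \<theta>)"
    unfolding m1_def by (rule d)
  define c s where "c = cos \<theta>" and "s = sin \<theta>"
  have cs: "s * s = 1 - c * c"
    using sin_squared_eq[of \<theta>] by (simp add: c_def s_def power2_eq_square)
  have "(m1 has_real_derivative
      real j * (real (j - 1) * (c ^ (i + 1 + 1) * s ^ (j - 1 - 1)) - real (i + 1) * (c ^ (i + 1 - 1) * s ^ (j - 1 + 1)))
      - real i * (real (j + 1) * (c ^ (i - 1 + 1) * s ^ (j + 1 - 1)) - real (i - 1) * (c ^ (i - 1 - 1) * s ^ (j + 1 + 1)))) (at \<theta>)"
    unfolding m1_def c_def s_def by (intro DERIV_diff DERIV_cmult d)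
  moreover have "real j * (real (j - 1) * (c ^ (i + 1 + 1) * s ^ (j - 1 - 1)) - real (i + 1) * (c ^ (i + 1 - 1) * s ^ (j - 1 + 1)))
      - real i * (real (j + 1) * (c ^ (i - 1 + 1) * s ^ (j + 1 - 1)) - real (i - 1) * (c ^ (i - 1 - 1) * s ^ (j + 1 + 1)))
    = real i * real (i - 1) * c ^ (i - 2) * s ^ j + real j * real (j - 1) * c ^ i * s ^ (j - 2)
       - (real (i + j))\<^sup>2 * (c ^ i * s ^ j)"
  proof -
    have 1: "real j * real (j - 1) * (c ^ (i + 2) * s ^ (j - 2)) = real j * real (j - 1) * (c ^ i * s ^ (j - 2) - c ^ i * s ^ j)"
    proof (cases "j \<ge> 2")
      case True
      then have "s ^ j = s ^ (j - 2) * (s * s)" by (simp flip: power_Suc2 add: Suc_diff_Suc numeral_2_eq_2 mult.assoc[symmetric])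
      then have sj: "s ^ j = s ^ (j - 2) * (1 - c * c)" by (simp only: cs)
      show ?thesis unfolding sj by (simp add: algebra_simps)
    next
      case False
      then have "j = 0 \<or> j = 1" by auto
      then show ?thesis by auto
    qed
    have 2: "real i * real (i - 1) * (c ^ (i - 2) * s ^ (j + 2)) = real i * real (i - 1) * (c ^ (i - 2) * s ^ j - c ^ i * s ^ j)"
    proof (cases "i \<ge> 2")
      case True
      then have ci: "c ^ i = c ^ (i - 2) * (c * c)" by (simp flip: power_Suc2 add: Suc_diff_Suc numeral_2_eq_2 mult.assoc[symmetric])
      have sj: "s ^ (j + 2) = s ^ j * (1 - c * c)" by (simp flip: cs add: power2_eq_square)
      show ?thesis unfolding ci sj by (simp add: algebra_simps)
    next
      case False
      then have "i = 0 \<or> i = 1" by auto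
      then show ?thesis by auto
    qed
    have 3: "real j * (real (i + 1) * (c ^ i * s ^ (j - 1 + 1))) = real j * real (i + 1) * (c ^ i * s ^ j)"
      by (cases j) auto
    have 4: "real i * (real (j + 1) * (c ^ (i - 1 + 1) * s ^ j)) = real i * real (j + 1) * (c ^ i * s ^ j)"
      by (cases i) auto
    have 5: "real i * real (i - 1) = real i * (real i - 1)" "real j * real (j - 1) = real j * (real j - 1)"
      by (cases i; simp) (cases j; simp)
    have "real j * (real (j - 1) * (c ^ (i + 1 + 1) * s ^ (j - 1 - 1)) - real (i + 1) * (c ^ (i + 1 - 1) * s ^ (j - 1 + 1)))
      - real i * (real (j + 1) * (c ^ (i - 1 + 1) * s ^ (j + 1 - 1)) - real (i - 1) * (c ^ (i - 1 - 1) * s ^ (j + 1 + 1)))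
      = real j * real (j - 1) * (c ^ (i + 2) * s ^ (j - 2)) - real j * (real (i + 1) * (c ^ i * s ^ (j - 1 + 1)))
       - real i * (real (j + 1) * (c ^ (i - 1 + 1) * s ^ j)) + real i * real (i - 1) * (c ^ (i - 2) * s ^ (j + 2))"
      by (simp add: right_diff_distrib mult.assoc numeral_2_eq_2)
    also have "\<dots> = real i * real (i - 1) * c ^ (i - 2) * s ^ j + real j * real (j - 1) * c ^ i * s ^ (j - 2)
       - (real i * real (i - 1) + real j * real (j - 1) + real j * real (i + 1) + real i * real (j + 1)) * (c ^ i * s ^ j)"
      unfolding 1 2 3 4 by (simp only: algebra_simps)
    also have "real i * real (i - 1) + real j * real (j - 1) + real j * real (i + 1) + real i * real (j + 1) = (real (i + j))\<^sup>2"
      unfolding 5 by (simp add: power2_eq_square algebra_simps)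
    finally show ?thesis .
  qed
  ultimately show "(m1 has_real_derivative
      (real i * real (i - 1) * cos \<theta> ^ (i - 2) * sin \<theta> ^ j + real j * real (j - 1) * cos \<theta> ^ i * sin \<theta> ^ (j - 2)
       - (real (i + j))\<^sup>2 * (cos \<theta> ^ i * sin \<theta> ^ j))) (at \<theta>)"
    by (simp add: c_def s_def)
qed

text \<open>The homogeneous part \<open>p\<close> of lowest degree \<open>d\<close> inherits both sign conditions, as \<open>\<rho>\<close> tends to zero
  along each ray. With \<open>q\<close> its restriction to the unit circle, \<open>q \<le> 0\<close> and \<open>q'' + d\<^sup>2 q \<ge> 0\<close> give
  \<open>q'' \<ge> 0\<close>. A convex periodic function has \<open>q'' = 0\<close>, so also \<open>q \<ge> 0\<close>; hence \<open>q = 0\<close> and the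
  coefficients of \<open>p\<close> vanish. The assumption on \<open>b 0 0\<close> starts the induction on \<open>d\<close>.\<close>

lemma bipoly_strong_max_principle:
  assumes T: "\<And>s t. s\<^sup>2 + t\<^sup>2 \<le> 1 \<Longrightarrow> bipoly n b s t \<le> 0"
    and L: "\<And>s t. s\<^sup>2 + t\<^sup>2 \<le> 1 \<Longrightarrow> bipoly_laplacian n b s t \<ge> 0"
    and "b 0 0 = 0"
  shows "bipoly_norm n b = 0"
proof -
  define q where "q d \<theta> = (\<Sum>i\<le>d. b i (d - i) * (cos \<theta> ^ i * sin \<theta> ^ (d - i)))" for d and \<theta> :: real
  define l where "l d \<theta> = (\<Sum>i\<le>d. b i (d - i) * (real i * real (i - 1) * cos \<theta> ^ (i - 2) * sin \<theta> ^ (d - i)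
     + real (d - i) * real (d - i - 1) * cos \<theta> ^ i * sin \<theta> ^ (d - i - 2)))" for d and \<theta> :: real
  have disc: "(\<rho> * cos \<theta>)\<^sup>2 + (\<rho> * sin \<theta>)\<^sup>2 \<le> 1" if "0 < \<rho>" "\<rho> \<le> 1" for \<rho> \<theta> :: real
  proof -
    have "(\<rho> * cos \<theta>)\<^sup>2 + (\<rho> * sin \<theta>)\<^sup>2 = \<rho>\<^sup>2"
      by (simp add: power_mult_distrib flip: distrib_left)
    then show ?thesis using that by (simp add: power_le_one)
  qed
  have coeff0: "\<forall>i\<le>d. b i (d - i) = 0" if "d < n" for d
    using that
  proof (induction d rule: less_induct)
    case (less d)
    have q0: "q e \<theta> = 0" and l0: "l e \<theta> = 0" if "e < d" for e \<theta>
      using less.IH[OF that] that less.prems by (simp_all add: q_def l_def)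
    have qle: "q d \<theta> \<le> 0" for \<theta>
    proof (rule lowest_coeff_nonpos[where c = "\<lambda>e. q e \<theta>" and n = n])
      show "(\<Sum>e<n. q e \<theta> * \<rho> ^ e) \<le> 0" if "0 < \<rho>" "\<rho> \<le> 1" for \<rho>
        using T[OF disc[OF that]] unfolding bipoly_polar q_def .
    qed (use q0 less.prems in auto)
    have "- l d \<theta> \<le> 0" for \<theta>
    proof (rule lowest_coeff_nonpos[where c = "\<lambda>e. - l e \<theta>" and n = n])
      show "(\<Sum>e<n. - l e \<theta> * \<rho> ^ e) \<le> 0" if "0 < \<rho>" "\<rho> \<le> 1" for \<rho>
      proof -
        have "0 \<le> \<rho>\<^sup>2 * bipoly_laplacian n b (\<rho> * cos \<theta>) (\<rho> * sin \<theta>)"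
          using L[OF disc[OF that]] by simp
        then show ?thesis
          unfolding bipoly_laplacian_polar l_def by (simp add: sum_negf)
      qed
    qed (use l0 less.prems in auto)
    then have lge: "l d \<theta> \<ge> 0" for \<theta> by simp
    show ?case
    proof (cases "d = 0")
      case True
      then show ?thesis using assms(3) by simp
    next
      case False
      define q1 where "q1 \<theta> = (\<Sum>i\<le>d. b i (d - i) * (real (d - i) * (cos \<theta> ^ (i + 1) * sin \<theta> ^ (d - i - 1))
          - real i * (cos \<theta> ^ (i - 1) * sin \<theta> ^ (d - i + 1))))" for \<theta> :: real
      have d1: "(q d has_real_derivative q1 \<theta>) (at \<theta>)" for \<theta>
        unfolding q_def q1_def by (intro DERIV_sum DERIV_cmult trig_monomial_derivs(1))
      have "(q1 has_real_derivative (\<Sum>i\<le>d. b i (d - i) *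
         (real i * real (i - 1) * cos \<theta> ^ (i - 2) * sin \<theta> ^ (d - i) + real (d - i) * real (d - i - 1) * cos \<theta> ^ i * sin \<theta> ^ (d - i - 2)
       - (real (i + (d - i)))\<^sup>2 * (cos \<theta> ^ i * sin \<theta> ^ (d - i))))) (at \<theta>)" for \<theta>
        unfolding q1_def by (intro DERIV_sum DERIV_cmult trig_monomial_derivs(2))
      moreover have "(\<Sum>i\<le>d. b i (d - i) *
         (real i * real (i - 1) * cos \<theta> ^ (i - 2) * sin \<theta> ^ (d - i) + real (d - i) * real (d - i - 1) * cos \<theta> ^ i * sin \<theta> ^ (d - i - 2)
       - (real (i + (d - i)))\<^sup>2 * (cos \<theta> ^ i * sin \<theta> ^ (d - i)))) = l d \<theta> - (real d)\<^sup>2 * q d \<theta>" for \<theta>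
        unfolding l_def q_def sum_distrib_left sum_subtractf[symmetric]
        by (intro sum.cong refl) (simp add: algebra_simps)
      ultimately have d2: "(q1 has_real_derivative l d \<theta> - (real d)\<^sup>2 * q d \<theta>) (at \<theta>)" for \<theta>
        by simp
      have "l d \<theta> - (real d)\<^sup>2 * q d \<theta> \<ge> 0" for \<theta>
        using lge[of \<theta>] mult_nonneg_nonpos[OF zero_le_power2[of "real d"] qle[of \<theta>]] by simp
      from periodic_convex_imp_second_deriv_0[OF d1 d2 this, of "2 * pi"]
      have "l d \<theta> - (real d)\<^sup>2 * q d \<theta> = 0" for \<theta>
        by (simp add: q_def)
      then have "(real d)\<^sup>2 * q d \<theta> \<ge> 0" for \<theta>
        using lge[of \<theta>] by (simp add: algebra_simps)
      then have qz: "q d \<theta> = 0" for \<theta>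
        using False qle[of \<theta>] by (simp add: zero_le_mult_iff) (metis order_antisym)
      have "(\<Sum>i\<le>d. b i (d - i) * x ^ i) = 0" for x
      proof -
        \<comment> \<open>chosen so that \<open>cos \<theta> = x sin \<theta>\<close> with \<open>sin \<theta> > 0\<close>\<close>
        define \<theta> where "\<theta> = pi / 2 - arctan x"
        have s: "sin \<theta> = cos (arctan x)" and c: "cos \<theta> = x * cos (arctan x)"
          unfolding \<theta>_def
          by (simp_all add: sin_diff cos_diff sin_arctan cos_arctan)
        have "q d \<theta> = cos (arctan x) ^ d * (\<Sum>i\<le>d. b i (d - i) * x ^ i)"
          unfolding q_def s c sum_distrib_left
        proof (intro sum.cong refl)
          fix i assume "i \<in> {..d}"
          then have "cos (arctan x) ^ d = cos (arctan x) ^ i * cos (arctan x) ^ (d - i)"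
            by (simp flip: power_add)
          then show "b i (d - i) * ((x * cos (arctan x)) ^ i * cos (arctan x) ^ (d - i))
              = cos (arctan x) ^ d * (b i (d - i) * x ^ i)"
            by (simp add: power_mult_distrib mult_ac)
        qed
        moreover have "cos (arctan x) \<noteq> 0"
          by (simp add: cos_arctan_not_zero)
        ultimately show ?thesis
          using qz[of \<theta>] by simp
      qed
      then show ?thesis
        using polyfun_eq_0[of "\<lambda>i. b i (d - i)" d] by blast
    qed
  qed
  show ?thesis
    unfolding bipoly_norm_def triangle_sum_by_degree
    by (intro sum.neutral ballI) (use coeff0 in simp)
qed

lemma common_convergent_subseq:
  fixes X :: "'i \<Rightarrow> nat \<Rightarrow> real"
  assumes "finite I" "\<And>p k. p \<in> I \<Longrightarrow> \<bar>X p k\<bar> \<le> C"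
  shows "\<exists>s. strict_mono s \<and> (\<forall>p\<in>I. convergent (X p \<circ> s))"
  using assms
proof (induction I rule: finite_induct)
  case empty
  show ?case using strict_mono_id by blast
next
  case (insert p I)
  then have "\<exists>s. strict_mono s \<and> (\<forall>q\<in>I. convergent (X q \<circ> s))"
    by blast
  then obtain s where s: "strict_mono s" "\<And>q. q \<in> I \<Longrightarrow> convergent (X q \<circ> s)"
    by blast
  have "bounded (range (X p \<circ> s))"
    using insert.prems by (auto simp: bounded_iff)
  then obtain l s' where s': "strict_mono s'" "((X p \<circ> s) \<circ> s') \<longlonglongrightarrow> l"
    using bounded_imp_convergent_subsequence by blast
  have "convergent (X q \<circ> (s \<circ> s'))" if "q \<in> insert p I" for q
  proof (cases "q = p")
    case True
    then show ?thesis using s'(2) by (auto simp: convergent_def o_assoc)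
  next
    case False
    then show ?thesis
      using convergent_subseq_convergent[OF s(2) s'(1)] that by (auto simp: o_assoc)
  qed
  then show ?case
    using strict_mono_o[OF s(1) s'(1)] by blast
qed

text \<open>A quantitative form of the maximum principle, by compactness: polynomials of norm \<open>1\<close> violating
  it for smaller and smaller \<open>\<epsilon>\<close> have a convergent subsequence, whose limit contradicts the strong
  maximum principle.\<close>

lemma bipoly_max_or_laplacian:
  "\<exists>\<epsilon>>0. \<forall>b. b 0 0 = 0 \<longrightarrow>
     (\<exists>s t. s\<^sup>2 + t\<^sup>2 \<le> 1 \<and> \<epsilon> * bipoly_norm n b \<le> bipoly n b s t) \<or>
     (\<exists>s t. s\<^sup>2 + t\<^sup>2 \<le> 1 \<and> bipoly_laplacian n b s t \<le> - \<epsilon> * bipoly_norm n b)"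
proof (rule ccontr)
  assume "\<not> ?thesis"
  then have "\<forall>m. \<exists>b. b 0 0 = 0 \<and>
     (\<forall>s t. s\<^sup>2 + t\<^sup>2 \<le> 1 \<longrightarrow> bipoly n b s t < inverse (real (Suc m)) * bipoly_norm n b) \<and>
     (\<forall>s t. s\<^sup>2 + t\<^sup>2 \<le> 1 \<longrightarrow> - inverse (real (Suc m)) * bipoly_norm n b < bipoly_laplacian n b s t)"
    by (metis (no_types, lifting) inverse_positive_iff_positive not_le of_nat_0_less_iff zero_less_Suc)
  then obtain b where b0: "\<And>m. b m 0 0 = (0::real)"
    and bT: "\<And>m s t. s\<^sup>2 + t\<^sup>2 \<le> 1 \<Longrightarrow> bipoly n (b m) s t < inverse (real (Suc m)) * bipoly_norm n (b m)"
    and bL: "\<And>m s t. s\<^sup>2 + t\<^sup>2 \<le> 1 \<Longrightarrow> - inverse (real (Suc m)) * bipoly_norm n (b m) < bipoly_laplacian n (b m) s t"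
    by metis
  have pos: "bipoly_norm n (b m) > 0" for m
  proof -
    have "bipoly n (b m) 0 0 = 0"
      unfolding bipoly_def using b0[of m]
      by (intro sum.neutral ballI) (auto simp: power_0_left)
    then show ?thesis
      using bT[of 0 0 m] by (simp add: zero_less_mult_iff)
  qed
  define B where "B m i j = b m i j / bipoly_norm n (b m)" for m i j
  have BT: "bipoly n (B m) s t \<le> inverse (real (Suc m))" if "s\<^sup>2 + t\<^sup>2 \<le> 1" for m s t
  proof -
    have "bipoly n (B m) s t = bipoly n (b m) s t / bipoly_norm n (b m)"
      unfolding bipoly_def B_def by (simp add: sum_divide_distrib)
    then show ?thesis
      using bT[OF that, of m] pos[of m] by (simp add: divide_le_eq)
  qed
  have BL: "- inverse (real (Suc m)) \<le> bipoly_laplacian n (B m) s t" if "s\<^sup>2 + t\<^sup>2 \<le> 1" for m s t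
  proof -
    have "bipoly_laplacian n (B m) s t = bipoly_laplacian n (b m) s t / bipoly_norm n (b m)"
      unfolding bipoly_laplacian_def B_def by (simp add: sum_divide_distrib)
    then show ?thesis
      using bL[OF that, of m] pos[of m] by (simp add: le_divide_eq)
  qed
  have BN: "bipoly_norm n (B m) = 1" for m
  proof -
    have "bipoly_norm n (B m) = (\<Sum>i<n. \<Sum>j<n-i. \<bar>b m i j\<bar> / bipoly_norm n (b m))"
      using pos[of m] by (simp add: bipoly_norm_def[of n "B m"] B_def)
    also have "\<dots> = bipoly_norm n (b m) / bipoly_norm n (b m)"
      by (simp only: sum_divide_distrib[symmetric] bipoly_norm_def[symmetric])
    finally show ?thesis using pos[of m] by simp
  qed
  define I where "I = (SIGMA i:{..<n}. {..<n-i})"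
  have I: "(\<Sum>i<n. \<Sum>j<n-i. F i j) = (\<Sum>p\<in>I. F (fst p) (snd p))" for F :: "nat \<Rightarrow> nat \<Rightarrow> real"
    unfolding I_def by (subst sum.Sigma) (auto simp: case_prod_unfold)
  have finI: "finite I" by (simp add: I_def)
  have Ble: "\<bar>B m (fst p) (snd p)\<bar> \<le> 1" if "p \<in> I" for p m
    using member_le_sum[of p I "\<lambda>p. \<bar>B m (fst p) (snd p)\<bar>"] that finI BN[of m]
    unfolding bipoly_norm_def I by simp
  obtain \<sigma> where \<sigma>: "strict_mono \<sigma>" "\<And>p. p \<in> I \<Longrightarrow> convergent ((\<lambda>m. B m (fst p) (snd p)) \<circ> \<sigma>)"
    using common_convergent_subseq[OF finI, of "\<lambda>p m. B m (fst p) (snd p)"] Ble by blast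
  define L where "L i j = (if (i, j) \<in> I then lim (\<lambda>m. B (\<sigma> m) i j) else 0)" for i j
  have lim: "(\<lambda>m. B (\<sigma> m) (fst p) (snd p)) \<longlonglongrightarrow> L (fst p) (snd p)" if "p \<in> I" for p
    using \<sigma>(2)[OF that] that by (simp add: L_def convergent_LIMSEQ_iff o_def)
  have inv: "(\<lambda>m. inverse (real (Suc (\<sigma> m)))) \<longlonglongrightarrow> 0"
    using LIMSEQ_subseq_LIMSEQ[OF LIMSEQ_inverse_real_of_nat \<sigma>(1)] by (simp add: o_def)
  have "(\<lambda>m. bipoly_norm n (B (\<sigma> m))) \<longlonglongrightarrow> bipoly_norm n L"
    unfolding bipoly_norm_def I by (intro tendsto_sum tendsto_rabs lim)
  then have "bipoly_norm n L = 1"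
    by (simp add: BN LIMSEQ_const_iff)
  moreover have "bipoly_norm n L = 0"
  proof (rule bipoly_strong_max_principle)
    fix s t :: real assume st: "s\<^sup>2 + t\<^sup>2 \<le> 1"
    have "(\<lambda>m. bipoly n (B (\<sigma> m)) s t) \<longlonglongrightarrow> bipoly n L s t"
      unfolding bipoly_def I by (intro tendsto_sum tendsto_mult_right lim)
    then show "bipoly n L s t \<le> 0"
      by (rule LIMSEQ_le[OF _ inv]) (use BT[OF st] in auto)
    have "(\<lambda>m. bipoly_laplacian n (B (\<sigma> m)) s t) \<longlonglongrightarrow> bipoly_laplacian n L s t"
      unfolding bipoly_laplacian_def I by (intro tendsto_sum tendsto_mult_right lim)
    then show "0 \<le> bipoly_laplacian n L s t"
      using LIMSEQ_le[OF tendsto_minus[OF inv]] BL[OF st] by auto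
  next
    show "L 0 0 = 0"
      unfolding L_def using b0 by (simp add: B_def lim_const)
  qed
  ultimately show False by simp
qed

section \<open>Almost subharmonic functions of finite order\<close>

lemma bipoly_norm_mono:
  assumes "0 \<le> \<rho>" "\<rho> \<le> \<rho>'"
  shows "bipoly_norm n (\<lambda>i j. b i j * \<rho> ^ (i + j)) \<le> bipoly_norm n (\<lambda>i j. b i j * \<rho>' ^ (i + j))"
  unfolding bipoly_norm_def using assms
  by (intro sum_mono) (auto simp: abs_mult intro!: mult_left_mono power_mono)

lemma bipoly_norm_double:
  assumes "0 \<le> \<rho>"
  shows "bipoly_norm n (\<lambda>i j. b i j * (2 * \<rho>) ^ (i + j)) \<le> 2 ^ n * bipoly_norm n (\<lambda>i j. b i j * \<rho> ^ (i + j))"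
  unfolding bipoly_norm_def sum_distrib_left
proof (intro sum_mono)
  fix i j assume "i \<in> {..<n}" "j \<in> {..<n-i}"
  then have "(2::real) ^ (i + j) \<le> 2 ^ n"
    by (intro power_increasing) auto
  then have "\<bar>b i j\<bar> * \<rho> ^ (i + j) * 2 ^ (i + j) \<le> \<bar>b i j\<bar> * \<rho> ^ (i + j) * 2 ^ n"
    using assms by (intro mult_left_mono) auto
  then show "\<bar>b i j * (2 * \<rho>) ^ (i + j)\<bar> \<le> 2 ^ n * \<bar>b i j * \<rho> ^ (i + j)\<bar>"
    using assms by (simp add: abs_mult power_mult_distrib mult_ac)
qed

lemma bipoly_norm_lower:
  assumes "0 \<le> \<rho>" "\<rho> \<le> 1"
  shows "\<rho> ^ (n-1) * bipoly_norm n b \<le> bipoly_norm n (\<lambda>i j. b i j * \<rho> ^ (i + j))"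
  unfolding bipoly_norm_def sum_distrib_left
proof (intro sum_mono)
  fix i j assume "i \<in> {..<n}" "j \<in> {..<n-i}"
  then have "\<rho> ^ (n-1) \<le> \<rho> ^ (i + j)"
    using assms by (intro power_decreasing) auto
  then show "\<rho> ^ (n-1) * \<bar>b i j\<bar> \<le> \<bar>b i j * \<rho> ^ (i + j)\<bar>"
    using assms mult_left_mono[of "\<rho> ^ (n-1)" "\<rho> ^ (i + j)" "\<bar>b i j\<bar>"] by (simp add: abs_mult mult_ac)
qed

lemma bipoly_norm_upper:
  assumes "0 \<le> \<rho>" "\<rho> \<le> 1" "b 0 0 = 0"
  shows "bipoly_norm n (\<lambda>i j. b i j * \<rho> ^ (i + j)) \<le> \<rho> * bipoly_norm n b"
  unfolding bipoly_norm_def sum_distrib_left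
proof (intro sum_mono)
  fix i j assume "i \<in> {..<n}" "j \<in> {..<n-i}"
  show "\<bar>b i j * \<rho> ^ (i + j)\<bar> \<le> \<rho> * \<bar>b i j\<bar>"
  proof (cases "i + j = 0")
    case False
    then have "\<rho> ^ (i + j) \<le> \<rho> ^ 1"
      using assms by (intro power_decreasing) auto
    then show ?thesis
      using assms mult_left_mono[of "\<rho> ^ (i + j)" "\<rho> ^ 1" "\<bar>b i j\<bar>"] by (simp add: abs_mult mult_ac)
  qed (use assms in simp)
qed

lemma unit_disc_scaled:
  fixes s t \<rho> :: real
  assumes "s\<^sup>2 + t\<^sup>2 \<le> 1" "0 \<le> \<rho>"
  shows "\<bar>\<rho> * s\<bar> \<le> \<rho>" "\<bar>\<rho> * t\<bar> \<le> \<rho>"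
proof -
  have "s\<^sup>2 \<le> 1" "t\<^sup>2 \<le> 1"
    using assms(1) zero_le_power2[of s] zero_le_power2[of t] by linarith+
  then have "\<bar>s\<bar> \<le> 1" "\<bar>t\<bar> \<le> 1"
    by (simp_all add: abs_square_le_1)
  then show "\<bar>\<rho> * s\<bar> \<le> \<rho>" "\<bar>\<rho> * t\<bar> \<le> \<rho>"
    using assms(2) by (simp_all add: abs_mult mult_left_le)
qed

text \<open>The hypotheses on a function on the plane through \<open>x\<close> spanned by \<open>u\<close> and \<open>w\<close> under which the
  maximum on small discs can be estimated with constants depending only on \<open>n\<close>, \<open>B\<close>, \<open>C\<close>, \<open>a\<close> and \<open>\<rho>1\<close>.\<close>

definition almost_subharmonic_plane ::
  "nat \<Rightarrow> real \<Rightarrow> real \<Rightarrow> real \<Rightarrow> real \<Rightarrow> 'a set \<Rightarrow> ('a::real_normed_vector \<Rightarrow> real) \<Rightarrow> 'a \<Rightarrow> 'a \<Rightarrow> 'a \<Rightarrow> bool" where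
  "almost_subharmonic_plane n B C a \<rho>1 U f x u w \<longleftrightarrow>
     open U \<and> smooth_on U f \<and> f x = 0 \<and> a \<le> bipoly_norm n (plane_coeff f x u w) \<and>
     (\<forall>s t. \<bar>s\<bar> \<le> \<rho>1 \<longrightarrow> \<bar>t\<bar> \<le> \<rho>1 \<longrightarrow> (let z = x + s *\<^sub>R u + t *\<^sub>R w in
        z \<in> U \<and>
        (\<forall>us. set us \<subseteq> {u, w} \<longrightarrow> length us = n \<longrightarrow> \<bar>iter_deriv us f z\<bar> \<le> B) \<and>
        - C * (\<bar>f z\<bar> + \<bar>iter_deriv [u] f z\<bar> + \<bar>iter_deriv [w] f z\<bar>)
          \<le> iter_deriv [u, u] f z + iter_deriv [w, w] f z))"

text \<open>At scale \<open>\<rho>\<close> the Taylor polynomial of degree less than \<open>n\<close> has norm \<open>N \<ge> c \<rho>^(n-1)\<close>, while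
  all errors are \<open>O(\<rho>^n) = O(\<rho> N)\<close>. The differential inequality bounds the Laplacian of the rescaled
  polynomial below by \<open>- O(\<rho> N)\<close>, which for small \<open>\<rho>\<close> excludes the second alternative of
  \<open>bipoly_max_or_laplacian\<close>; the first one transfers from the polynomial to \<open>f\<close>.\<close>

lemma almost_subharmonic_max_bound:
  fixes n :: nat and B C c :: real
  assumes n: "n \<ge> 2" and "B \<ge> 0" "C \<ge> 0" "c > 0" "\<rho>1 > 0"
  shows "\<exists>\<kappa>>0. \<exists>K>0. \<exists>\<rho>0>0. \<rho>0 \<le> 1 \<and> \<rho>0 \<le> \<rho>1 \<and>
    (\<forall>U (f :: 'a::real_normed_vector \<Rightarrow> real) x u w \<rho>.
      almost_subharmonic_plane n B C c \<rho>1 U f x u w \<longrightarrow> 0 < \<rho> \<longrightarrow> \<rho> \<le> \<rho>0 \<longrightarrow>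
        (\<exists>s t. s\<^sup>2 + t\<^sup>2 \<le> \<rho>\<^sup>2 \<and>
           \<kappa> * bipoly_norm n (\<lambda>i j. plane_coeff f x u w i j * \<rho> ^ (i + j)) \<le> f (x + s *\<^sub>R u + t *\<^sub>R w)) \<and>
        (\<forall>s t. \<bar>s\<bar> \<le> \<rho> \<longrightarrow> \<bar>t\<bar> \<le> \<rho> \<longrightarrow>
           f (x + s *\<^sub>R u + t *\<^sub>R w) \<le> K * bipoly_norm n (\<lambda>i j. plane_coeff f x u w i j * \<rho> ^ (i + j))))"
proof -
  obtain \<epsilon> where \<epsilon>: "\<epsilon> > 0" "\<And>b. b 0 0 = 0 \<Longrightarrow>
     (\<exists>s t. s\<^sup>2 + t\<^sup>2 \<le> 1 \<and> \<epsilon> * bipoly_norm n b \<le> bipoly n b s t) \<or>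
     (\<exists>s t. s\<^sup>2 + t\<^sup>2 \<le> 1 \<and> bipoly_laplacian n b s t \<le> - \<epsilon> * bipoly_norm n b)"
    using bipoly_max_or_laplacian[of n] by blast
  define E where "E = real (n + 1) * B / c"
  define M where "M = C * (2 * real n + 1 + 3 * E) + 2 * E + 1"
  \<comment> \<open>\<open>M \<rho> N\<close> will bound the total error at scale \<open>\<rho>\<close>\<close>
  define \<rho>0 where "\<rho>0 = min (min 1 \<rho>1) (\<epsilon> / (2 * M))"
  have E: "E \<ge> 0" using assms by (simp add: E_def)
  have M: "M \<ge> 2 * E + 1" "M > 0"
    using E \<open>C \<ge> 0\<close> by (simp_all add: M_def add_nonneg_pos)
  have \<rho>0: "0 < \<rho>0" "\<rho>0 \<le> 1" "\<rho>0 \<le> \<rho>1" "\<rho>0 * M \<le> \<epsilon> / 2"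
  proof -
    have "\<rho>0 \<le> \<epsilon> / (2 * M)" by (simp add: \<rho>0_def)
    then show "\<rho>0 * M \<le> \<epsilon> / 2" using M(2) by (simp add: field_simps)
  qed (use M \<epsilon> assms in \<open>auto simp: \<rho>0_def\<close>)
  have main: "(\<exists>s t. s\<^sup>2 + t\<^sup>2 \<le> \<rho>\<^sup>2 \<and>
           \<epsilon> / 2 * bipoly_norm n (\<lambda>i j. plane_coeff f x u w i j * \<rho> ^ (i + j)) \<le> f (x + s *\<^sub>R u + t *\<^sub>R w)) \<and>
        (\<forall>s t. \<bar>s\<bar> \<le> \<rho> \<longrightarrow> \<bar>t\<bar> \<le> \<rho> \<longrightarrow>
           f (x + s *\<^sub>R u + t *\<^sub>R w) \<le> (1 + E) * bipoly_norm n (\<lambda>i j. plane_coeff f x u w i j * \<rho> ^ (i + j)))"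
    if adm: "almost_subharmonic_plane n B C c \<rho>1 U f x u w" and \<rho>: "0 < \<rho>" "\<rho> \<le> \<rho>0"
    for U and f :: "'a \<Rightarrow> real" and x u w \<rho>
  proof -
    have U: "open U" and f: "smooth_on U f" and x0: "f x = 0" and c: "c \<le> bipoly_norm n (plane_coeff f x u w)"
      using adm unfolding almost_subharmonic_plane_def by blast+
    have inU: "x + s *\<^sub>R u + t *\<^sub>R w \<in> U" if "\<bar>s\<bar> \<le> \<rho>1" "\<bar>t\<bar> \<le> \<rho>1" for s t
      using adm that unfolding almost_subharmonic_plane_def Let_def by blast
    have bd: "\<bar>iter_deriv us f (x + s *\<^sub>R u + t *\<^sub>R w)\<bar> \<le> B"
      if "\<bar>s\<bar> \<le> \<rho>1" "\<bar>t\<bar> \<le> \<rho>1" "set us \<subseteq> {u, w}" "length us = n" for us s t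
      using adm that unfolding almost_subharmonic_plane_def Let_def by blast
    have lap: "- C * (\<bar>f z\<bar> + \<bar>iter_deriv [u] f z\<bar> + \<bar>iter_deriv [w] f z\<bar>)
          \<le> iter_deriv [u, u] f z + iter_deriv [w, w] f z"
      if "z = x + s *\<^sub>R u + t *\<^sub>R w" "\<bar>s\<bar> \<le> \<rho>1" "\<bar>t\<bar> \<le> \<rho>1" for s t z
      using adm that unfolding almost_subharmonic_plane_def Let_def by blast
    let ?pc = "plane_coeff f x u w"
    let ?b = "\<lambda>i j. ?pc i j * \<rho> ^ (i + j)"
    define N where "N = bipoly_norm n ?b"
    have \<rho>1: "\<rho> \<le> 1" "\<rho> \<le> \<rho>1" using \<rho> \<rho>0 by auto
    have xU: "x \<in> U" using inU[of 0 0] \<open>\<rho>1 > 0\<close> by simp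
    have "\<rho> ^ (n-1) * c \<le> \<rho> ^ (n-1) * bipoly_norm n ?pc"
      using c \<rho>(1) by (intro mult_left_mono) auto
    also have "\<dots> \<le> N"
      unfolding N_def using bipoly_norm_lower \<rho> \<rho>1 by simp
    finally have Nlow: "\<rho> ^ (n-1) * c \<le> N" .
    then have N0: "N > 0" using \<rho>(1) \<open>c > 0\<close> zero_less_power[of \<rho> "n-1"]
      by (meson less_le_trans mult_pos_pos)
    have err: "real (n + 1) * B * \<rho> ^ n \<le> \<rho> * E * N"
    proof -
      have "\<rho> ^ n = \<rho> * \<rho> ^ (n-1)" using n by (cases n) auto
      then have "real (n + 1) * B * \<rho> ^ n = \<rho> * E * (\<rho> ^ (n-1) * c)"
        using \<open>c > 0\<close> by (simp add: E_def)
      also have "\<dots> \<le> \<rho> * E * N"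
        using Nlow \<rho>(1) E by (intro mult_left_mono) auto
      finally show ?thesis .
    qed
    have \<rho>EN: "\<rho> * E * N \<le> E * N"
      using \<rho>(1) \<rho>1 E N0 by (intro mult_right_mono) (auto intro: mult_left_le_one_le)
    have taylor: "\<bar>iter_deriv vs f (x + s *\<^sub>R u + t *\<^sub>R w) - bipoly (n - length vs) (plane_coeff (iter_deriv vs f) x u w) s t\<bar>
        \<le> real (n + 1) * B * \<rho> ^ (n - length vs)"
      if "set vs \<subseteq> {u, w}" "length vs \<le> n" "\<bar>s\<bar> \<le> \<rho>" "\<bar>t\<bar> \<le> \<rho>" for vs s t
    proof -
      have "\<bar>iter_deriv vs f (x + s *\<^sub>R u + t *\<^sub>R w) - bipoly (n - length vs) (plane_coeff (iter_deriv vs f) x u w) s t\<bar>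
        \<le> real (n - length vs + 1) * B * \<rho> ^ (n - length vs)"
      proof (rule taylor_plane[OF smooth_on_iter_deriv[OF f] _ _ that(3,4)])
        fix i j \<sigma> \<tau> assume "i + j = n - length vs" "\<bar>\<sigma>\<bar> \<le> \<rho>" "\<bar>\<tau>\<bar> \<le> \<rho>"
        then show "\<bar>iter_deriv (replicate i u @ replicate j w) (iter_deriv vs f) (x + \<sigma> *\<^sub>R u + \<tau> *\<^sub>R w)\<bar> \<le> B"
          using bd[of \<sigma> \<tau> "vs @ replicate i u @ replicate j w"] that(1,2) \<rho>1
          by (auto simp: iter_deriv_append set_replicate_conv_if split: if_splits)
      qed (use inU \<rho>1 in auto)
      also have "\<dots> \<le> real (n + 1) * B * \<rho> ^ (n - length vs)"
        using \<open>B \<ge> 0\<close> \<rho>(1) by (intro mult_right_mono) auto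
      finally show ?thesis .
    qed
    have f_upper: "\<bar>f (x + s *\<^sub>R u + t *\<^sub>R w)\<bar> \<le> (1 + E) * N" if "\<bar>s\<bar> \<le> \<rho>" "\<bar>t\<bar> \<le> \<rho>" for s t
    proof -
      have "\<bar>bipoly n ?pc s t\<bar> \<le> N"
        unfolding N_def by (rule abs_bipoly_le[OF that])
      moreover have "\<bar>f (x + s *\<^sub>R u + t *\<^sub>R w) - bipoly n ?pc s t\<bar> \<le> E * N"
        using taylor[of "[]" s t] that err \<rho>EN by simp
      ultimately show ?thesis by (simp add: algebra_simps)
    qed
    have D_upper: "\<rho> * \<bar>iter_deriv [v] f (x + s *\<^sub>R u + t *\<^sub>R w)\<bar> \<le> (real n + E) * N"
      if "v \<in> {u, w}" "\<bar>s\<bar> \<le> \<rho>" "\<bar>t\<bar> \<le> \<rho>" for v s t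
    proof -
      let ?q = "plane_coeff (iter_deriv [v] f) x u w"
      have "\<rho> * \<bar>bipoly (n-1) ?q s t\<bar> \<le> \<rho> * bipoly_norm (n-1) (\<lambda>i j. ?q i j * \<rho> ^ (i + j))"
        using \<rho>(1) by (intro mult_left_mono abs_bipoly_le that) auto
      also have "\<dots> \<le> real n * N"
        using that(1) bipoly_norm_direction1[of \<rho> n f u x w] bipoly_norm_direction2[OF U f xU, of \<rho> n w u] \<rho>(1)
        unfolding N_def by auto
      finally have 1: "\<rho> * \<bar>bipoly (n-1) ?q s t\<bar> \<le> real n * N" .
      have "\<rho> * \<bar>iter_deriv [v] f (x + s *\<^sub>R u + t *\<^sub>R w) - bipoly (n-1) ?q s t\<bar> \<le> \<rho> * (real (n + 1) * B * \<rho> ^ (n-1))"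
        using taylor[of "[v]" s t] that n \<rho>(1) by (intro mult_left_mono) auto
      also have "\<dots> = real (n + 1) * B * \<rho> ^ n"
        using n by (cases n) auto
      finally have 2: "\<rho> * \<bar>iter_deriv [v] f (x + s *\<^sub>R u + t *\<^sub>R w) - bipoly (n-1) ?q s t\<bar> \<le> E * N"
        using err \<rho>EN by linarith
      have "\<rho> * \<bar>iter_deriv [v] f (x + s *\<^sub>R u + t *\<^sub>R w)\<bar> \<le>
        \<rho> * (\<bar>bipoly (n-1) ?q s t\<bar> + \<bar>iter_deriv [v] f (x + s *\<^sub>R u + t *\<^sub>R w) - bipoly (n-1) ?q s t\<bar>)"
        using \<rho>(1) by (intro mult_left_mono) linarith+
      then show ?thesis
        using 1 2 by (simp add: distrib_left distrib_right)
    qed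
    have b0: "?b 0 0 = 0" using x0 by (simp add: plane_coeff_def)
    have "\<exists>s t. s\<^sup>2 + t\<^sup>2 \<le> \<rho>\<^sup>2 \<and> \<epsilon> / 2 * N \<le> f (x + s *\<^sub>R u + t *\<^sub>R w)"
      using \<epsilon>(2)[of ?b, OF b0]
    proof (elim disjE exE conjE)
      fix s t :: real
      assume st: "s\<^sup>2 + t\<^sup>2 \<le> 1" and le: "\<epsilon> * bipoly_norm n ?b \<le> bipoly n ?b s t"
      have st1: "\<bar>\<rho> * s\<bar> \<le> \<rho>" "\<bar>\<rho> * t\<bar> \<le> \<rho>"
        using unit_disc_scaled[OF st] \<rho>(1) by auto
      have "\<epsilon> * N \<le> bipoly n ?pc (\<rho> * s) (\<rho> * t)"
        using le unfolding bipoly_scale N_def .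
      moreover have "\<bar>f (x + (\<rho> * s) *\<^sub>R u + (\<rho> * t) *\<^sub>R w) - bipoly n ?pc (\<rho> * s) (\<rho> * t)\<bar> \<le> \<rho> * E * N"
        using taylor[of "[]", OF _ _ st1] err by simp
      moreover have "\<rho> * E * N \<le> \<epsilon> / 2 * N"
      proof -
        have "\<rho> * E \<le> \<rho>0 * M" using \<rho> E M \<rho>0 by (intro mult_mono) auto
        then show ?thesis using \<rho>0(4) N0 by (intro mult_right_mono) auto
      qed
      ultimately have "\<epsilon> / 2 * N \<le> f (x + (\<rho> * s) *\<^sub>R u + (\<rho> * t) *\<^sub>R w)"
        by (simp add: field_simps)
      moreover have "(\<rho> * s)\<^sup>2 + (\<rho> * t)\<^sup>2 \<le> \<rho>\<^sup>2"
        using mult_left_mono[OF st, of "\<rho>\<^sup>2"] by (simp add: power_mult_distrib distrib_left)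
      ultimately show ?thesis by blast
    next
      fix s t :: real
      assume st: "s\<^sup>2 + t\<^sup>2 \<le> 1" and le: "bipoly_laplacian n ?b s t \<le> - \<epsilon> * bipoly_norm n ?b"
      have st1: "\<bar>\<rho> * s\<bar> \<le> \<rho>" "\<bar>\<rho> * t\<bar> \<le> \<rho>"
        using unit_disc_scaled[OF st] \<rho>(1) by auto
      define z where "z = x + (\<rho> * s) *\<^sub>R u + (\<rho> * t) *\<^sub>R w"
      define L where "L = iter_deriv [u, u] f z + iter_deriv [w, w] f z"
      let ?l = "bipoly_laplacian n ?pc (\<rho> * s) (\<rho> * t)"
      have l: "\<rho>\<^sup>2 * ?l \<le> - \<epsilon> * N"
        using le unfolding bipoly_laplacian_scale N_def .
      have "\<bar>L - ?l\<bar> \<le> 2 * (real (n + 1) * B * \<rho> ^ (n-2))"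
        using taylor[of "[u,u]", OF _ _ st1] taylor[of "[w,w]", OF _ _ st1] n
        unfolding bipoly_laplacian_taylor[OF U f xU, symmetric] L_def z_def
        by (simp add: numeral_2_eq_2) linarith
      then have "\<rho>\<^sup>2 * \<bar>L - ?l\<bar> \<le> \<rho>\<^sup>2 * (2 * (real (n + 1) * B * \<rho> ^ (n-2)))"
        by (intro mult_left_mono) auto
      also have "\<dots> = 2 * (real (n + 1) * B * \<rho> ^ n)"
      proof -
        have "\<rho> ^ n = \<rho>\<^sup>2 * \<rho> ^ (n-2)" using n by (simp only: power_add[symmetric] le_add_diff_inverse)
        then show ?thesis by simp
      qed
      also have "\<dots> \<le> 2 * (\<rho> * E * N)" using err by simp
      finally have "\<rho>\<^sup>2 * \<bar>L - ?l\<bar> \<le> 2 * (\<rho> * E * N)" .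
      have 1: "\<rho>\<^sup>2 * L \<le> - \<epsilon> * N + 2 * (\<rho> * E * N)"
      proof -
        have "L \<le> ?l + \<bar>L - ?l\<bar>" by linarith
        then have "\<rho>\<^sup>2 * L \<le> \<rho>\<^sup>2 * ?l + \<rho>\<^sup>2 * \<bar>L - ?l\<bar>"
          unfolding distrib_left[symmetric] by (rule mult_left_mono) simp
        then show ?thesis using l \<open>\<rho>\<^sup>2 * \<bar>L - ?l\<bar> \<le> 2 * (\<rho> * E * N)\<close> by linarith
      qed
      define G where "G = \<bar>f z\<bar> + \<bar>iter_deriv [u] f z\<bar> + \<bar>iter_deriv [w] f z\<bar>"
      have "- C * G \<le> L"
        unfolding G_def L_def by (rule lap[OF z_def]) (use st1 \<rho>1 in linarith)+
      then have 2: "- C * (\<rho>\<^sup>2 * G) \<le> \<rho>\<^sup>2 * L"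
        using mult_left_mono[of "- C * G" L "\<rho>\<^sup>2"] by (simp add: mult_ac)
      have "\<rho> * \<bar>f z\<bar> \<le> (1 + E) * N"
        using f_upper[OF st1] \<rho>1 \<rho>(1) unfolding z_def[symmetric]
        by (smt (verit, best) mult_left_le_one_le)
      then have "\<rho> * G \<le> (1 + E) * N + (real n + E) * N + (real n + E) * N"
        using D_upper[OF _ st1, of u] D_upper[OF _ st1, of w] unfolding z_def[symmetric] G_def distrib_left
        by (intro add_mono) blast+
      also have "\<dots> = (2 * real n + 1 + 3 * E) * N"
        by (simp add: algebra_simps)
      finally have "C * \<rho> * (\<rho> * G) \<le> C * \<rho> * ((2 * real n + 1 + 3 * E) * N)"
        using \<open>C \<ge> 0\<close> \<rho>(1) by (intro mult_left_mono) auto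
      then have "C * (\<rho>\<^sup>2 * G) \<le> \<rho> * (C * (2 * real n + 1 + 3 * E)) * N"
        by (simp add: power2_eq_square mult_ac)
      with 1 2 have "\<epsilon> * N \<le> \<rho> * (C * (2 * real n + 1 + 3 * E)) * N + 2 * (\<rho> * E * N)"
        by simp
      also have "\<dots> < (\<rho> * M) * N"
        using \<rho>(1) N0 by (simp add: M_def algebra_simps)
      finally have "\<epsilon> < \<rho> * M" using N0 by simp
      also have "\<rho> * M \<le> \<rho>0 * M" using \<rho>(2) M(2) by simp
      finally have False using \<rho>0(4) \<epsilon>(1) by simp
      then show ?thesis ..
    qed
    moreover have "\<forall>s t. \<bar>s\<bar> \<le> \<rho> \<longrightarrow> \<bar>t\<bar> \<le> \<rho> \<longrightarrow> f (x + s *\<^sub>R u + t *\<^sub>R w) \<le> (1 + E) * N"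
      using f_upper abs_le_D1 by blast
    ultimately show ?thesis
      unfolding N_def by blast
  qed
  have pos: "\<epsilon> / 2 > 0" "1 + E > 0" using \<epsilon>(1) E by simp_all
  show ?thesis
    by (rule exI, rule conjI, rule pos(1), rule exI, rule conjI, rule pos(2), rule exI,
      rule conjI, rule \<rho>0(1), rule conjI, rule \<rho>0(2), rule conjI, rule \<rho>0(3),
      intro allI impI, rule main)
qed

section \<open>The Levi form as a Laplacian\<close>

lemma frechet_derivative_eq_inner_gradient:
  fixes r :: "'a::euclidean_space \<Rightarrow> real"
  assumes "r differentiable (at x)"
  shows "frechet_derivative r (at x) h = h \<bullet> gradient r x"
proof -
  let ?F = "frechet_derivative r (at x)"
  define G where "G = (\<Sum>b\<in>Basis. ?F b *\<^sub>R b)"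
  have lin: "linear ?F" using assms by (rule linear_frechet_derivative)
  have F: "?F h = h \<bullet> G" for h
  proof -
    have "?F h = ?F (\<Sum>b\<in>Basis. (h \<bullet> b) *\<^sub>R b)" by (simp add: euclidean_representation)
    also have "\<dots> = h \<bullet> G"
      by (simp add: linear_sum[OF lin] linear_scale[OF lin] G_def inner_sum_right mult.commute)
    finally show ?thesis .
  qed
  then have "?F = (\<lambda>h. h \<bullet> G)" by auto
  then have "GDERIV r x :> G"
    using assms unfolding frechet_derivative_works gderiv_def by simp
  moreover have "D = G" if "GDERIV r x :> D" for D
  proof -
    have "h \<bullet> D = h \<bullet> G" for h
      using has_derivative_unique[OF that[unfolded gderiv_def] \<open>GDERIV r x :> G\<close>[unfolded gderiv_def]]
      by metis
    then show ?thesis by (metis vector_eq_ldot)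
  qed
  ultimately have "gradient r x = G"
    unfolding gradient_def by (rule the_equality)
  then show ?thesis using F by simp
qed

lemma bilinear_second_derivative:
  fixes r :: "'a::real_normed_vector \<Rightarrow> real"
  assumes "open U" "smooth_on U r" "x \<in> U"
  shows "bilinear (\<lambda>a b. iter_deriv [a, b] r x)"
proof -
  have "linear (\<lambda>b. iter_deriv [a, b] r x)" for a
    using linear_frechet_derivative[OF smooth_on_differentiable[OF smooth_on_direction[OF assms(2)] assms(3)]]
    by simp
  moreover from this have "linear (\<lambda>a. iter_deriv [a, b] r x)" for b
    unfolding iter_deriv_swap[OF assms, of _ b] .
  ultimately show ?thesis by (simp add: bilinear_def)
qed

lemma dz_of_real:
  assumes "r differentiable (at x)"
  shows "dz j (\<lambda>z. complex_of_real (r z)) x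
      = (of_real (frechet_derivative r (at x) (axis j 1)) - \<i> * of_real (frechet_derivative r (at x) (axis j \<i>))) / 2"
    and "dzbar j (\<lambda>z. complex_of_real (r z)) x
      = (of_real (frechet_derivative r (at x) (axis j 1)) + \<i> * of_real (frechet_derivative r (at x) (axis j \<i>))) / 2"
proof -
  have "((\<lambda>z. complex_of_real (r z)) has_derivative (\<lambda>h. complex_of_real (frechet_derivative r (at x) h))) (at x)"
    using assms unfolding frechet_derivative_works by (rule has_derivative_of_real)
  then have *: "frechet_derivative (\<lambda>z. complex_of_real (r z)) (at x) = (\<lambda>h. complex_of_real (frechet_derivative r (at x) h))"
    by (rule frechet_derivative_at[symmetric])
  show "dz j (\<lambda>z. complex_of_real (r z)) x
      = (of_real (frechet_derivative r (at x) (axis j 1)) - \<i> * of_real (frechet_derivative r (at x) (axis j \<i>))) / 2"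
    "dzbar j (\<lambda>z. complex_of_real (r z)) x
      = (of_real (frechet_derivative r (at x) (axis j 1)) + \<i> * of_real (frechet_derivative r (at x) (axis j \<i>))) / 2"
    unfolding dz_def dzbar_def * by simp_all
qed

lemma complex_vec_expand:
  fixes v :: "complex^'n"
  shows "v = (\<Sum>j\<in>UNIV. Re (v $ j) *\<^sub>R axis j 1 + Im (v $ j) *\<^sub>R axis j \<i>)"
  by (simp add: vec_eq_iff complex_eq_iff axis_def if_distrib[of Re] if_distrib[of Im] sum.delta
      if_distrib[of "\<lambda>x. _ * x"] cong: if_cong)

text \<open>The complex-linear form \<open>\<partial>r\<close> in terms of real directional derivatives, so that complex tangent vectors
  are those \<open>v\<close> for which both \<open>v\<close> and \<open>\<i> v\<close> are orthogonal to the gradient.\<close>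

lemma complex_tangent_functional:
  fixes r :: "complex^'n \<Rightarrow> real"
  assumes "r differentiable (at x)"
  shows "(\<Sum>j\<in>UNIV. dz j (\<lambda>z. complex_of_real (r z)) x * v $ j)
    = (of_real (v \<bullet> gradient r x) - \<i> * of_real ((\<i> *s v) \<bullet> gradient r x)) / 2"
proof -
  let ?G = "gradient r x"
  have "dz j (\<lambda>z. complex_of_real (r z)) x * v $ j
     = (of_real (Re (v $ j) * (axis j 1 \<bullet> ?G) + Im (v $ j) * (axis j \<i> \<bullet> ?G))
       - \<i> * of_real (- Im (v $ j) * (axis j 1 \<bullet> ?G) + Re (v $ j) * (axis j \<i> \<bullet> ?G))) / 2" for j
    unfolding dz_of_real[OF assms] frechet_derivative_eq_inner_gradient[OF assms]
    by (simp add: complex_eq_iff algebra_simps)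
  then have "(\<Sum>j\<in>UNIV. dz j (\<lambda>z. complex_of_real (r z)) x * v $ j)
    = (of_real (\<Sum>j\<in>UNIV. Re (v $ j) * (axis j 1 \<bullet> ?G) + Im (v $ j) * (axis j \<i> \<bullet> ?G))
       - \<i> * of_real (\<Sum>j\<in>UNIV. - Im (v $ j) * (axis j 1 \<bullet> ?G) + Re (v $ j) * (axis j \<i> \<bullet> ?G))) / 2"
    by (simp only: sum_divide_distrib[symmetric] sum_subtractf sum_distrib_left[symmetric] of_real_sum)
  moreover have "v \<bullet> ?G = (\<Sum>j\<in>UNIV. Re (v $ j) * (axis j 1 \<bullet> ?G) + Im (v $ j) * (axis j \<i> \<bullet> ?G))"
    by (subst complex_vec_expand[of v]) (simp only: inner_sum_left inner_add_left inner_scaleR_left)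
  moreover have "(\<i> *s v) \<bullet> ?G = (\<Sum>j\<in>UNIV. - Im (v $ j) * (axis j 1 \<bullet> ?G) + Re (v $ j) * (axis j \<i> \<bullet> ?G))"
    by (subst complex_vec_expand[of "\<i> *s v"]) (simp add: inner_sum_left inner_add_left inner_diff_left)
  ultimately show ?thesis by simp
qed

text \<open>Both sides are expanded over the real basis \<open>e j\<close>, \<open>f j = \<i> e j\<close>. Multiplying \<open>v\<close> by \<open>\<i>\<close> exchanges
  the real and imaginary parts of its coordinates up to sign. The sum of the two second derivatives
  thus retains exactly the combinations \<open>H e e + H f f\<close> and \<open>H e f - H f e\<close> that the product of
  the two Wirtinger operators contains. So the Levi form is a Laplacian on a complex line.\<close>

lemma levi_form_eq:
  fixes r :: "complex^'n \<Rightarrow> real"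
  assumes "open U" "smooth_on U r" "x \<in> U"
  shows "4 * Re (levi_form r x v) = iter_deriv [v, v] r x + iter_deriv [\<i> *s v, \<i> *s v] r x"
proof -
  let ?H = "\<lambda>a b. iter_deriv [a, b] r x"
  have bil: "bilinear ?H" by (rule bilinear_second_derivative[OF assms])
  define e f where "e j = (axis j 1 :: complex^'n)" and "f j = (axis j \<i> :: complex^'n)" for j
  have dd: "dz j (dzbar k (\<lambda>z. complex_of_real (r z))) x
      = (of_real (?H (e k) (e j) + ?H (f k) (f j)) + \<i> * of_real (?H (f k) (e j) - ?H (e k) (f j))) / 4" for j k
  proof -
    let ?g = "\<lambda>z. (complex_of_real (frechet_derivative r (at z) (e k)) + \<i> * of_real (frechet_derivative r (at z) (f k))) / 2"
    have D: "((\<lambda>z. frechet_derivative r (at z) a) has_derivative (\<lambda>h. ?H a h)) (at x)" for a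
      using smooth_on_differentiable[OF smooth_on_direction[OF assms(2)] assms(3), of a]
      by (simp add: frechet_derivative_works)
    have "((\<lambda>z. complex_of_real (frechet_derivative r (at z) (e k)) + \<i> * of_real (frechet_derivative r (at z) (f k)))
        has_derivative (\<lambda>h. of_real (?H (e k) h) + \<i> * of_real (?H (f k) h))) (at x)"
      by (intro has_derivative_add has_derivative_mult_right has_derivative_of_real D)
    from bounded_linear.has_derivative[OF bounded_linear_divide[of 2] this]
    have "(?g has_derivative (\<lambda>h. (of_real (?H (e k) h) + \<i> * of_real (?H (f k) h)) / 2)) (at x)" .
    then have "(dzbar k (\<lambda>z. complex_of_real (r z)) has_derivative (\<lambda>h. (of_real (?H (e k) h) + \<i> * of_real (?H (f k) h)) / 2)) (at x)"
      by (rule has_derivative_transform_within_open[OF _ assms(1,3)])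
        (simp add: dz_of_real smooth_on_differentiable[OF assms(2)] e_def f_def)
    then have "frechet_derivative (dzbar k (\<lambda>z. complex_of_real (r z))) (at x) = (\<lambda>h. (of_real (?H (e k) h) + \<i> * of_real (?H (f k) h)) / 2)"
      by (rule frechet_derivative_at[symmetric])
    then have "dz j (dzbar k (\<lambda>z. complex_of_real (r z))) x
      = ((of_real (?H (e k) (e j)) + \<i> * of_real (?H (f k) (e j))) / 2
        - \<i> * ((of_real (?H (e k) (f j)) + \<i> * of_real (?H (f k) (f j))) / 2)) / 2"
      unfolding dz_def by (simp only: e_def f_def)
    then show ?thesis
      by (simp add: complex_eq_iff field_simps del: iter_deriv.simps)
  qed
  have re4: "4 * Re ((of_real A + \<i> * of_real B) / 4 * p * cnj q)
      = (Re p * Re q + Im p * Im q) * A - (Im p * Re q - Re p * Im q) * B" for A B :: real and p q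
    by (simp add: field_simps)
  define a b where "a j = Re (v $ j)" and "b j = Im (v $ j)" for j
  have "4 * Re (levi_form r x v) = (\<Sum>j\<in>UNIV. \<Sum>k\<in>UNIV.
      4 * Re (dz j (dzbar k (\<lambda>z. complex_of_real (r z))) x * v $ j * cnj (v $ k)))"
    unfolding levi_form_def by (simp add: sum_distrib_left)
  also have "\<dots> = (\<Sum>j\<in>UNIV. \<Sum>k\<in>UNIV. (a j * a k + b j * b k) * (?H (e k) (e j) + ?H (f k) (f j))
      + (b j * a k - a j * b k) * (?H (e k) (f j) - ?H (f k) (e j)))"
    unfolding dd by (intro sum.cong refl) (simp only: re4, simp add: a_def b_def algebra_simps del: iter_deriv.simps)
  also have "\<dots> = (\<Sum>k\<in>UNIV. \<Sum>j\<in>UNIV. (a j * a k + b j * b k) * (?H (e k) (e j) + ?H (f k) (f j))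
      + (b j * a k - a j * b k) * (?H (e k) (f j) - ?H (f k) (e j)))"
    by (rule sum.swap)
  also have "\<dots> = (\<Sum>k\<in>UNIV. \<Sum>j\<in>UNIV. ?H (a k *\<^sub>R e k + b k *\<^sub>R f k) (a j *\<^sub>R e j + b j *\<^sub>R f j))
     + (\<Sum>k\<in>UNIV. \<Sum>j\<in>UNIV. ?H (- b k *\<^sub>R e k + a k *\<^sub>R f k) (- b j *\<^sub>R e j + a j *\<^sub>R f j))"
    unfolding sum.distrib[symmetric]
    by (intro sum.cong refl)
      (simp only: bilinear_ladd[OF bil] bilinear_radd[OF bil] bilinear_lmul[OF bil] bilinear_rmul[OF bil]
        real_scaleR_def, simp add: algebra_simps del: iter_deriv.simps)
  also have "\<dots> = ?H (\<Sum>k\<in>UNIV. a k *\<^sub>R e k + b k *\<^sub>R f k) (\<Sum>k\<in>UNIV. a k *\<^sub>R e k + b k *\<^sub>R f k)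
     + ?H (\<Sum>k\<in>UNIV. - b k *\<^sub>R e k + a k *\<^sub>R f k) (\<Sum>k\<in>UNIV. - b k *\<^sub>R e k + a k *\<^sub>R f k)"
    by (simp only: bilinear_sum[OF bil] sum.cartesian_product)
  also have "(\<Sum>k\<in>UNIV. a k *\<^sub>R e k + b k *\<^sub>R f k) = v"
    using complex_vec_expand[of v] by (simp add: a_def b_def e_def f_def)
  also have "(\<Sum>k\<in>UNIV. - b k *\<^sub>R e k + a k *\<^sub>R f k) = \<i> *s v"
    using complex_vec_expand[of "\<i> *s v"] by (simp add: a_def b_def e_def f_def)
  finally show ?thesis .
qed

section \<open>Uniform estimates near the boundary\<close>

lemma iter_deriv_lipschitz:
  fixes f :: "'a::real_normed_vector \<Rightarrow> real"
  assumes f: "smooth_on U f" and S: "convex S" "S \<subseteq> U" "x \<in> S" "y \<in> S"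
    and B: "\<And>us y. y \<in> S \<Longrightarrow> length us = Suc k \<Longrightarrow> \<bar>iter_deriv us f y\<bar> \<le> B * prod_list (map norm us)"
    and k: "length us = k"
  shows "\<bar>iter_deriv us f x - iter_deriv us f y\<bar> \<le> B * prod_list (map norm us) * norm (x - y)"
proof -
  have mem: "y + s *\<^sub>R (x - y) \<in> S" if "0 \<le> s" "s \<le> 1" for s
    using convexD[OF S(1,4,3), of "1 - s" s] that by (simp add: algebra_simps)
  have "\<exists>s. 0 < s \<and> s < 1 \<and> iter_deriv us f (y + 1 *\<^sub>R (x - y)) - iter_deriv us f y
      = 1 * frechet_derivative (iter_deriv us f) (at (y + s *\<^sub>R (x - y))) (x - y)"
    using mem S(2) by (intro line_mvt smooth_on_differentiable[OF smooth_on_iter_deriv[OF f]]) auto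
  then obtain s where s: "0 < s" "s < 1"
    "iter_deriv us f x - iter_deriv us f y = iter_deriv (us @ [x - y]) f (y + s *\<^sub>R (x - y))"
    by (auto simp: iter_deriv_append)
  show ?thesis
    unfolding s(3) using B[OF mem[of s], of "us @ [x - y]"] s(1,2) k by (simp add: mult.assoc)
qed

text \<open>The constants of a tubular neighbourhood of the boundary: \<open>\<eta>\<close> is its width, \<open>B k\<close> bounds the
  derivatives of order \<open>k\<close> of the defining function there, and \<open>c\<close> is the least growth rate of the
  defining function in the normal direction.\<close>

locale collar =
  fixes \<Omega> U :: "(complex^'n) set" and r :: "complex^'n \<Rightarrow> real" and \<eta> c :: real and B :: "nat \<Rightarrow> real"
  assumes open_U: "open U" and smooth_r: "smooth_on U r"
    and Omega_eq: "\<Omega> \<inter> U = {z \<in> U. r z < 0}"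
    and frontier_eq: "frontier \<Omega> \<inter> U = {z \<in> U. r z = 0}"
    and \<eta>_pos: "0 < \<eta>" and c_pos: "0 < c" and B_pos: "\<And>k. 0 < B k"
    and cball_subset: "\<And>P. P \<in> frontier \<Omega> \<Longrightarrow> cball P \<eta> \<subseteq> U"
    and deriv_bound: "\<And>P x us. P \<in> frontier \<Omega> \<Longrightarrow> x \<in> cball P \<eta> \<Longrightarrow>
      \<bar>iter_deriv us r x\<bar> \<le> B (length us) * prod_list (map norm us)"
    and normal_deriv: "\<And>P x. P \<in> frontier \<Omega> \<Longrightarrow> x \<in> cball P \<eta> \<Longrightarrow> c \<le> iter_deriv [outward_normal r P] r x"
    and norm_normal: "\<And>P. P \<in> frontier \<Omega> \<Longrightarrow> norm (outward_normal r P) = 1"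

lemma collar_exists:
  fixes \<Omega> U :: "(complex^'n) set"
  assumes "bounded \<Omega>" "frontier \<Omega> \<subseteq> U" "defining_function \<Omega> U r"
  obtains \<eta> c B where "collar \<Omega> U r \<eta> c B"
proof -
  let ?F = "frontier \<Omega>"
  have U: "open U" "smooth_on U r" "\<Omega> \<inter> U = {z \<in> U. r z < 0}" "frontier \<Omega> \<inter> U = {z \<in> U. r z = 0}"
    and grad: "\<And>z. z \<in> ?F \<Longrightarrow> gradient r z \<noteq> 0"
    using assms unfolding defining_function_def by auto
  have F: "compact ?F" using assms(1) by (rule compact_frontier_bounded)
  obtain e where e: "e > 0" "(\<Union>x\<in>?F. cball x e) \<subseteq> U"
    using compact_subset_open_imp_cball_epsilon_subset[OF F U(1) assms(2)] by blast
  define K where "K = {x + y |x y. x \<in> ?F \<and> y \<in> cball 0 e}"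
  have K: "compact K" unfolding K_def by (intro compact_sums F compact_cball)
  have cball_K: "cball P e \<subseteq> K" if "P \<in> ?F" for P
  proof
    fix x assume "x \<in> cball P e"
    then have "x = P + (x - P) \<and> P \<in> ?F \<and> x - P \<in> cball 0 e"
      using that by (simp add: dist_norm norm_minus_commute)
    then show "x \<in> K" unfolding K_def by (intro CollectI exI)
  qed
  have "K \<subseteq> U"
  proof
    fix z assume "z \<in> K"
    then obtain x y where xy: "z = x + y" "x \<in> ?F" "y \<in> cball 0 e" unfolding K_def by blast
    then have "z \<in> cball x e" by (simp add: dist_norm)
    then show "z \<in> U" using e(2) xy(2) by (meson UN_I subsetD)
  qed
  then have "\<forall>k. \<exists>B>0. \<forall>x\<in>K. \<forall>us. length us = k \<longrightarrow> norm (iter_deriv us r x) \<le> B * prod_list (map norm us)"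
    using iter_deriv_bound_compact[OF U(1,2) K] by blast
  then obtain B where B: "\<And>k. B k > 0" "\<And>x us. x \<in> K \<Longrightarrow> \<bar>iter_deriv us r x\<bar> \<le> B (length us) * prod_list (map norm us)"
    unfolding real_norm_def by metis
  have inner: "frechet_derivative r (at x) h = h \<bullet> gradient r x" if "x \<in> U" for x h
    by (rule frechet_derivative_eq_inner_gradient[OF smooth_on_differentiable[OF U(2) that]])
  have "\<exists>c>0. \<forall>P\<in>?F. c \<le> norm (gradient r P)"
  proof (cases "?F = {}")
    case False
    have cont: "continuous_on ?F (\<lambda>x. frechet_derivative r (at x) b)" for b
    proof (rule continuous_at_imp_continuous_on, rule ballI)
      fix x assume "x \<in> ?F"
      then have "x \<in> U" using assms(2) by blast
      then show "isCont (\<lambda>x. frechet_derivative r (at x) b) x"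
        using smooth_on_differentiable[OF smooth_on_direction[OF U(2)]] differentiable_imp_continuous_within by blast
    qed
    have eq: "(\<Sum>b\<in>Basis. frechet_derivative r (at x) b *\<^sub>R b) = gradient r x" if "x \<in> ?F" for x
    proof -
      have "frechet_derivative r (at x) b = gradient r x \<bullet> b" for b
        using inner[of x b] that assms(2) by (simp add: inner_commute subset_iff)
      then show ?thesis by (simp add: euclidean_representation)
    qed
    have "continuous_on ?F (\<lambda>x. \<Sum>b\<in>Basis. frechet_derivative r (at x) b *\<^sub>R b)"
      by (rule continuous_on_sum) (rule continuous_on_scaleR[OF cont continuous_on_const])
    then have "continuous_on ?F (gradient r)"
      by (rule continuous_on_eq) (rule eq)
    from continuous_attains_inf[OF F False continuous_on_norm[OF this]]
    obtain P where P: "P \<in> ?F" "\<forall>Q\<in>?F. norm (gradient r P) \<le> norm (gradient r Q)" ..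
    show ?thesis
      using grad[OF P(1)] P(2) by (intro exI[of _ "norm (gradient r P)"]) simp
  next
    case True
    then show ?thesis by (intro exI[of _ 1]) simp
  qed
  then obtain c where c: "c > 0" "\<And>P. P \<in> ?F \<Longrightarrow> c \<le> norm (gradient r P)" by blast
  have nu: "norm (outward_normal r P) = 1" if "P \<in> ?F" for P
    using grad[OF that] by (simp add: outward_normal_def)
  define \<eta> where "\<eta> = min e (c / (2 * B 2))"
  have \<eta>: "0 < \<eta>" "\<eta> \<le> e" "B 2 * \<eta> \<le> c / 2"
  proof -
    have "\<eta> \<le> c / (2 * B 2)" by (simp add: \<eta>_def)
    then show "B 2 * \<eta> \<le> c / 2" using B(1)[of 2] by (simp add: field_simps)
  qed (use e B(1) c in \<open>auto simp: \<eta>_def\<close>)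
  have sub: "cball P \<eta> \<subseteq> cball P e" for P using \<eta>(2) by auto
  have "collar \<Omega> U r \<eta> (c / 2) B"
  proof (unfold_locales)
    fix P assume P: "P \<in> ?F"
    show "cball P \<eta> \<subseteq> U" using e(2) P sub by blast
  next
    fix P x us assume "P \<in> ?F" "x \<in> cball P \<eta>"
    then show "\<bar>iter_deriv us r x\<bar> \<le> B (length us) * prod_list (map norm us)"
      using B(2) cball_K sub by blast
  next
    fix P x assume P: "P \<in> ?F" and x: "x \<in> cball P \<eta>"
    let ?\<nu> = "outward_normal r P"
    have "P \<in> U" using P assms(2) by auto
    then have "iter_deriv [?\<nu>] r P = norm (gradient r P)"
      using grad[OF P] by (simp add: inner outward_normal_def dot_square_norm power2_eq_square)
    moreover have "\<bar>iter_deriv [?\<nu>] r x - iter_deriv [?\<nu>] r P\<bar> \<le> B 2 * prod_list (map norm [?\<nu>]) * norm (x - P)"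
    proof (rule iter_deriv_lipschitz[OF U(2) convex_cball[of P e], where k = 1])
      show "cball P e \<subseteq> U" using e(2) P by blast
      show "x \<in> cball P e" using x sub by (meson subsetD)
      show "P \<in> cball P e" using e by auto
      show "\<bar>iter_deriv us r y\<bar> \<le> B 2 * prod_list (map norm us)" if "y \<in> cball P e" "length us = Suc 1" for us y
        using B(2)[of y us] that cball_K[OF P] by (auto simp: numeral_2_eq_2)
    qed simp
    moreover have "B 2 * norm (x - P) \<le> B 2 * \<eta>"
      using x B(1)[of 2] by (intro mult_left_mono) (auto simp: dist_norm norm_minus_commute)
    ultimately show "c / 2 \<le> iter_deriv [?\<nu>] r x"
      using c(2)[OF P] \<eta>(3) nu[OF P] by simp
  qed (use U B(1) \<eta> c nu in auto)
  then show thesis by (rule that)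
qed

context collar
begin

lemma r_frontier: "P \<in> frontier \<Omega> \<Longrightarrow> r P = 0"
  using cball_subset[of P] \<eta>_pos frontier_eq by (metis (mono_tags, lifting) IntI centre_in_cball less_eq_real_def mem_Collect_eq subsetD)

lemma lipschitz:
  assumes "P \<in> frontier \<Omega>" "x \<in> cball P \<eta>" "y \<in> cball P \<eta>"
  shows "\<bar>iter_deriv us r x - iter_deriv us r y\<bar> \<le> B (Suc (length us)) * prod_list (map norm us) * norm (x - y)"
proof (rule iter_deriv_lipschitz[OF smooth_r convex_cball[of P \<eta>] _ assms(2,3)])
  show "cball P \<eta> \<subseteq> U" using cball_subset assms(1) by blast
  show "\<bar>iter_deriv vs r y\<bar> \<le> B (Suc (length us)) * prod_list (map norm vs)"
    if "y \<in> cball P \<eta>" "length vs = Suc (length us)" for vs y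
    using deriv_bound[OF assms(1) that(1), of vs] that(2) by simp
qed simp

lemma increase_along_normal:
  assumes "P \<in> frontier \<Omega>" "x \<in> cball P \<eta>" "x + s *\<^sub>R outward_normal r P \<in> cball P \<eta>" "0 \<le> s"
  shows "r x + c * s \<le> r (x + s *\<^sub>R outward_normal r P)"
proof (cases "s = 0")
  case False
  let ?\<nu> = "outward_normal r P"
  have mem: "x + t *\<^sub>R ?\<nu> \<in> cball P \<eta>" if "0 \<le> t" "t \<le> s" for t
    using convexD[OF convex_cball assms(2,3), of "1 - t / s" "t / s"] that False assms(4)
    by (simp add: algebra_simps)
  have "\<exists>t. 0 < t \<and> t < s \<and> r (x + s *\<^sub>R ?\<nu>) - r x = s * frechet_derivative r (at (x + t *\<^sub>R ?\<nu>)) ?\<nu>"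
    using mem cball_subset[OF assms(1)] False assms(4)
    by (intro line_mvt smooth_on_differentiable[OF smooth_r]) auto
  then obtain t where t: "0 < t" "t < s" "r (x + s *\<^sub>R ?\<nu>) - r x = s * iter_deriv [?\<nu>] r (x + t *\<^sub>R ?\<nu>)"
    by auto
  have "c * s \<le> s * iter_deriv [?\<nu>] r (x + t *\<^sub>R ?\<nu>)"
    using normal_deriv[OF assms(1) mem[of t]] t assms(4) by (simp add: mult.commute mult_left_mono)
  then show ?thesis using t(3) by simp
qed simp

text \<open>Since \<open>r\<close> grows at rate at least \<open>c\<close> along the normal, a displacement of length at most \<open>\<bar>r z\<bar> / c\<close>
  in that direction reaches the zero set.\<close>

lemma nearby_boundary_point:
  assumes P: "P \<in> frontier \<Omega>" and z: "norm (z - P) + \<bar>r z\<bar> / c \<le> \<eta>"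
  obtains z' where "z' \<in> frontier \<Omega>" "norm (z' - P) \<le> \<eta>" "norm (z - z') \<le> \<bar>r z\<bar> / c"
proof -
  let ?\<nu> = "outward_normal r P"
  define a where "a = \<bar>r z\<bar> / c"
  have a: "a \<ge> 0" "c * a = \<bar>r z\<bar>" using c_pos by (simp_all add: a_def)
  have near: "norm (z + s *\<^sub>R ?\<nu> - P) \<le> \<eta>" if "\<bar>s\<bar> \<le> a" for s
  proof -
    have "norm (z + s *\<^sub>R ?\<nu> - P) \<le> norm (z - P) + norm (s *\<^sub>R ?\<nu>)"
      using norm_triangle_ineq[of "z - P" "s *\<^sub>R ?\<nu>"] by (simp add: algebra_simps)
    then show ?thesis using z that norm_normal[OF P] by (simp add: a_def)
  qed
  then have mem: "z + s *\<^sub>R ?\<nu> \<in> cball P \<eta>" if "\<bar>s\<bar> \<le> a" for s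
    using that by (simp add: dist_norm norm_minus_commute)
  have z0: "z \<in> cball P \<eta>" using mem[of 0] a by simp
  have "r (z + (-a) *\<^sub>R ?\<nu>) \<le> 0"
    using increase_along_normal[OF P mem[of "-a"], of a] z0 a by simp
  moreover have "0 \<le> r (z + a *\<^sub>R ?\<nu>)"
    using increase_along_normal[OF P z0 mem[of a]] a by simp
  moreover have "isCont (\<lambda>s. r (z + s *\<^sub>R ?\<nu>)) s" if "-a \<le> s \<and> s \<le> a" for s
    by (rule DERIV_isCont[OF line_deriv[OF smooth_on_differentiable[OF smooth_r]]])
      (use mem[of s] that cball_subset[OF P] in auto)
  ultimately obtain s where s: "-a \<le> s" "s \<le> a" "r (z + s *\<^sub>R ?\<nu>) = 0"
    using IVT[of "\<lambda>s. r (z + s *\<^sub>R ?\<nu>)" "-a" 0 a] a by auto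
  then have "z + s *\<^sub>R ?\<nu> \<in> U"
    using mem[of s] cball_subset[OF P] by auto
  then have "z + s *\<^sub>R ?\<nu> \<in> frontier \<Omega>"
    using s(3) frontier_eq by auto
  moreover have "norm (z - (z + s *\<^sub>R ?\<nu>)) \<le> a"
    using s norm_normal[OF P] by simp
  ultimately show thesis
    using that near[of s] s unfolding a_def by auto
qed

text \<open>Subtracting a complex multiple of the gradient makes \<open>v\<close> complex tangent. The length of the
  correction is controlled by \<open>\<bar>\<partial>r(v)\<bar>\<close>, that is, by the first derivatives along \<open>v\<close> and \<open>\<i> v\<close>.\<close>

lemma levi_lower_bound_at_boundary:
  assumes pc: "pseudoconvex \<Omega> r" and P: "P \<in> frontier \<Omega>" and v: "norm v = 1"
  shows "- (2 * B 2 * (2 + 2 * B 1 / c) / c) * (\<bar>iter_deriv [v] r P\<bar> + \<bar>iter_deriv [\<i> *s v] r P\<bar>)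
    \<le> iter_deriv [v, v] r P + iter_deriv [\<i> *s v, \<i> *s v] r P"
proof -
  have PU: "P \<in> U" and Pb: "P \<in> cball P \<eta>" using P cball_subset[OF P] \<eta>_pos by auto
  have diff: "r differentiable (at P)" by (rule smooth_on_differentiable[OF smooth_r PU])
  note inner = frechet_derivative_eq_inner_gradient[OF diff]
  define G where "G = gradient r P"
  define \<l> where "\<l> w = (\<Sum>j\<in>UNIV. dz j (\<lambda>z. complex_of_real (r z)) P * w $ j)" for w
  have l: "\<l> w = (of_real (w \<bullet> G) - \<i> * of_real ((\<i> *s w) \<bullet> G)) / 2" for w
    unfolding \<l>_def G_def by (rule complex_tangent_functional[OF diff])
  have G: "c \<le> norm G"
  proof -
    have "c \<le> outward_normal r P \<bullet> G"
      using normal_deriv[OF P Pb] by (simp add: inner G_def)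
    also have "\<dots> \<le> norm G"
      using norm_cauchy_schwarz[of "outward_normal r P" G] norm_normal[OF P] by simp
    finally show ?thesis .
  qed
  have iG: "(\<i> *s G) \<bullet> G = 0"
    by (simp add: inner_vec_def inner_complex_def algebra_simps)
  have lG: "\<l> G = of_real ((norm G)\<^sup>2) / 2"
    unfolding l iG by (simp add: dot_square_norm)
  \<comment> \<open>\<open>\<l>\<close> is the form \<open>\<partial>r\<close>, and \<open>\<mu> G\<close> is the complex normal component of \<open>v\<close>\<close>
  define \<mu> where "\<mu> = \<l> v / \<l> G"
  define v' where "v' = v - \<mu> *s G"
  have "\<l> v' = \<l> v - \<mu> * \<l> G"
    unfolding \<l>_def v'_def by (simp add: algebra_simps sum_subtractf sum_distrib_left)
  moreover have "\<l> G \<noteq> 0"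
    using G c_pos lG by auto
  ultimately have "\<l> v' = 0"
    by (simp add: \<mu>_def)
  then have "v' \<in> complex_tangent_space r P"
    by (simp add: complex_tangent_space_def \<l>_def)
  then have pos: "0 \<le> iter_deriv [v', v'] r P + iter_deriv [\<i> *s v', \<i> *s v'] r P"
    using pc P unfolding pseudoconvex_def levi_form_eq[OF open_U smooth_r PU, symmetric] by simp
  define T where "T = \<bar>iter_deriv [v] r P\<bar> + \<bar>iter_deriv [\<i> *s v] r P\<bar>"
  have lv: "2 * norm (\<l> v) \<le> T"
  proof -
    have "2 * norm (\<l> v) = norm (of_real (v \<bullet> G) - \<i> * of_real ((\<i> *s v) \<bullet> G))"
      unfolding l by (simp add: norm_divide)
    also have "\<dots> \<le> norm (of_real (v \<bullet> G) :: complex) + norm (\<i> * of_real ((\<i> *s v) \<bullet> G))"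
      by (rule norm_triangle_ineq4)
    also have "\<dots> = T" by (simp add: T_def inner G_def norm_mult)
    finally show ?thesis .
  qed
  have iv: "norm (\<i> *s w) = norm w" for w :: "complex^'n" by (simp add: norm_complex_smult)
  have diffv: "norm (v - v') \<le> T / c"
  proof -
    have "norm (v - v') = 2 * norm (\<l> v) / norm G"
      using G c_pos by (simp add: v'_def norm_complex_smult \<mu>_def lG norm_divide power2_eq_square norm_mult)
    also have "\<dots> \<le> T / c"
      by (rule frac_le[OF _ lv c_pos G]) (simp add: T_def)
    finally show ?thesis .
  qed
  have T0: "T \<ge> 0" "T \<le> 2 * B 1"
    using deriv_bound[OF P Pb, of "[v]"] deriv_bound[OF P Pb, of "[\<i> *s v]"] v iv[of v]
    by (simp_all add: T_def)
  have nv': "norm v' \<le> 1 + 2 * B 1 / c"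
  proof -
    have "norm v' \<le> norm v + norm (v - v')"
      using norm_triangle_ineq4[of v "v - v'"] by simp
    also have "\<dots> \<le> 1 + 2 * B 1 / c"
      using diffv T0 c_pos v divide_right_mono[of T "2 * B 1" c] by simp
    finally show ?thesis .
  qed
  have cmp: "\<bar>iter_deriv [a, a] r P - iter_deriv [b, b] r P\<bar> \<le> B 2 * (norm a + norm b) * norm (a - b)" for a b
  proof -
    note bil = bilinear_second_derivative[OF open_U smooth_r PU]
    have "iter_deriv [a, a] r P - iter_deriv [b, b] r P = iter_deriv [a - b, a] r P + iter_deriv [b, a - b] r P"
      using bilinear_lsub[OF bil] bilinear_rsub[OF bil] by simp
    moreover have "\<bar>iter_deriv [a - b, a] r P\<bar> \<le> B 2 * (norm (a - b) * norm a)"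
      "\<bar>iter_deriv [b, a - b] r P\<bar> \<le> B 2 * (norm b * norm (a - b))"
      using deriv_bound[OF P Pb, of "[a - b, a]"] deriv_bound[OF P Pb, of "[b, a - b]"]
      by (simp_all add: numeral_2_eq_2)
    ultimately show ?thesis by (simp add: algebra_simps)
  qed
  define V where "V = 1 + 2 * B 1 / c"
  have "B 2 * (norm v + norm v') * norm (v - v') \<le> B 2 * (1 + V) * (T / c)"
    using nv' v diffv B_pos[of 2] B_pos[of 1] c_pos T0 unfolding V_def
    by (intro mult_mono) auto
  moreover have "\<bar>iter_deriv [v, v] r P - iter_deriv [v', v'] r P\<bar> \<le> B 2 * (norm v + norm v') * norm (v - v')"
    by (rule cmp)
  moreover have "\<bar>iter_deriv [\<i> *s v, \<i> *s v] r P - iter_deriv [\<i> *s v', \<i> *s v'] r P\<bar> \<le> B 2 * (norm v + norm v') * norm (v - v')"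
    using cmp[of "\<i> *s v" "\<i> *s v'"] unfolding vector_ssub_ldistrib[symmetric] iv .
  ultimately have "- 2 * (B 2 * (1 + V) * (T / c)) \<le> iter_deriv [v, v] r P + iter_deriv [\<i> *s v, \<i> *s v] r P"
    using pos by linarith
  moreover have "- (2 * B 2 * (2 + 2 * B 1 / c) / c) * T = - 2 * (B 2 * (1 + V) * (T / c))"
    by (simp add: V_def algebra_simps add_divide_distrib)
  ultimately show ?thesis
    unfolding T_def[symmetric] by linarith
qed

text \<open>Comparison with a boundary point at distance at most \<open>\<bar>r z\<bar> / c\<close>, at which the preceding bound
  applies. All derivatives involved are Lipschitz, which produces the term \<open>\<bar>r z\<bar>\<close>.\<close>

lemma levi_lower_bound:
  assumes "pseudoconvex \<Omega> r"
  obtains \<eta>' C where "0 < \<eta>'" "\<eta>' \<le> \<eta>" "C \<ge> 0"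
    "\<And>P v z. P \<in> frontier \<Omega> \<Longrightarrow> norm v = 1 \<Longrightarrow> z \<in> cball P \<eta>' \<Longrightarrow>
      - C * (\<bar>r z\<bar> + \<bar>iter_deriv [v] r z\<bar> + \<bar>iter_deriv [\<i> *s v] r z\<bar>)
        \<le> iter_deriv [v, v] r z + iter_deriv [\<i> *s v, \<i> *s v] r z"
proof -
  define \<eta>' where "\<eta>' = \<eta> / (1 + B 1 / c)"
  define A where "A = 2 * B 2 * (2 + 2 * B 1 / c) / c"
  define C where "C = A * (1 + 2 * B 2 / c) + 2 * B 3 / c"
  have A: "A \<ge> 0" using B_pos[of 1] B_pos[of 2] c_pos by (simp add: A_def)
  have C: "C \<ge> A" "C \<ge> 0"
  proof -
    have "A * 1 \<le> A * (1 + 2 * B 2 / c)"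
      using A B_pos[of 2] c_pos by (intro mult_left_mono) auto
    moreover have "2 * B 3 / c \<ge> 0" using B_pos[of 3] c_pos by simp
    ultimately show "C \<ge> A" unfolding C_def by linarith
    then show "C \<ge> 0" using A by linarith
  qed
  have "1 + B 1 / c \<ge> 1" using B_pos[of 1] c_pos by simp
  then have \<eta>': "0 < \<eta>'" "\<eta>' \<le> \<eta>" "\<eta>' * (1 + B 1 / c) = \<eta>"
    using \<eta>_pos by (auto simp: \<eta>'_def divide_le_eq mult_le_cancel_left1)
  have "- C * (\<bar>r z\<bar> + \<bar>iter_deriv [v] r z\<bar> + \<bar>iter_deriv [\<i> *s v] r z\<bar>)
        \<le> iter_deriv [v, v] r z + iter_deriv [\<i> *s v, \<i> *s v] r z"
    if P: "P \<in> frontier \<Omega>" and v: "norm v = 1" and z: "z \<in> cball P \<eta>'" for P v z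
  proof -
    have zb: "z \<in> cball P \<eta>" "P \<in> cball P \<eta>" using z \<eta>' by auto
    have "\<bar>r z\<bar> \<le> B 1 * norm (z - P)"
      using lipschitz[OF P zb, of "[]"] r_frontier[OF P] by simp
    then have "\<bar>r z\<bar> / c \<le> B 1 / c * norm (z - P)"
      using c_pos by (simp add: field_simps)
    then have "norm (z - P) + \<bar>r z\<bar> / c \<le> norm (z - P) * (1 + B 1 / c)"
      by (simp add: algebra_simps)
    also have "\<dots> \<le> \<eta>' * (1 + B 1 / c)"
      using z B_pos[of 1] c_pos by (intro mult_right_mono) (auto simp: dist_norm norm_minus_commute)
    finally have "norm (z - P) + \<bar>r z\<bar> / c \<le> \<eta>" unfolding \<eta>' .
    \<comment> \<open>\<open>\<eta>'\<close> is such that \<open>z\<close>, moved by \<open>\<bar>r z\<bar> / c\<close>, stays in the collar\<close>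
    from nearby_boundary_point[OF P this] obtain z' where
      z': "z' \<in> frontier \<Omega>" "norm (z' - P) \<le> \<eta>" "norm (z - z') \<le> \<bar>r z\<bar> / c" .
    have z'b: "z' \<in> cball P \<eta>" using z'(2) by (simp add: dist_norm norm_minus_commute)
    have iv: "norm (\<i> *s v) = 1" using v by (simp add: norm_complex_smult)
    have cmp: "\<bar>iter_deriv us r z - iter_deriv us r z'\<bar> \<le> B (Suc (length us)) * (\<bar>r z\<bar> / c)"
      if "prod_list (map norm us) = 1" for us
    proof -
      have "\<bar>iter_deriv us r z - iter_deriv us r z'\<bar> \<le> B (Suc (length us)) * norm (z - z')"
        using lipschitz[OF P zb(1) z'b, of us] that by simp
      also have "\<dots> \<le> B (Suc (length us)) * (\<bar>r z\<bar> / c)"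
        using z'(3) B_pos[of "Suc (length us)"] by (intro mult_left_mono) auto
      finally show ?thesis .
    qed
    let ?D = "\<lambda>z. \<bar>iter_deriv [v] r z\<bar> + \<bar>iter_deriv [\<i> *s v] r z\<bar>"
    let ?L = "\<lambda>z. iter_deriv [v, v] r z + iter_deriv [\<i> *s v, \<i> *s v] r z"
    have "?D z' \<le> ?D z + 2 * (B 2 * (\<bar>r z\<bar> / c))"
      using cmp[of "[v]"] cmp[of "[\<i> *s v]"] v iv by (simp add: numeral_2_eq_2 del: iter_deriv.simps)
    then have "A * ?D z' \<le> A * (?D z + 2 * (B 2 * (\<bar>r z\<bar> / c)))"
      using A by (rule mult_left_mono)
    moreover have "- A * ?D z' \<le> ?L z'"
      unfolding A_def by (rule levi_lower_bound_at_boundary[OF assms z'(1) v])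
    moreover have "?L z' \<le> ?L z + 2 * (B 3 * (\<bar>r z\<bar> / c))"
      using cmp[of "[v, v]"] cmp[of "[\<i> *s v, \<i> *s v]"] v iv by (simp add: numeral_3_eq_3 del: iter_deriv.simps)
    ultimately have "- (A * (?D z + 2 * (B 2 * (\<bar>r z\<bar> / c)))) - 2 * (B 3 * (\<bar>r z\<bar> / c)) \<le> ?L z"
      by simp
    moreover have "A * (?D z + 2 * (B 2 * (\<bar>r z\<bar> / c))) + 2 * (B 3 * (\<bar>r z\<bar> / c)) = A * ?D z + (C - A) * \<bar>r z\<bar>"
      by (simp add: C_def algebra_simps)
    moreover have "A * ?D z \<le> C * ?D z" using C by (intro mult_right_mono) auto
    moreover have "(C - A) * \<bar>r z\<bar> \<le> C * \<bar>r z\<bar>" using A by (intro mult_right_mono) auto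
    ultimately show ?thesis by (simp add: distrib_left del: iter_deriv.simps)
  qed
  then show thesis using that \<eta>'(1,2) C(2) by blast
qed

end

section \<open>Finite type and the gauge of a complex line\<close>

text \<open>The complex line \<open>\<zeta> \<mapsto> P + \<zeta> v\<close> is one of the curves in the definition of the type, and it has
  order at most one. If all derivatives of \<open>r\<close> along it vanished, its quotient of orders would be infinite.\<close>

lemma finite_type_imp_plane_deriv_nonzero:
  fixes r :: "complex^'n \<Rightarrow> real"
  assumes "open U" "smooth_on U r" "P \<in> U" "r P = 0" "v \<noteq> 0" "dangelo_type r P < \<infinity>"
  shows "\<exists>i j. iter_deriv (replicate i v @ replicate j (\<i> *s v)) r P \<noteq> 0"
proof (rule ccontr)
  assume "\<not> ?thesis"
  then have zero: "iter_deriv (replicate i v @ replicate j (\<i> *s v)) r P = 0" for i j by blast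
  then have zero': "iter_deriv (replicate i v @ replicate j (\<i> *s v)) r (P + 0 *s v) = 0" for i j by simp
  define F where "F \<zeta> = P + \<zeta> *s v" for \<zeta>
  have "\<not> (\<forall>\<^sub>F \<zeta> in nhds 0. F \<zeta> = P)"
  proof
    assume "\<forall>\<^sub>F \<zeta> in nhds 0. F \<zeta> = P"
    then obtain d where d: "d > 0" "\<And>\<zeta>. dist \<zeta> 0 < d \<Longrightarrow> F \<zeta> = P"
      unfolding eventually_nhds_metric by blast
    have "F (of_real (d / 2)) = P" by (rule d(2)) (use d(1) in simp)
    then show False using d(1) assms(5) by (auto simp: F_def vec_eq_iff)
  qed
  then have F: "F \<in> holomorphic_curves_at P"
    by (auto simp: holomorphic_curves_at_def F_def intro!: analytic_intros)
  have "iter_deriv vs (\<lambda>\<zeta>. (r \<circ> F) \<zeta> - (r \<circ> F) 0) 0 = 0" for vs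
  proof -
    have "iter_deriv vs (\<lambda>\<zeta>. (r \<circ> F) \<zeta> - (r \<circ> F) 0) 0 = iter_deriv (map (\<lambda>c. c *s v) vs) r (P + 0 *s v)"
      using iter_deriv_complex_line[OF assms(1,2), of P 0 v vs] assms(3,4) by (simp add: F_def o_def)
    also have "\<dots> = 0"
    proof (rule iter_deriv_eq_0_if_plane_eq_0[OF assms(1,2) _ zero'])
      show "P + 0 *s v \<in> U" using assms(3) by simp
      fix a assume "a \<in> set (map (\<lambda>c. c *s v) vs)"
      then obtain c where "a = c *s v" by auto
      then show "\<exists>\<alpha> \<beta>. a = \<alpha> *\<^sub>R v + \<beta> *\<^sub>R (\<i> *s v)"
        using complex_smult_eq[of c v] by blast
    qed
    finally show ?thesis .
  qed
  then have "{vs. iter_deriv vs (\<lambda>\<zeta>. (r \<circ> F) \<zeta> - (r \<circ> F) 0) 0 \<noteq> 0} = {}"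
    by blast
  then have 1: "vanishing_order (r \<circ> F) = \<infinity>"
    unfolding vanishing_order_def by (simp add: top_enat_def)
  obtain j where j: "v $ j \<noteq> 0" using assms(5) by (auto simp: vec_eq_iff)
  have "((\<lambda>\<zeta>. F \<zeta> $ j - F 0 $ j) has_derivative (\<lambda>\<zeta>. \<zeta> * v $ j)) (at 0)"
    by (auto simp: F_def intro!: derivative_eq_intros)
  then have "frechet_derivative (\<lambda>\<zeta>. F \<zeta> $ j - F 0 $ j) (at 0) = (\<lambda>\<zeta>. \<zeta> * v $ j)"
    by (rule frechet_derivative_at[symmetric])
  then have "iter_deriv [1] (\<lambda>\<zeta>. F \<zeta> $ j - F 0 $ j) 0 \<noteq> 0" using j by simp
  then have "vanishing_order (\<lambda>\<zeta>. F \<zeta> $ j) \<le> enat (length [1::complex])"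
    unfolding vanishing_order_def by (intro INF_lower) blast
  then have "vanishing_order_vec F \<le> enat 1"
    unfolding vanishing_order_vec_def by (intro INF_lower2[of j]) auto
  then obtain k where k: "vanishing_order_vec F = enat k" by (cases "vanishing_order_vec F") auto
  \<comment> \<open>in the extended reals \<open>\<infinity> / k = \<infinity>\<close> for \<open>k = 0\<close> as well\<close>
  have "\<infinity> = ereal_of_enat (vanishing_order (r \<circ> F)) / ereal_of_enat (vanishing_order_vec F)"
    unfolding 1 k by (cases k) (simp_all add: divide_ereal_def)
  also have "\<dots> \<le> dangelo_type r P"
    unfolding dangelo_type_def by (rule SUP_upper[OF F])
  finally show False using assms(6) by simp
qed

lemma abs_coeff_le_bipoly_norm:
  assumes "i + j < n"
  shows "\<bar>b i j\<bar> \<le> bipoly_norm n b"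
proof -
  have "\<bar>b i j\<bar> \<le> (\<Sum>j<n-i. \<bar>b i j\<bar>)"
    by (rule member_le_sum[of j "{..<n-i}" "\<lambda>j. \<bar>b i j\<bar>"]) (use assms in auto)
  also have "\<dots> \<le> bipoly_norm n b"
    unfolding bipoly_norm_def
    by (rule member_le_sum[of i "{..<n}" "\<lambda>i. \<Sum>j<n-i. \<bar>b i j\<bar>"]) (use assms in \<open>auto intro: sum_nonneg\<close>)
  finally show ?thesis .
qed

lemma prod_list_norm_units: "(\<And>u. u \<in> set us \<Longrightarrow> norm u = 1) \<Longrightarrow> prod_list (map norm us) = 1"
  by (induction us) auto

context collar
begin

text \<open>If the claim failed for every \<open>n\<close>, with bounds tending to zero, a limit of the corresponding
  boundary points and unit vectors would be a complex line along which all derivatives of \<open>r\<close> vanish.\<close>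

lemma uniform_finite_order:
  assumes F: "compact (frontier \<Omega>)" and ft: "finite_type \<Omega> r"
  obtains n a where "n \<ge> 2" "a > 0"
    "\<And>P v. P \<in> frontier \<Omega> \<Longrightarrow> norm v = 1 \<Longrightarrow> a \<le> bipoly_norm n (plane_coeff r P v (\<i> *s v))"
proof -
  have "\<exists>n. n \<ge> 2 \<and> (\<exists>a>0. \<forall>P\<in>frontier \<Omega>. \<forall>v. norm v = 1 \<longrightarrow> a \<le> bipoly_norm n (plane_coeff r P v (\<i> *s v)))"
  proof (rule ccontr)
    assume neg: "\<not> ?thesis"
    have "\<exists>P v. P \<in> frontier \<Omega> \<and> norm v = 1 \<and>
        bipoly_norm (k + 2) (plane_coeff r P v (\<i> *s v)) < inverse (real (Suc k))" for k
    proof (rule ccontr)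
      assume "\<not> ?thesis"
      then have "\<forall>P\<in>frontier \<Omega>. \<forall>v. norm v = 1 \<longrightarrow>
          inverse (real (Suc k)) \<le> bipoly_norm (k + 2) (plane_coeff r P v (\<i> *s v))"
        by (auto simp: not_less)
      moreover have "k + 2 \<ge> 2" "inverse (real (Suc k)) > 0" by simp_all
      ultimately show False using neg by blast
    qed
    then obtain P v where Pv: "\<And>k. P k \<in> frontier \<Omega>" "\<And>k. norm (v k) = 1"
      "\<And>k. bipoly_norm (k + 2) (plane_coeff r (P k) (v k) (\<i> *s v k)) < inverse (real (Suc k))"
      by metis
    have "compact (frontier \<Omega> \<times> sphere (0 :: complex^'n) 1)"
      by (intro compact_Times F compact_sphere)
    moreover have "\<forall>k. (P k, v k) \<in> frontier \<Omega> \<times> sphere (0 :: complex^'n) 1"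
      using Pv(1,2) by simp
    ultimately have "\<exists>q\<in>frontier \<Omega> \<times> sphere (0 :: complex^'n) 1. \<exists>\<sigma>. strict_mono \<sigma> \<and> ((\<lambda>k. (P k, v k)) \<circ> \<sigma>) \<longlonglongrightarrow> q"
      unfolding compact_def by (elim allE[where x = "\<lambda>k. (P k, v k)"] impE)
    then obtain q \<sigma> where q: "q \<in> frontier \<Omega> \<times> sphere 0 1" and \<sigma>: "strict_mono \<sigma>"
      and lim: "((\<lambda>k. (P k, v k)) \<circ> \<sigma>) \<longlonglongrightarrow> q"
      by blast
    obtain P0 v0 where q0: "q = (P0, v0)" by (cases q)
    have lim: "(\<lambda>k. P (\<sigma> k)) \<longlonglongrightarrow> P0" "(\<lambda>k. v (\<sigma> k)) \<longlonglongrightarrow> v0"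
      using tendsto_fst[OF lim] tendsto_snd[OF lim] by (simp_all add: q0 o_def)
    have P0: "P0 \<in> frontier \<Omega>" "norm v0 = 1" "P0 \<in> U" using q cball_subset[of P0] \<eta>_pos by (auto simp: q0)
    have "iter_deriv (replicate i v0 @ replicate j (\<i> *s v0)) r P0 = 0" for i j
    proof -
      have lin: "bounded_linear (\<lambda>v :: complex^'n. \<i> *s v)"
        by (rule bounded_linear_intro[where K = 1]) (auto simp: norm_complex_smult vec_eq_iff algebra_simps)
      define V where "V b k = (if b then v (\<sigma> k) else \<i> *s v (\<sigma> k))" for b k
      define L where "L b = (if b then v0 else \<i> *s v0)" for b
      have "(V b \<longlongrightarrow> L b) sequentially" for b
        using lim(2) bounded_linear.tendsto[OF lin lim(2)] unfolding V_def L_def by (cases b) simp_all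
      from iter_deriv_tendsto[where V = V and L = L and ks = "replicate i True @ replicate j False",
          OF open_U smooth_r P0(3) lim(1) this]
      have "(\<lambda>k. iter_deriv (replicate i (v (\<sigma> k)) @ replicate j (\<i> *s v (\<sigma> k))) r (P (\<sigma> k)))
          \<longlonglongrightarrow> iter_deriv (replicate i v0 @ replicate j (\<i> *s v0)) r P0"
        by (simp add: V_def L_def map_replicate)
      then have "(\<lambda>k. plane_coeff r (P (\<sigma> k)) (v (\<sigma> k)) (\<i> *s v (\<sigma> k)) i j) \<longlonglongrightarrow> plane_coeff r P0 v0 (\<i> *s v0) i j"
        unfolding plane_coeff_def by (intro tendsto_divide tendsto_const) auto
      moreover have "(\<lambda>k. plane_coeff r (P (\<sigma> k)) (v (\<sigma> k)) (\<i> *s v (\<sigma> k)) i j) \<longlonglongrightarrow> 0"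
      proof (rule Lim_null_comparison)
        show "(\<lambda>k. inverse (real (Suc (\<sigma> k)))) \<longlonglongrightarrow> 0"
          using LIMSEQ_subseq_LIMSEQ[OF LIMSEQ_inverse_real_of_nat \<sigma>] by (simp add: o_def)
        show "\<forall>\<^sub>F k in sequentially. norm (plane_coeff r (P (\<sigma> k)) (v (\<sigma> k)) (\<i> *s v (\<sigma> k)) i j) \<le> inverse (real (Suc (\<sigma> k)))"
          using eventually_ge_at_top[of "i + j"]
        proof eventually_elim
          case (elim k)
          then have "i + j < \<sigma> k + 2" using strict_mono_imp_increasing[OF \<sigma>, of k] by linarith
          then show ?case
            using abs_coeff_le_bipoly_norm[of i j "\<sigma> k + 2" "plane_coeff r (P (\<sigma> k)) (v (\<sigma> k)) (\<i> *s v (\<sigma> k))"]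
              Pv(3)[of "\<sigma> k"] by simp
        qed
      qed
      ultimately have "plane_coeff r P0 v0 (\<i> *s v0) i j = 0"
        using LIMSEQ_unique by blast
      then show ?thesis by (simp add: plane_coeff_def)
    qed
    moreover have "dangelo_type r P0 < \<infinity>" using ft P0(1) by (simp add: finite_type_def)
    moreover have "v0 \<noteq> 0" using P0(2) by auto
    ultimately show False
      using finite_type_imp_plane_deriv_nonzero[OF open_U smooth_r P0(3) r_frontier[OF P0(1)]] by blast
  qed
  then show thesis using that by blast
qed

text \<open>The gauge is \<open>N \<rho> = \<Sum> \<bar>a\<^sub>i\<^sub>j\<bar> \<rho>^(i + j)\<close> with the Taylor coefficients of \<open>r\<close> in the plane of \<open>v\<close> and \<open>\<i> v\<close>.
  It is comparable to the maximum of \<open>r\<close> over the disc of radius \<open>\<rho>\<close>, with constants that do not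
  depend on the boundary point or on the direction.\<close>

lemma tangential_gauge:
  assumes "compact (frontier \<Omega>)" "pseudoconvex \<Omega> r" "finite_type \<Omega> r"
  shows "\<exists>(m::nat)>0. \<exists>a>0. \<exists>A>0. \<exists>\<kappa>>0. \<exists>K>0. \<exists>\<rho>0>0. \<rho>0 \<le> 1 \<and> \<rho>0 \<le> \<eta> \<and>
    (\<forall>P\<in>frontier \<Omega>. \<forall>v. norm v = 1 \<longrightarrow> (\<exists>N :: real \<Rightarrow> real.
      (\<forall>\<rho>. 0 < \<rho> \<and> \<rho> \<le> \<rho>0 \<longrightarrow> a * \<rho> ^ m \<le> N \<rho> \<and> N \<rho> \<le> A * \<rho> \<and>
         (\<exists>\<zeta>. norm \<zeta> \<le> \<rho> \<and> \<kappa> * N \<rho> \<le> r (P + \<zeta> *s v)) \<and>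
         (\<forall>\<zeta>. norm \<zeta> \<le> \<rho> \<longrightarrow> r (P + \<zeta> *s v) \<le> K * N \<rho>)) \<and>
      (\<forall>\<rho> \<rho>'. 0 \<le> \<rho> \<and> \<rho> \<le> \<rho>' \<longrightarrow> N \<rho> \<le> N \<rho>') \<and>
      (\<forall>\<rho>\<ge>0. N (2 * \<rho>) \<le> 2 ^ m * N \<rho>)))"
proof -
  obtain n a where n: "n \<ge> 2" and a: "a > 0" and
    low: "\<And>P v. P \<in> frontier \<Omega> \<Longrightarrow> norm v = 1 \<Longrightarrow> a \<le> bipoly_norm n (plane_coeff r P v (\<i> *s v))"
    by (rule uniform_finite_order[OF assms(1,3)]) (rule that)
  obtain \<eta>' C where \<eta>': "0 < \<eta>'" "\<eta>' \<le> \<eta>" and C: "C \<ge> 0" and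
    lap: "\<And>P v z. P \<in> frontier \<Omega> \<Longrightarrow> norm v = 1 \<Longrightarrow> z \<in> cball P \<eta>' \<Longrightarrow>
      - C * (\<bar>r z\<bar> + \<bar>iter_deriv [v] r z\<bar> + \<bar>iter_deriv [\<i> *s v] r z\<bar>)
        \<le> iter_deriv [v, v] r z + iter_deriv [\<i> *s v, \<i> *s v] r z"
    by (rule levi_lower_bound[OF assms(2)]) (rule that)
  define \<rho>1 where "\<rho>1 = \<eta>' / 2"
  have \<rho>1: "\<rho>1 > 0" using \<eta>' by (simp add: \<rho>1_def)
  obtain \<kappa> K \<rho>0 where \<kappa>: "\<kappa> > 0" "K > 0" and \<rho>0: "0 < \<rho>0" "\<rho>0 \<le> 1" "\<rho>0 \<le> \<rho>1" and
    bd: "\<forall>U (f :: complex^'n \<Rightarrow> real) x u w \<rho>.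
      almost_subharmonic_plane n (B n) C a \<rho>1 U f x u w \<longrightarrow> 0 < \<rho> \<longrightarrow> \<rho> \<le> \<rho>0 \<longrightarrow>
        (\<exists>s t. s\<^sup>2 + t\<^sup>2 \<le> \<rho>\<^sup>2 \<and>
           \<kappa> * bipoly_norm n (\<lambda>i j. plane_coeff f x u w i j * \<rho> ^ (i + j)) \<le> f (x + s *\<^sub>R u + t *\<^sub>R w)) \<and>
        (\<forall>s t. \<bar>s\<bar> \<le> \<rho> \<longrightarrow> \<bar>t\<bar> \<le> \<rho> \<longrightarrow>
           f (x + s *\<^sub>R u + t *\<^sub>R w) \<le> K * bipoly_norm n (\<lambda>i j. plane_coeff f x u w i j * \<rho> ^ (i + j)))"
    using almost_subharmonic_max_bound[OF n less_imp_le[OF B_pos[of n]] C a \<rho>1, where 'a = "complex^'n"]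
    by (elim exE conjE) (rule that)
  define A where "A = 1 + (\<Sum>i<n. \<Sum>j<n-i. B (i + j))"
  have A: "A > 0" unfolding A_def using B_pos by (intro add_pos_nonneg sum_nonneg) (auto intro: less_imp_le)
  have gauge: "\<exists>N :: real \<Rightarrow> real.
      (\<forall>\<rho>. 0 < \<rho> \<and> \<rho> \<le> \<rho>0 \<longrightarrow> a * \<rho> ^ n \<le> N \<rho> \<and> N \<rho> \<le> A * \<rho> \<and>
         (\<exists>\<zeta>. norm \<zeta> \<le> \<rho> \<and> \<kappa> * N \<rho> \<le> r (P + \<zeta> *s v)) \<and>
         (\<forall>\<zeta>. norm \<zeta> \<le> \<rho> \<longrightarrow> r (P + \<zeta> *s v) \<le> K * N \<rho>)) \<and>
      (\<forall>\<rho> \<rho>'. 0 \<le> \<rho> \<and> \<rho> \<le> \<rho>' \<longrightarrow> N \<rho> \<le> N \<rho>') \<and>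
      (\<forall>\<rho>\<ge>0. N (2 * \<rho>) \<le> 2 ^ n * N \<rho>)"
    if P: "P \<in> frontier \<Omega>" and v: "norm v = 1" for P v
  proof -
    let ?w = "\<i> *s v"
    let ?pc = "plane_coeff r P v ?w"
    define N where "N \<rho> = bipoly_norm n (\<lambda>i j. ?pc i j * \<rho> ^ (i + j))" for \<rho>
    have w: "norm ?w = 1" using v by (simp add: norm_complex_smult)
    have mem: "P + s *\<^sub>R v + t *\<^sub>R ?w \<in> cball P \<eta>'" if "\<bar>s\<bar> \<le> \<rho>1" "\<bar>t\<bar> \<le> \<rho>1" for s t
    proof -
      have "norm (s *\<^sub>R v + t *\<^sub>R ?w) \<le> \<bar>s\<bar> + \<bar>t\<bar>"
        using norm_triangle_ineq[of "s *\<^sub>R v" "t *\<^sub>R ?w"] v w by simp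
      moreover have "dist P (P + s *\<^sub>R v + t *\<^sub>R ?w) = norm (s *\<^sub>R v + t *\<^sub>R ?w)"
        unfolding add.assoc dist_norm by (subst norm_minus_commute) simp
      ultimately show ?thesis
        using that unfolding \<rho>1_def mem_cball by linarith
    qed
    have mem': "P + s *\<^sub>R v + t *\<^sub>R ?w \<in> cball P \<eta>" if "\<bar>s\<bar> \<le> \<rho>1" "\<bar>t\<bar> \<le> \<rho>1" for s t
      using mem[OF that] \<eta>' by auto
    have line: "P + \<zeta> *s v = P + Re \<zeta> *\<^sub>R v + Im \<zeta> *\<^sub>R ?w" for \<zeta>
      using complex_smult_eq[of \<zeta> v] by (simp add: add.assoc)
    have "almost_subharmonic_plane n (B n) C a \<rho>1 U r P v ?w"
      unfolding almost_subharmonic_plane_def Let_def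
    proof (intro conjI allI impI)
      fix s t assume st: "\<bar>s\<bar> \<le> \<rho>1" "\<bar>t\<bar> \<le> \<rho>1"
      show "P + s *\<^sub>R v + t *\<^sub>R ?w \<in> U"
        using mem'[OF st] cball_subset[OF P] by blast
      show "- C * (\<bar>r (P + s *\<^sub>R v + t *\<^sub>R ?w)\<bar> + \<bar>iter_deriv [v] r (P + s *\<^sub>R v + t *\<^sub>R ?w)\<bar>
            + \<bar>iter_deriv [?w] r (P + s *\<^sub>R v + t *\<^sub>R ?w)\<bar>)
          \<le> iter_deriv [v, v] r (P + s *\<^sub>R v + t *\<^sub>R ?w) + iter_deriv [?w, ?w] r (P + s *\<^sub>R v + t *\<^sub>R ?w)"
        by (rule lap[OF P v mem[OF st]])
      fix us assume us: "set us \<subseteq> {v, ?w}" "length us = n"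
      have "prod_list (map norm us) = 1" using us(1) v w by (intro prod_list_norm_units) auto
      then show "\<bar>iter_deriv us r (P + s *\<^sub>R v + t *\<^sub>R ?w)\<bar> \<le> B n"
        using deriv_bound[OF P mem'[OF st], of us] us(2) by simp
    qed (use open_U smooth_r r_frontier[OF P] low[OF P v] in auto)
    then have main: "(\<exists>s t. s\<^sup>2 + t\<^sup>2 \<le> \<rho>\<^sup>2 \<and> \<kappa> * N \<rho> \<le> r (P + s *\<^sub>R v + t *\<^sub>R ?w)) \<and>
        (\<forall>s t. \<bar>s\<bar> \<le> \<rho> \<longrightarrow> \<bar>t\<bar> \<le> \<rho> \<longrightarrow> r (P + s *\<^sub>R v + t *\<^sub>R ?w) \<le> K * N \<rho>)"
      if "0 < \<rho>" "\<rho> \<le> \<rho>0" for \<rho>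
      unfolding N_def using bd that by blast
    have "a * \<rho> ^ n \<le> N \<rho> \<and> N \<rho> \<le> A * \<rho> \<and>
         (\<exists>\<zeta>. norm \<zeta> \<le> \<rho> \<and> \<kappa> * N \<rho> \<le> r (P + \<zeta> *s v)) \<and>
         (\<forall>\<zeta>. norm \<zeta> \<le> \<rho> \<longrightarrow> r (P + \<zeta> *s v) \<le> K * N \<rho>)" if \<rho>: "0 < \<rho>" "\<rho> \<le> \<rho>0" for \<rho>
    proof (intro conjI)
      have "\<rho> ^ n \<le> \<rho> ^ (n-1)" using \<rho> \<rho>0 by (intro power_decreasing) auto
      then have "a * \<rho> ^ n \<le> \<rho> ^ (n-1) * bipoly_norm n ?pc"
        using mult_mono[OF low[OF P v], of "\<rho> ^ n" "\<rho> ^ (n-1)"] low[OF P v] a \<rho>(1) by (simp add: mult.commute)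
      also have "\<dots> \<le> N \<rho>" unfolding N_def using \<rho> \<rho>0 by (intro bipoly_norm_lower) auto
      finally show "a * \<rho> ^ n \<le> N \<rho>" .
      have "bipoly_norm n ?pc \<le> (\<Sum>i<n. \<Sum>j<n-i. B (i + j))"
        unfolding bipoly_norm_def
      proof (intro sum_mono)
        fix i j :: nat
        have "prod_list (map norm (replicate i v @ replicate j ?w)) = 1"
          using v w by (intro prod_list_norm_units) auto
        then have "\<bar>iter_deriv (replicate i v @ replicate j ?w) r P\<bar> \<le> B (i + j)"
          using deriv_bound[OF P, of P "replicate i v @ replicate j ?w"] \<eta>_pos by simp
        moreover have "\<bar>?pc i j\<bar> \<le> \<bar>iter_deriv (replicate i v @ replicate j ?w) r P\<bar>"
          unfolding plane_coeff_def abs_divide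
          by (auto simp: divide_le_eq mult_le_cancel_left1 abs_mult fact_ge_1 intro!: mult_ge1_I)
        ultimately show "\<bar>?pc i j\<bar> \<le> B (i + j)" by linarith
      qed
      then have "\<rho> * bipoly_norm n ?pc \<le> \<rho> * A" using \<rho>(1) by (simp add: A_def)
      moreover have "N \<rho> \<le> \<rho> * bipoly_norm n ?pc"
        unfolding N_def using \<rho> \<rho>0 r_frontier[OF P] by (intro bipoly_norm_upper) (auto simp: plane_coeff_def)
      ultimately show "N \<rho> \<le> A * \<rho>" by (simp add: mult.commute)
      obtain s t where st: "s\<^sup>2 + t\<^sup>2 \<le> \<rho>\<^sup>2" "\<kappa> * N \<rho> \<le> r (P + s *\<^sub>R v + t *\<^sub>R ?w)"
        using main[OF \<rho>] by blast
      have "norm (Complex s t) \<le> \<rho>"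
        using st(1) \<rho>(1) by (simp add: complex_norm real_le_lsqrt)
      moreover have "\<kappa> * N \<rho> \<le> r (P + Complex s t *s v)"
        using st(2) line[of "Complex s t"] by (simp only: complex.sel)
      ultimately show "\<exists>\<zeta>. norm \<zeta> \<le> \<rho> \<and> \<kappa> * N \<rho> \<le> r (P + \<zeta> *s v)" by blast
      show "\<forall>\<zeta>. norm \<zeta> \<le> \<rho> \<longrightarrow> r (P + \<zeta> *s v) \<le> K * N \<rho>"
      proof (intro allI impI)
        fix \<zeta> :: complex assume "norm \<zeta> \<le> \<rho>"
        then have "\<bar>Re \<zeta>\<bar> \<le> \<rho>" "\<bar>Im \<zeta>\<bar> \<le> \<rho>"
          using abs_Re_le_cmod[of \<zeta>] abs_Im_le_cmod[of \<zeta>] by linarith+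
        then show "r (P + \<zeta> *s v) \<le> K * N \<rho>"
          unfolding line[of \<zeta>] using main[OF \<rho>] by blast
      qed
    qed
    moreover have "N \<rho> \<le> N \<rho>'" if "0 \<le> \<rho>" "\<rho> \<le> \<rho>'" for \<rho> \<rho>'
      unfolding N_def by (rule bipoly_norm_mono[OF that])
    moreover have "N (2 * \<rho>) \<le> 2 ^ n * N \<rho>" if "\<rho> \<ge> 0" for \<rho>
      unfolding N_def by (rule bipoly_norm_double[OF that])
    ultimately show ?thesis by blast
  qed
  have n0: "0 < n" and \<rho>\<eta>: "\<rho>0 \<le> \<eta>" using n \<rho>0 \<eta>' by (simp_all add: \<rho>1_def)
  show ?thesis
    by (rule exI, rule conjI, rule n0, rule exI, rule conjI, rule a, rule exI, rule conjI, rule A,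
      rule exI, rule conjI, rule \<kappa>(1), rule exI, rule conjI, rule \<kappa>(2), rule exI, rule conjI, rule \<rho>0(1),
      rule conjI, rule \<rho>0(2), rule conjI, rule \<rho>\<eta>, intro ballI allI impI, rule gauge)
qed

end

section \<open>Lipschitz holomorphic functions on chains of discs\<close>

text \<open>The oscillation of \<open>H\<close> is at most \<open>2 M\<close>; the factor \<open>3\<close> makes the inequality strict, as the Schwarz
  lemma requires.\<close>

lemma Schwarz_bound:
  assumes H: "H holomorphic_on ball 0 R" and R: "R > 0" and M: "\<And>z. norm z < R \<Longrightarrow> norm (H z) \<le> M"
    and \<zeta>: "norm \<zeta> < R"
  shows "norm (H \<zeta> - H 0) \<le> 3 * M * (norm \<zeta> / R)"
proof (cases "M = 0")
  case True
  then show ?thesis using M[OF \<zeta>] M[of 0] R by simp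
next
  case False
  moreover have "norm (H 0) \<le> M" using M[of 0] R by simp
  ultimately have M0: "M > 0" using norm_ge_zero[of "H 0"] by linarith
  define h where "h z = (H (of_real R * z) - H 0) / of_real (3 * M)" for z
  have mem: "norm (of_real R * z) < R" if "norm z < 1" for z :: complex
    using that R by (simp add: norm_mult)
  have "(H \<circ> (\<lambda>z. of_real R * z)) holomorphic_on ball 0 1"
    by (rule holomorphic_on_compose_gen[OF _ H]) (use mem in \<open>auto intro!: holomorphic_intros\<close>)
  then have h: "h holomorphic_on ball 0 1"
    unfolding h_def using M0 by (intro holomorphic_intros) (auto simp: o_def)
  have "norm (h z) < 1" if "norm z < 1" for z
  proof -
    have "norm (H (of_real R * z) - H 0) \<le> M + M"
      by (rule order_trans[OF norm_triangle_ineq4 add_mono]) (use M[OF mem[OF that]] M[of 0] R in auto)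
    then have "norm (H (of_real R * z) - H 0) < 3 * M" using M0 by simp
    then show ?thesis using M0 by (simp add: h_def norm_divide)
  qed
  moreover have "norm (\<zeta> / of_real R) < 1" using \<zeta> R by (simp add: norm_divide)
  ultimately have "norm (h (\<zeta> / of_real R)) \<le> norm (\<zeta> / of_real R)"
    by (intro Schwarz_Lemma(1)[OF h]) (auto simp: h_def)
  then show ?thesis using M0 R by (simp add: h_def norm_divide field_simps)
qed

lemma holomorphic_along_line:
  assumes f: "f \<in> holomorphic_functions \<Omega>" and A: "\<And>\<zeta>. \<zeta> \<in> A \<Longrightarrow> p + \<zeta> *s v \<in> \<Omega>"
  shows "(\<lambda>\<zeta>. f (p + \<zeta> *s v)) holomorphic_on A"
  unfolding holomorphic_on_def
proof
  fix \<zeta> assume "\<zeta> \<in> A"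
  then obtain D where D: "(f has_derivative D) (at (p + \<zeta> *s v))" "\<And>c v. D (c *s v) = c * D v"
    using A f unfolding holomorphic_functions_def by blast
  have lin: "bounded_linear (\<lambda>\<zeta>. \<zeta> *s v)"
    by (rule bounded_linear_intro[where K = "norm v"])
      (auto simp: norm_complex_smult vec_eq_iff algebra_simps)
  have "((\<lambda>\<zeta>. p + \<zeta> *s v) has_derivative (\<lambda>\<zeta>. \<zeta> *s v)) (at \<zeta>)"
    by (auto intro!: derivative_eq_intros bounded_linear.has_derivative[OF lin])
  from has_derivative_compose[OF this D(1)]
  have "((\<lambda>\<zeta>. f (p + \<zeta> *s v)) has_field_derivative D v) (at \<zeta>)"
    unfolding has_field_derivative_def D(2) by (simp add: mult.commute[of _ "D v"])
  then show "(\<lambda>\<zeta>. f (p + \<zeta> *s v)) field_differentiable at \<zeta> within A"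
    using field_differentiable_at_within field_differentiable_def by blast
qed

text \<open>Both suprema in the norm are over nonempty bounded sets of reals: \<open>f\<close> is bounded because \<open>\<Omega>\<close> is,
  and a nonempty open set contains two distinct points.\<close>

lemma Lip_norm_bounds:
  fixes \<Omega> :: "(complex^'n) set"
  assumes \<Omega>: "open \<Omega>" "bounded \<Omega>" "\<Omega> \<noteq> {}" and f: "f \<in> Lip \<alpha> \<Omega>" and \<alpha>: "\<alpha> > 0"
  shows "0 \<le> Lip_norm \<alpha> \<Omega> f"
    and "x \<in> \<Omega> \<Longrightarrow> norm (f x) \<le> Lip_norm \<alpha> \<Omega> f"
    and "x \<in> \<Omega> \<Longrightarrow> y \<in> \<Omega> \<Longrightarrow> norm (f x - f y) \<le> Lip_norm \<alpha> \<Omega> f * norm (x - y) powr \<alpha>"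
proof -
  obtain C where C: "C > 0" "\<And>x y. x \<in> \<Omega> \<Longrightarrow> y \<in> \<Omega> \<Longrightarrow> norm (f x - f y) \<le> C * norm (x - y) powr \<alpha>"
    using f unfolding Lip_def by blast
  define Q where "Q = {norm (f x - f y) / norm (x - y) powr \<alpha> | x y. x \<in> \<Omega> \<and> y \<in> \<Omega> \<and> x \<noteq> y}"
  define M where "M = (SUP x\<in>\<Omega>. norm (f x))"
  have LN: "Lip_norm \<alpha> \<Omega> f = M + Sup Q" by (simp add: Lip_norm_def M_def Q_def)
  have bQ: "bdd_above Q"
  proof (rule bdd_aboveI)
    fix q assume "q \<in> Q"
    then obtain x y where xy: "q = norm (f x - f y) / norm (x - y) powr \<alpha>" "x \<in> \<Omega>" "y \<in> \<Omega>" "x \<noteq> y"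
      unfolding Q_def by blast
    then show "q \<le> C" using C(2)[of x y] by (simp add: divide_le_eq)
  qed
  obtain x0 where x0: "x0 \<in> \<Omega>" using \<Omega>(3) by blast
  have "\<Omega> \<noteq> {x0}" using \<Omega>(1) not_open_singleton[of x0] by auto
  then obtain y0 where y0: "y0 \<in> \<Omega>" "x0 \<noteq> y0" using x0 by blast
  have Q_upper: "norm (f x - f y) / norm (x - y) powr \<alpha> \<le> Sup Q" if "x \<in> \<Omega>" "y \<in> \<Omega>" "x \<noteq> y" for x y
    by (rule cSup_upper[OF _ bQ]) (use that Q_def in blast)
  have Q0: "0 \<le> Sup Q" using Q_upper[OF x0 y0] by (rule order_trans[rotated]) simp
  obtain b where b: "\<And>x. x \<in> \<Omega> \<Longrightarrow> norm x \<le> b" using \<Omega>(2) unfolding bounded_iff by blast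
  have bM: "bdd_above ((\<lambda>x. norm (f x)) ` \<Omega>)"
  proof (rule bdd_aboveI2)
    fix x assume x: "x \<in> \<Omega>"
    have "norm (x - x0) \<le> b + b"
      by (rule order_trans[OF norm_triangle_ineq4 add_mono]) (use b x x0 in auto)
    then have "norm (x - x0) powr \<alpha> \<le> (b + b) powr \<alpha>" using \<alpha> by (intro powr_mono2) auto
    then have "C * norm (x - x0) powr \<alpha> \<le> C * (b + b) powr \<alpha>" using C(1) by simp
    moreover have "norm (f x) \<le> norm (f x0) + norm (f x - f x0)"
      using norm_triangle_ineq[of "f x0" "f x - f x0"] by simp
    ultimately show "norm (f x) \<le> norm (f x0) + C * (b + b) powr \<alpha>" using C(2)[OF x x0] by linarith
  qed
  have M_upper: "norm (f x) \<le> M" if "x \<in> \<Omega>" for x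
    unfolding M_def by (rule cSUP_upper[OF that bM])
  have M0: "0 \<le> M" using M_upper[OF x0] norm_ge_zero order_trans by blast
  show "0 \<le> Lip_norm \<alpha> \<Omega> f" using M0 Q0 by (simp add: LN)
  show "norm (f x) \<le> Lip_norm \<alpha> \<Omega> f" if "x \<in> \<Omega>" using M_upper[OF that] Q0 by (simp add: LN)
  show "norm (f x - f y) \<le> Lip_norm \<alpha> \<Omega> f * norm (x - y) powr \<alpha>" if "x \<in> \<Omega>" "y \<in> \<Omega>"
  proof (cases "x = y")
    case False
    have "norm (f x - f y) \<le> Sup Q * norm (x - y) powr \<alpha>"
      using Q_upper[OF that False] False by (simp add: divide_le_eq)
    also have "\<dots> \<le> Lip_norm \<alpha> \<Omega> f * norm (x - y) powr \<alpha>"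
      using M0 by (intro mult_right_mono) (auto simp: LN)
    finally show ?thesis .
  qed simp
qed

lemma dyadic_scale:
  fixes t T :: real
  assumes "0 < t" "2 * t \<le> T"
  obtains n where "2 ^ (n + 1) * t \<le> T" "T < 2 ^ (n + 2) * t"
proof -
  obtain k where "T / t < 2 ^ k" using real_arch_pow[of 2 "T / t"] by auto
  also have "(2::real) ^ k \<le> 2 ^ (k + 2)" by (intro power_increasing) auto
  finally have ex: "T < 2 ^ (k + 2) * t" using assms(1) by (simp add: divide_less_eq)
  define n where "n = (LEAST n. T < 2 ^ (n + 2) * t)"
  have 1: "T < 2 ^ (n + 2) * t" unfolding n_def by (rule LeastI[where P = "\<lambda>n. T < 2 ^ (n + 2) * t", OF ex])
  have "2 ^ (n + 1) * t \<le> T"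
  proof (cases n)
    case 0
    then show ?thesis using assms(2) by simp
  next
    case (Suc j)
    then have "\<not> T < 2 ^ (j + 2) * t"
      using not_less_Least[of j "\<lambda>n. T < 2 ^ (n + 2) * t"] by (simp add: n_def)
    then show ?thesis using Suc by simp
  qed
  then show thesis using 1 that by blast
qed

text \<open>Let \<open>F k\<close> be \<open>f\<close> on the disc of radius \<open>2^(k+1) t\<close> at depth \<open>h k = max \<delta> (K N(2^(k+1) t))\<close>. Taking
  the maximum with \<open>\<delta>\<close> treats two situations at once: as long as the disc at depth \<open>\<delta>\<close> has room, the
  depth does not change and consecutive \<open>F k\<close> agree; afterwards the depth follows the gauge.
  The oscillation of \<open>F k - F (k+1)\<close> between \<open>0\<close> and \<open>\<zeta>\<close> is at most a constant times
  \<open>(K N(2^(k+2) t))^\<alpha> / 2^(k+1)\<close>, which is summable since \<open>2^(m \<alpha>) \<le> 3/2\<close>.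
  The last \<open>F n\<close> lives on a disc of radius comparable to \<open>T\<close>, so its oscillation is \<open>O(t)\<close>, and
  \<open>a t \<le> N t^\<alpha>\<close>.\<close>

lemma tangential_chain_estimate:
  fixes \<Omega> :: "(complex^'n) set" and f :: "complex^'n \<Rightarrow> complex" and N :: "real \<Rightarrow> real" and m :: nat
  assumes f: "f \<in> holomorphic_functions \<Omega>"
    and L: "L \<ge> 0" "\<And>x. x \<in> \<Omega> \<Longrightarrow> norm (f x) \<le> L"
      "\<And>x y. x \<in> \<Omega> \<Longrightarrow> y \<in> \<Omega> \<Longrightarrow> norm (f x - f y) \<le> L * norm (x - y) powr \<alpha>"
    and \<alpha>: "0 < \<alpha>" "real m * \<alpha> \<le> 1 / 2" "m > 0"
    and \<nu>: "norm \<nu> = 1" and K: "K \<ge> 1" and a: "0 < a" "a \<le> 1" and T: "0 < T" "T \<le> 1"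
    and N_lower: "\<And>\<rho>. 0 < \<rho> \<Longrightarrow> \<rho> \<le> T \<Longrightarrow> a * \<rho> ^ m \<le> N \<rho>"
    and N_mono: "\<And>\<rho> \<rho>'. 0 \<le> \<rho> \<Longrightarrow> \<rho> \<le> \<rho>' \<Longrightarrow> N \<rho> \<le> N \<rho>'"
    and N_double: "\<And>\<rho>. 0 \<le> \<rho> \<Longrightarrow> N (2 * \<rho>) \<le> 2 ^ m * N \<rho>"
    and inside: "\<And>\<rho> h \<xi>. 0 < \<rho> \<Longrightarrow> \<rho> \<le> T \<Longrightarrow> K * N \<rho> \<le> h \<Longrightarrow> h \<le> H \<Longrightarrow> norm \<xi> \<le> \<rho> \<Longrightarrow>
      P - h *\<^sub>R \<nu> + \<xi> *s v \<in> \<Omega>"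
    and H: "K * N T \<le> H" "0 \<le> \<delta>" "\<delta> \<le> H"
    and t: "norm \<zeta> = t" "0 < t" "2 * t \<le> T"
    and pts: "P - \<delta> *\<^sub>R \<nu> \<in> \<Omega>" "P - \<delta> *\<^sub>R \<nu> + \<zeta> *s v \<in> \<Omega>"
  shows "norm (f (P - \<delta> *\<^sub>R \<nu>) - f (P - \<delta> *\<^sub>R \<nu> + \<zeta> *s v)) \<le> (17 * K + 6 / (a * T)) * L * N t powr \<alpha>"
proof -
  obtain n where n: "2 ^ (n + 1) * t \<le> T" "T < 2 ^ (n + 2) * t"
    using dyadic_scale[OF t(2,3)] .
  have tT: "t \<le> T" "t \<le> 1" using t T by auto
  have Npos: "N \<rho> > 0" if "0 < \<rho>" "\<rho> \<le> T" for \<rho>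
    using N_lower[OF that] that a by (meson less_le_trans mult_pos_pos zero_less_power)
  have Nt: "N t > 0" using Npos[OF t(2) tT(1)] .
  have scale: "2 ^ (k + 1) * t \<le> T" if "k \<le> n" for k
  proof -
    have "(2::real) ^ (k + 1) * t \<le> 2 ^ (n + 1) * t"
      using that t(2) by (intro mult_right_mono power_increasing) auto
    then show ?thesis using n(1) by linarith
  qed
  have \<alpha>1: "\<alpha> \<le> 1"
  proof -
    have "1 * \<alpha> \<le> real m * \<alpha>" using \<alpha> by (intro mult_right_mono) auto
    then show ?thesis using \<alpha>(2) by linarith
  qed
  have two: "(2 ^ m) powr \<alpha> \<le> (3/2 :: real)"
  proof -
    have "(2 ^ m :: real) powr \<alpha> = 2 powr (real m * \<alpha>)"
      by (simp add: powr_powr flip: powr_realpow)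
    also have "\<dots> \<le> 2 powr (1/2)" using \<alpha>(2) by (intro powr_mono) auto
    also have "\<dots> = sqrt 2" by (simp add: powr_half_sqrt)
    also have "\<dots> \<le> 3/2" by (rule real_le_lsqrt) (auto simp: power2_eq_square)
    finally show ?thesis .
  qed
  have N_pow: "N (2 ^ j * t) \<le> (2 ^ m) ^ j * N t" for j
  proof (induction j)
    case (Suc j)
    have "N (2 ^ Suc j * t) \<le> 2 ^ m * N (2 ^ j * t)"
      using N_double[of "2 ^ j * t"] t(2) by (simp add: mult.assoc)
    also have "\<dots> \<le> 2 ^ m * ((2 ^ m) ^ j * N t)" using Suc by (intro mult_left_mono) auto
    finally show ?case by (simp add: mult.assoc)
  qed simp
  have KN_powr: "(K * N (2 ^ j * t)) powr \<alpha> \<le> K * (3/2) ^ j * N t powr \<alpha>" if "2 ^ j * t \<le> T" for j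
  proof -
    have p: "0 < N (2 ^ j * t)" using Npos[OF _ that] t(2) by simp
    have "(K * N (2 ^ j * t)) powr \<alpha> \<le> (K * ((2 ^ m) ^ j * N t)) powr \<alpha>"
      using K N_pow[of j] p \<alpha> by (intro powr_mono2 mult_left_mono) auto
    also have "\<dots> = K powr \<alpha> * ((2 ^ m) powr \<alpha>) ^ j * N t powr \<alpha>"
      using K Nt by (simp add: powr_mult powr_power powr_powr mult.commute mult.left_commute flip: powr_realpow)
    also have "\<dots> \<le> K powr 1 * (3/2) ^ j * N t powr \<alpha>"
    proof (intro mult_right_mono mult_mono)
      show "K powr \<alpha> \<le> K powr 1" using K \<alpha>1 by (intro powr_mono) auto
      show "((2 ^ m) powr \<alpha>) ^ j \<le> (3/2) ^ j" using two by (intro power_mono) auto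
    qed auto
    finally show ?thesis using K by simp
  qed
  define h where "h k = max \<delta> (K * N (2 ^ (k + 1) * t))" for k
  define F where "F k \<xi> = f (P - h k *\<^sub>R \<nu> + \<xi> *s v)" for k \<xi>
  have F_in: "P - h k *\<^sub>R \<nu> + \<xi> *s v \<in> \<Omega>" if "k \<le> n" "norm \<xi> \<le> 2 ^ (k + 1) * t" for k \<xi>
  proof (rule inside[OF _ scale[OF that(1)]])
    have "N (2 ^ (k + 1) * t) \<le> N T" using scale[OF that(1)] t(2) by (intro N_mono) auto
    then have "K * N (2 ^ (k + 1) * t) \<le> K * N T" using K by (intro mult_left_mono) auto
    then show "h k \<le> H" using H by (auto simp: h_def)
  qed (use that t(2) in \<open>auto simp: h_def\<close>)
  have move: "norm (f (P - s *\<^sub>R \<nu> + \<xi> *s v) - f (P - s' *\<^sub>R \<nu> + \<xi> *s v)) \<le> L * b powr \<alpha>"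
    if "P - s *\<^sub>R \<nu> + \<xi> *s v \<in> \<Omega>" "P - s' *\<^sub>R \<nu> + \<xi> *s v \<in> \<Omega>" "\<bar>s - s'\<bar> \<le> b" for s s' \<xi> b
  proof -
    have "P - s *\<^sub>R \<nu> + \<xi> *s v - (P - s' *\<^sub>R \<nu> + \<xi> *s v) = (s' - s) *\<^sub>R \<nu>"
      by (simp add: algebra_simps)
    then have "norm (P - s *\<^sub>R \<nu> + \<xi> *s v - (P - s' *\<^sub>R \<nu> + \<xi> *s v)) \<le> b"
      using that(3) \<nu> by (simp add: abs_minus_commute)
    then have "norm (P - s *\<^sub>R \<nu> + \<xi> *s v - (P - s' *\<^sub>R \<nu> + \<xi> *s v)) powr \<alpha> \<le> b powr \<alpha>"
      using \<alpha>(1) by (intro powr_mono2) auto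
    then show ?thesis using L(3)[OF that(1,2)] L(1) mult_left_mono order_trans by blast
  qed
  have step: "norm ((F k \<zeta> - F k 0) - (F (Suc k) \<zeta> - F (Suc k) 0)) \<le> 27/8 * K * L * N t powr \<alpha> * (3/4) ^ k"
    if k: "k < n" for k
  proof -
    define R where "R = 2 ^ (k + 1) * t"
    define M where "M = L * (K * N (2 ^ (k + 2) * t)) powr \<alpha>"
    have R: "R > 0" "t < R" "t / R = 1 / 2 ^ (k + 1)"
      using t(2) by (simp_all add: R_def mult_less_cancel_right1 add_pos_pos one_less_power[of 2 "Suc k", simplified])
    have in1: "P - h k *\<^sub>R \<nu> + \<xi> *s v \<in> \<Omega>" and in2: "P - h (Suc k) *\<^sub>R \<nu> + \<xi> *s v \<in> \<Omega>" if "norm \<xi> < R" for \<xi>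
    proof -
      show "P - h k *\<^sub>R \<nu> + \<xi> *s v \<in> \<Omega>" using F_in[of k \<xi>] that k by (simp add: R_def)
      have "R \<le> 2 ^ (Suc k + 1) * t" using t(2) by (simp add: R_def)
      then show "P - h (Suc k) *\<^sub>R \<nu> + \<xi> *s v \<in> \<Omega>" using F_in[of "Suc k" \<xi>] that k by simp
    qed
    have hdiff: "\<bar>h k - h (Suc k)\<bar> \<le> K * N (2 ^ (k + 2) * t)"
    proof -
      have "N (2 ^ (k + 1) * t) \<le> N (2 ^ (k + 2) * t)" using t(2) by (intro N_mono) auto
      then have "K * N (2 ^ (k + 1) * t) \<le> K * N (2 ^ (k + 2) * t)" using K by (intro mult_left_mono) auto
      moreover have "0 \<le> K * N (2 ^ (k + 1) * t)"
        using Npos[OF _ scale[of k]] k t(2) K by (simp add: less_imp_le)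
      ultimately show ?thesis by (simp add: h_def max_def)
    qed
    have hol: "(\<lambda>\<xi>. F k \<xi> - F (Suc k) \<xi>) holomorphic_on ball 0 R"
      unfolding F_def by (intro holomorphic_intros holomorphic_along_line[OF f]) (use in1 in2 in auto)
    have "norm ((F k \<zeta> - F (Suc k) \<zeta>) - (F k 0 - F (Suc k) 0)) \<le> 3 * M * (norm \<zeta> / R)"
    proof (rule Schwarz_bound[OF hol R(1)])
      show "norm (F k \<xi> - F (Suc k) \<xi>) \<le> M" if "norm \<xi> < R" for \<xi>
        unfolding F_def M_def by (rule move[OF in1[OF that] in2[OF that] hdiff])
    qed (use t R in auto)
    also have "\<dots> = 3 * M / 2 ^ (k + 1)" using R(3) t(1) by simp
    also have "\<dots> \<le> 3 * (L * (K * (3/2) ^ (k + 2) * N t powr \<alpha>)) / 2 ^ (k + 1)"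
      unfolding M_def using KN_powr[of "k + 2"] scale[of "Suc k"] k L(1)
      by (intro divide_right_mono mult_left_mono) auto
    also have "\<dots> = 27/8 * K * L * N t powr \<alpha> * (3/4) ^ k"
    proof -
      have "(3/2 :: real) ^ (k + 2) / 2 ^ (k + 1) = 9/8 * (3/4) ^ k"
        by (simp add: power_add power_divide flip: power_mult_distrib)
      then show ?thesis by (simp add: field_simps)
    qed
    finally show ?thesis by (simp add: algebra_simps)
  qed
  have last: "norm (F n \<zeta> - F n 0) \<le> 6 / (a * T) * L * N t powr \<alpha>"
  proof -
    define R where "R = 2 ^ (n + 1) * t"
    have R: "R > 0" "t < R" "T < 2 * R"
      using t(2) n(2) by (simp_all add: R_def mult_less_cancel_right1 add_pos_pos one_less_power[of 2 "Suc n", simplified])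
    have in1: "P - h n *\<^sub>R \<nu> + \<xi> *s v \<in> \<Omega>" if "norm \<xi> < R" for \<xi>
      using F_in[of n \<xi>] that by (simp add: R_def)
    have "norm (F n \<zeta> - F n 0) \<le> 3 * L * (norm \<zeta> / R)"
    proof (rule Schwarz_bound[OF _ R(1)])
      show "F n holomorphic_on ball 0 R"
        unfolding F_def by (intro holomorphic_along_line[OF f]) (use in1 in auto)
      show "norm (F n \<xi>) \<le> L" if "norm \<xi> < R" for \<xi>
        unfolding F_def by (rule L(2)[OF in1[OF that]])
    qed (use t R in auto)
    also have "\<dots> \<le> 3 * L * (2 * t / T)"
      using t R T L(1) by (intro mult_left_mono) (auto simp: divide_le_eq le_divide_eq field_simps)
    finally have 1: "norm (F n \<zeta> - F n 0) \<le> 6 * L * t / T" by simp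
    have "a * t \<le> N t powr \<alpha>"
    proof -
      have "a powr 1 * t powr 1 \<le> a powr \<alpha> * t powr (real m * \<alpha>)"
        using a t(2) tT \<alpha>1 \<alpha> by (intro mult_mono powr_mono') auto
      also have "\<dots> = (a * t ^ m) powr \<alpha>"
        using a t(2) by (simp add: powr_mult powr_powr flip: powr_realpow)
      also have "\<dots> \<le> N t powr \<alpha>"
        using N_lower[OF t(2) tT(1)] a t(2) \<alpha> by (intro powr_mono2) auto
      finally show ?thesis using a t(2) by simp
    qed
    then have "6 * L * (a * t) / (a * T) \<le> 6 * L * N t powr \<alpha> / (a * T)"
      using L(1) a T by (intro divide_right_mono mult_left_mono) auto
    then show ?thesis using 1 a by simp
  qed
  have "norm (F 0 \<zeta> - F 0 0) \<le> 27/2 * K * L * N t powr \<alpha> + 6 / (a * T) * L * N t powr \<alpha>"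
  proof -
    let ?D = "\<lambda>k. F k \<zeta> - F k 0"
    have "?D 0 = (\<Sum>k<n. ?D k - ?D (Suc k)) + ?D n"
      unfolding sum_lessThan_telescope'[of ?D n] by simp
    then have "norm (?D 0) \<le> norm (\<Sum>k<n. ?D k - ?D (Suc k)) + norm (?D n)"
      by (metis norm_triangle_ineq)
    also have "norm (\<Sum>k<n. ?D k - ?D (Suc k)) \<le> (\<Sum>k<n. 27/8 * K * L * N t powr \<alpha> * (3/4) ^ k)"
      by (rule order_trans[OF norm_sum sum_mono]) (use step in auto)
    also have "\<dots> = 27/8 * K * L * N t powr \<alpha> * (\<Sum>k<n. (3/4) ^ k)"
      by (simp add: sum_distrib_left)
    also have "\<dots> \<le> 27/8 * K * L * N t powr \<alpha> * 4"
    proof (intro mult_left_mono)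
      have "(\<Sum>k<n. (3/4 :: real) ^ k) = 4 * (1 - (3/4) ^ n)"
        by (simp add: sum_gp_strict)
      then show "(\<Sum>k<n. (3/4 :: real) ^ k) \<le> 4" by simp
    qed (use K L(1) in auto)
    finally show ?thesis using last by (simp add: algebra_simps)
  qed
  moreover have shift: "norm (f (P - \<delta> *\<^sub>R \<nu> + \<xi> *s v) - F 0 \<xi>) \<le> 3/2 * K * L * N t powr \<alpha>"
    if "P - \<delta> *\<^sub>R \<nu> + \<xi> *s v \<in> \<Omega>" "norm \<xi> \<le> t" for \<xi>
  proof -
    have in0: "P - h 0 *\<^sub>R \<nu> + \<xi> *s v \<in> \<Omega>"
      by (rule F_in) (use that(2) t(2) in auto)
    have "0 < N (2 ^ 1 * t)" using Npos[of "2 ^ 1 * t"] t by simp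
    then have "0 \<le> K * N (2 ^ 1 * t)" using K by simp
    then have "\<bar>\<delta> - h 0\<bar> \<le> K * N (2 ^ 1 * t)"
      using H(2) by (simp add: h_def max_def)
    then have "norm (f (P - \<delta> *\<^sub>R \<nu> + \<xi> *s v) - F 0 \<xi>) \<le> L * (K * N (2 ^ 1 * t)) powr \<alpha>"
      unfolding F_def by (rule move[OF that(1) in0])
    also have "\<dots> \<le> L * (K * (3/2) ^ 1 * N t powr \<alpha>)"
      by (rule mult_left_mono[OF KN_powr L(1)]) (use t(3) in simp)
    finally show ?thesis by (simp add: mult_ac)
  qed
  have "norm (f (P - \<delta> *\<^sub>R \<nu>) - F 0 0) \<le> 3/2 * K * L * N t powr \<alpha>"
    using shift[of 0] pts(1) t(2) by simp
  moreover have "norm (F 0 \<zeta> - f (P - \<delta> *\<^sub>R \<nu> + \<zeta> *s v)) \<le> 3/2 * K * L * N t powr \<alpha>"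
    using shift[OF pts(2)] t(1) by (simp add: norm_minus_commute)
  moreover have "norm (f (P - \<delta> *\<^sub>R \<nu>) - f (P - \<delta> *\<^sub>R \<nu> + \<zeta> *s v))
      \<le> norm (f (P - \<delta> *\<^sub>R \<nu>) - F 0 0) + norm (F 0 \<zeta> - F 0 0) + norm (F 0 \<zeta> - f (P - \<delta> *\<^sub>R \<nu> + \<zeta> *s v))"
    by norm
  moreover have "3/2 * K * L * N t powr \<alpha> + (27/2 * K * L * N t powr \<alpha> + 6 / (a * T) * L * N t powr \<alpha>)
      + 3/2 * K * L * N t powr \<alpha> \<le> (17 * K + 6 / (a * T)) * L * N t powr \<alpha>"
  proof -
    have "0 \<le> K * L * N t powr \<alpha>" using K L(1) by simp
    then show ?thesis by (simp add: algebra_simps)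
  qed
  ultimately show ?thesis by linarith
qed

section \<open>The tangential estimate\<close>

context collar
begin

text \<open>Moving inwards by \<open>h\<close> lowers \<open>r\<close> by at least \<open>c h\<close>.\<close>

lemma inner_point_in:
  assumes P: "P \<in> frontier \<Omega>" and \<xi>: "norm \<xi> \<le> \<eta> / 2" "norm v = 1" and h: "0 \<le> h" "h \<le> \<eta> / 2"
    and neg: "r (P + \<xi> *s v) < c * h"
  shows "P - h *\<^sub>R outward_normal r P + \<xi> *s v \<in> \<Omega>"
proof -
  let ?\<nu> = "outward_normal r P"
  define y where "y = P - h *\<^sub>R ?\<nu> + \<xi> *s v"
  have y: "y + h *\<^sub>R ?\<nu> = P + \<xi> *s v" by (simp add: y_def)
  have "norm (y - P) \<le> norm (\<xi> *s v) + norm (h *\<^sub>R ?\<nu>)"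
    using norm_triangle_ineq4[of "\<xi> *s v" "h *\<^sub>R ?\<nu>"] by (simp add: y_def algebra_simps)
  also have "\<dots> \<le> \<eta>"
    using \<xi> h norm_normal[OF P] by (simp add: norm_complex_smult)
  finally have yb: "y \<in> cball P \<eta>" by (simp add: dist_norm norm_minus_commute)
  have "P + \<xi> *s v \<in> cball P \<eta>"
    using \<xi> \<eta>_pos by (simp add: dist_norm norm_complex_smult)
  then have "r y + c * h \<le> r (P + \<xi> *s v)"
    using increase_along_normal[OF P yb _ h(1)] unfolding y by blast
  then have "r y < 0" using neg by simp
  then have "y \<in> \<Omega>" using Omega_eq cball_subset[OF P] yb by blast
  then show ?thesis by (simp add: y_def)
qed

text \<open>If \<open>r\<close> exceeds \<open>B 1 \<cdot> \<delta>\<close> at some \<open>P + \<zeta> v\<close>, then it is still positive after the shift by \<open>\<delta>\<close> along the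
  normal. So the shifted point is outside \<open>\<Omega>\<close>, and every disc about the inner point that is
  contained in \<open>\<Omega>\<close> has radius less than \<open>\<bar>\<zeta>\<bar>\<close>. So the supremum in the definition of the radius is
  over a bounded set, and \<open>w\<close> lies in one of the discs with radius from this set, hence in \<open>\<Omega>\<close>.\<close>

lemma tangent_disc_small:
  assumes P: "P \<in> frontier \<Omega>" and v: "norm v = 1" and \<delta>: "0 < \<delta>" "\<delta> \<le> \<eta> / 2"
    and \<rho>: "norm \<zeta> \<le> \<rho>" "\<rho> \<le> \<eta> / 2" and pos: "B 1 * \<delta> < r (P + \<zeta> *s v)"
    and \<Omega>: "open \<Omega>" and w: "w \<in> tangent_disc \<Omega> U r P v \<delta>"
  obtains \<xi> where "w = inner_point r P \<delta> + \<xi> *s v" "norm \<xi> < \<rho>" "inner_point r P \<delta> \<in> \<Omega>" "w \<in> \<Omega>"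
proof -
  let ?\<nu> = "outward_normal r P"
  let ?p = "inner_point r P \<delta>"
  have p: "?p = P - \<delta> *\<^sub>R ?\<nu>" by (simp add: inner_point_def)
  define S where "S = {\<rho>. \<rho> > 0 \<and> (\<forall>\<zeta>::complex. norm \<zeta> \<le> \<rho> \<longrightarrow> ?p + \<zeta> *s v \<in> \<Omega> \<inter> U)}"
  have "?p \<in> \<Omega>"
    using inner_point_in[OF P, of 0 v \<delta>] v \<delta> \<eta>_pos c_pos r_frontier[OF P] by (simp add: p)
  have "norm (?p - P) \<le> \<eta>" using \<delta> norm_normal[OF P] by (simp add: p)
  then have "?p \<in> cball P \<eta>" by (simp add: dist_norm norm_minus_commute)
  then have pU: "?p \<in> \<Omega> \<inter> U" using \<open>?p \<in> \<Omega>\<close> cball_subset[OF P] by blast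
  have open_OU: "open (\<Omega> \<inter> U)" using \<Omega> open_U by (rule open_Int)
  obtain e where e: "e > 0" "ball ?p e \<subseteq> \<Omega> \<inter> U" using openE[OF open_OU pU] .
  have "e / 2 \<in> S"
    unfolding S_def
  proof (intro CollectI conjI allI impI)
    fix z :: complex assume "norm z \<le> e / 2"
    then have "?p + z *s v \<in> ball ?p e"
      using e(1) by (simp add: dist_norm norm_complex_smult v)
    then show "?p + z *s v \<in> \<Omega> \<inter> U" using e(2) by blast
  qed (use e(1) in simp)
  then have ne: "S \<noteq> {}" by blast
  have outside: "?p + \<zeta> *s v \<notin> \<Omega> \<inter> U"
  proof
    assume "?p + \<zeta> *s v \<in> \<Omega> \<inter> U"
    then have neg: "r (?p + \<zeta> *s v) < 0" using Omega_eq by blast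
    have "norm (?p + \<zeta> *s v - P) \<le> norm (\<zeta> *s v) + norm (\<delta> *\<^sub>R ?\<nu>)"
      using norm_triangle_ineq4[of "\<zeta> *s v" "\<delta> *\<^sub>R ?\<nu>"] by (simp add: p algebra_simps)
    also have "\<dots> \<le> \<eta>" using \<rho> \<delta> v norm_normal[OF P] by (simp add: norm_complex_smult)
    finally have 1: "?p + \<zeta> *s v \<in> cball P \<eta>" by (simp add: dist_norm norm_minus_commute)
    have 2: "P + \<zeta> *s v \<in> cball P \<eta>"
      using \<rho> \<eta>_pos v by (simp add: dist_norm norm_complex_smult)
    have "\<bar>r (P + \<zeta> *s v) - r (?p + \<zeta> *s v)\<bar> \<le> B 1 * norm (P + \<zeta> *s v - (?p + \<zeta> *s v))"
      using lipschitz[OF P 2 1, of "[]"] by simp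
    also have "P + \<zeta> *s v - (?p + \<zeta> *s v) = \<delta> *\<^sub>R ?\<nu>" by (simp add: p)
    finally show False using neg pos \<delta>(1) norm_normal[OF P] by simp
  qed
  have S_lt: "\<sigma> < \<rho>" if "\<sigma> \<in> S" for \<sigma>
  proof (rule ccontr)
    assume "\<not> \<sigma> < \<rho>"
    then have "norm \<zeta> \<le> \<sigma>" using \<rho>(1) by simp
    then show False using that outside by (simp add: S_def)
  qed
  obtain \<xi> where \<xi>: "w = ?p + \<xi> *s v" "norm \<xi> < Sup S"
    using w unfolding tangent_disc_def disc_radius_def S_def by blast
  obtain \<sigma> where \<sigma>: "\<sigma> \<in> S" "norm \<xi> < \<sigma>" using less_cSupD[OF ne \<xi>(2)] by blast
  have "w \<in> \<Omega>" using \<sigma> unfolding S_def \<xi>(1) by auto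
  moreover have "norm \<xi> < \<rho>" using \<sigma> S_lt by force
  ultimately show thesis using that \<xi>(1) \<open>?p \<in> \<Omega>\<close> by blast
qed

end

theorem corollary1p3:
  fixes \<Omega> U :: "(complex^'n) set" and r :: "complex^'n \<Rightarrow> real"
  assumes "CARD('n) > 1"
    and "smoothly_bounded_domain \<Omega>"
    and "frontier \<Omega> \<subseteq> U"
    and "defining_function \<Omega> U r"
    and "pseudoconvex \<Omega> r"
    and "finite_type \<Omega> r"
  shows "\<exists>\<alpha>\<^sub>0>0. \<exists>C>0. \<exists>\<delta>\<^sub>0>0.
    \<forall>\<alpha>. 0 < \<alpha> \<and> \<alpha> < \<alpha>\<^sub>0 \<longrightarrow>
      (\<forall>f \<in> holomorphic_functions \<Omega> \<inter> Lip \<alpha> \<Omega>.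
       \<forall>P \<in> frontier \<Omega>. \<forall>v \<in> unit_complex_tangents r P.
       \<forall>\<delta>. 0 < \<delta> \<and> \<delta> < \<delta>\<^sub>0 \<longrightarrow>
         (\<forall>w \<in> tangent_disc \<Omega> U r P v \<delta>.
            norm (f (inner_point r P \<delta>) - f w)
              \<le> C * Lip_norm \<alpha> \<Omega> f * max_r r P v (norm (inner_point r P \<delta> - w)) powr \<alpha>))"
proof -
  have \<Omega>: "open \<Omega>" "bounded \<Omega>" "\<Omega> \<noteq> {}"
    using assms(2) by (simp_all add: smoothly_bounded_domain_def)
  obtain \<eta> c B where "collar \<Omega> U r \<eta> c B"
    using collar_exists[OF \<Omega>(2) assms(3,4)] .
  then interpret collar \<Omega> U r \<eta> c B .
  obtain m :: nat and a A \<kappa> K \<rho>0 where m: "m > 0" and a: "a > 0" and A: "A > 0" and \<kappa>: "\<kappa> > 0" and K: "K > 0"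
    and \<rho>0: "\<rho>0 > 0" "\<rho>0 \<le> 1" "\<rho>0 \<le> \<eta>"
    and gauge: "\<forall>P\<in>frontier \<Omega>. \<forall>v. norm v = 1 \<longrightarrow> (\<exists>N :: real \<Rightarrow> real.
      (\<forall>\<rho>. 0 < \<rho> \<and> \<rho> \<le> \<rho>0 \<longrightarrow> a * \<rho> ^ m \<le> N \<rho> \<and> N \<rho> \<le> A * \<rho> \<and>
         (\<exists>\<zeta>. norm \<zeta> \<le> \<rho> \<and> \<kappa> * N \<rho> \<le> r (P + \<zeta> *s v)) \<and>
         (\<forall>\<zeta>. norm \<zeta> \<le> \<rho> \<longrightarrow> r (P + \<zeta> *s v) \<le> K * N \<rho>)) \<and>
      (\<forall>\<rho> \<rho>'. 0 \<le> \<rho> \<and> \<rho> \<le> \<rho>' \<longrightarrow> N \<rho> \<le> N \<rho>') \<and>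
      (\<forall>\<rho>\<ge>0. N (2 * \<rho>) \<le> 2 ^ m * N \<rho>))"
    using tangential_gauge[OF compact_frontier_bounded[OF \<Omega>(2)] assms(5,6)]
    by (elim exE conjE) (rule that)
  \<comment> \<open>at depth \<open>K' N \<rho>\<close> the disc of radius \<open>\<rho>\<close> is inside \<open>\<Omega>\<close>, as \<open>r \<le> K N \<rho>\<close> on it before the shift\<close>
  define K' where "K' = max 1 (2 * K / c)"
  \<comment> \<open>the largest scale of the chain: the discs of radius \<open>T\<close> at depth \<open>K' N T\<close> stay in the collar\<close>
  define T where "T = min \<rho>0 (min (\<eta> / 2) (\<eta> / (2 * K' * A)))"
  define a' where "a' = min a 1"
  define \<kappa>' where "\<kappa>' = min \<kappa> 1"
  \<comment> \<open>depths below \<open>\<delta>0\<close> force the discs to have radius less than \<open>T / 2\<close>\<close>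
  define \<delta>0 where "\<delta>0 = min (\<eta> / 2) (\<kappa> * (a * (T / 2) ^ m) / B 1)"
  define \<alpha>0 where "\<alpha>0 = 1 / (2 * real m)"
  define C where "C = (17 * K' + 6 / (a' * T)) / \<kappa>'"
  have K': "K' \<ge> 1" "2 * K \<le> K' * c"
  proof -
    show "K' \<ge> 1" by (simp add: K'_def)
    have "2 * K / c \<le> K'" by (simp add: K'_def)
    then show "2 * K \<le> K' * c" using c_pos by (simp add: divide_le_eq)
  qed
  have T: "T > 0" "T \<le> 1" "T \<le> \<rho>0" "T \<le> \<eta> / 2" "K' * (A * T) \<le> \<eta> / 2"
  proof -
    show "T > 0" using \<rho>0 \<eta>_pos A K' by (simp add: T_def)
    show "T \<le> 1" "T \<le> \<rho>0" "T \<le> \<eta> / 2" using \<rho>0 by (auto simp: T_def)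
    have "T \<le> \<eta> / (2 * K' * A)" by (simp add: T_def)
    then show "K' * (A * T) \<le> \<eta> / 2" using A K' by (simp add: field_simps)
  qed
  have a': "0 < a'" "a' \<le> 1" "a' \<le> a" using a by (auto simp: a'_def)
  have \<kappa>': "0 < \<kappa>'" "\<kappa>' \<le> 1" "\<kappa>' \<le> \<kappa>" using \<kappa> by (auto simp: \<kappa>'_def)
  have C: "C > 0" using K' a' T \<kappa>' by (simp add: C_def add_pos_pos)
  have \<alpha>0: "\<alpha>0 > 0" using m by (simp add: \<alpha>0_def)
  have \<delta>0: "\<delta>0 > 0" using \<eta>_pos \<kappa> a T B_pos[of 1] by (simp add: \<delta>0_def)
  have main: "norm (f (inner_point r P \<delta>) - f w)
      \<le> C * Lip_norm \<alpha> \<Omega> f * max_r r P v (norm (inner_point r P \<delta> - w)) powr \<alpha>"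
    if \<alpha>: "0 < \<alpha>" "\<alpha> < \<alpha>0" and f: "f \<in> holomorphic_functions \<Omega> \<inter> Lip \<alpha> \<Omega>" and P: "P \<in> frontier \<Omega>"
      and v: "v \<in> unit_complex_tangents r P" and \<delta>: "0 < \<delta>" "\<delta> < \<delta>0" and w: "w \<in> tangent_disc \<Omega> U r P v \<delta>"
    for \<alpha> f P v \<delta> w
  proof -
    let ?\<nu> = "outward_normal r P"
    let ?L = "Lip_norm \<alpha> \<Omega> f"
    have v1: "norm v = 1" using v by (simp add: unit_complex_tangents_def)
    have L: "0 \<le> ?L" "\<And>x. x \<in> \<Omega> \<Longrightarrow> norm (f x) \<le> ?L"
      "\<And>x y. x \<in> \<Omega> \<Longrightarrow> y \<in> \<Omega> \<Longrightarrow> norm (f x - f y) \<le> ?L * norm (x - y) powr \<alpha>"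
      using Lip_norm_bounds[OF \<Omega> _ \<alpha>(1), of f] f by blast+
    obtain N :: "real \<Rightarrow> real" where N: "\<forall>\<rho>. 0 < \<rho> \<and> \<rho> \<le> \<rho>0 \<longrightarrow> a * \<rho> ^ m \<le> N \<rho> \<and> N \<rho> \<le> A * \<rho> \<and>
         (\<exists>\<zeta>. norm \<zeta> \<le> \<rho> \<and> \<kappa> * N \<rho> \<le> r (P + \<zeta> *s v)) \<and>
         (\<forall>\<zeta>. norm \<zeta> \<le> \<rho> \<longrightarrow> r (P + \<zeta> *s v) \<le> K * N \<rho>)"
      and N_mono: "\<forall>\<rho> \<rho>'. 0 \<le> \<rho> \<and> \<rho> \<le> \<rho>' \<longrightarrow> N \<rho> \<le> N \<rho>'"
      and N_double: "\<forall>\<rho>\<ge>0. N (2 * \<rho>) \<le> 2 ^ m * N \<rho>"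
      using gauge P v1 by blast
    have N_lower: "a * \<rho> ^ m \<le> N \<rho>" and N_upper: "N \<rho> \<le> A * \<rho>"
      and N_max: "\<exists>\<zeta>. norm \<zeta> \<le> \<rho> \<and> \<kappa> * N \<rho> \<le> r (P + \<zeta> *s v)"
      and N_bound: "\<And>\<zeta>. norm \<zeta> \<le> \<rho> \<Longrightarrow> r (P + \<zeta> *s v) \<le> K * N \<rho>"
      if "0 < \<rho>" "\<rho> \<le> T" for \<rho>
      using N that T(3) by (meson order_trans)+
    have \<delta>': "\<delta> \<le> \<eta> / 2" "B 1 * \<delta> < \<kappa> * (a * (T / 2) ^ m)"
      using \<delta>(2) B_pos[of 1] by (simp_all add: \<delta>0_def field_simps)
    have T2: "0 < T / 2" "T / 2 \<le> T" using T by auto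
    obtain \<zeta> where \<zeta>: "norm \<zeta> \<le> T / 2" "\<kappa> * N (T / 2) \<le> r (P + \<zeta> *s v)"
      using N_max[OF T2] by blast
    have "\<kappa> * (a * (T / 2) ^ m) \<le> \<kappa> * N (T / 2)"
      using N_lower[OF T2] \<kappa> by (intro mult_left_mono) auto
    then have "B 1 * \<delta> < r (P + \<zeta> *s v)" using \<delta>'(2) \<zeta>(2) by linarith
    then obtain \<xi> where \<xi>: "w = inner_point r P \<delta> + \<xi> *s v" "norm \<xi> < T / 2" "inner_point r P \<delta> \<in> \<Omega>" "w \<in> \<Omega>"
      using tangent_disc_small[OF P v1 \<delta>(1) \<delta>'(1) \<zeta>(1) _ _ \<Omega>(1) w] T by auto
    have dist: "norm (inner_point r P \<delta> - w) = norm \<xi>"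
      using v1 by (simp add: \<xi>(1) norm_complex_smult)
    show ?thesis
    proof (cases "\<xi> = 0")
      case True
      then have "f w = f (inner_point r P \<delta>)" by (simp add: \<xi>(1))
      then show ?thesis using C L(1) by simp
    next
      case False
      define t where "t = norm \<xi>"
      have t: "0 < t" "2 * t \<le> T" "t \<le> T" using False \<xi>(2) T(1) norm_ge_zero[of \<xi>] unfolding t_def by (simp, linarith+)
      have m\<alpha>: "real m * \<alpha> \<le> 1 / 2"
        using \<alpha>(2) m by (simp add: \<alpha>0_def field_simps)
      have inside: "P - h *\<^sub>R ?\<nu> + z *s v \<in> \<Omega>"
        if "0 < \<rho>" "\<rho> \<le> T" "K' * N \<rho> \<le> h" "h \<le> \<eta> / 2" "norm z \<le> \<rho>" for \<rho> h z
      proof (rule inner_point_in[OF P _ v1 _ that(4)])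
        have "0 < a * \<rho> ^ m" using a that(1) by simp
        then have N0: "0 < N \<rho>" using N_lower[OF that(1,2)] by linarith
        show "norm z \<le> \<eta> / 2" using that(2,5) T(4) by linarith
        have "0 < K' * N \<rho>" using K' N0 by simp
        then show "0 \<le> h" using that(3) by linarith
        have "K * N \<rho> < 2 * K * N \<rho>" using K N0 by simp
        also have "\<dots> \<le> K' * c * N \<rho>" using K'(2) N0 by (intro mult_right_mono) auto
        also have "\<dots> \<le> c * h" using that(3) c_pos mult_left_mono[of "K' * N \<rho>" h c] by (simp add: mult_ac)
        finally show "r (P + z *s v) < c * h" using N_bound[OF that(1,2,5)] by linarith
      qed
      have KT: "K' * N T \<le> \<eta> / 2"
      proof -
        have "K' * N T \<le> K' * (A * T)" using N_upper[of T] T K' by (intro mult_left_mono) auto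
        then show ?thesis using T(5) by linarith
      qed
      have low: "a' * \<rho> ^ m \<le> N \<rho>" if "0 < \<rho>" "\<rho> \<le> T" for \<rho>
      proof -
        have "a' * \<rho> ^ m \<le> a * \<rho> ^ m" using a' that by (intro mult_right_mono) auto
        then show ?thesis using N_lower[OF that] by linarith
      qed
      have "norm (f (P - \<delta> *\<^sub>R ?\<nu>) - f (P - \<delta> *\<^sub>R ?\<nu> + \<xi> *s v)) \<le> (17 * K' + 6 / (a' * T)) * ?L * N t powr \<alpha>"
      proof (rule tangential_chain_estimate[where H = "\<eta> / 2" and m = m and N = N and t = t])
        show "f \<in> holomorphic_functions \<Omega>" using f by blast
        show "norm ?\<nu> = 1" by (rule norm_normal[OF P])
        show "P - \<delta> *\<^sub>R ?\<nu> \<in> \<Omega>" "P - \<delta> *\<^sub>R ?\<nu> + \<xi> *s v \<in> \<Omega>"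
          using \<xi> by (simp_all add: inner_point_def)
        show "N \<rho> \<le> N \<rho>'" if "0 \<le> \<rho>" "\<rho> \<le> \<rho>'" for \<rho> \<rho>' using N_mono that by blast
        show "N (2 * \<rho>) \<le> 2 ^ m * N \<rho>" if "0 \<le> \<rho>" for \<rho> using N_double that by blast
      qed (fact L \<alpha>(1) m\<alpha> m K'(1) a'(1,2) T(1,2) low inside KT less_imp_le[OF \<delta>(1)] \<delta>'(1) t_def[symmetric] t(1,2))+
      also have "\<dots> \<le> (17 * K' + 6 / (a' * T)) * ?L * (max_r r P v t powr \<alpha> / \<kappa>')"
      proof (rule mult_left_mono)
        obtain z where z: "norm z \<le> t" "\<kappa> * N t \<le> r (P + z *s v)" using N_max[OF t(1,3)] by blast
        have "r (P + z *s v) \<le> max_r r P v t"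
          unfolding max_r_def
        proof (rule cSup_upper)
          show "r (P + z *s v) \<in> {r (P + \<zeta> *s v) |\<zeta>. norm \<zeta> \<le> t}" using z(1) by blast
          show "bdd_above {r (P + \<zeta> *s v) |\<zeta>. norm \<zeta> \<le> t}"
            by (rule bdd_aboveI[of _ "K * N t"]) (use N_bound[OF t(1,3)] in auto)
        qed
        moreover have Nt: "0 < N t"
        proof -
          have "0 < a * t ^ m" using a t(1) by simp
          then show ?thesis using N_lower[OF t(1,3)] by linarith
        qed
        moreover have "\<kappa>' * N t \<le> \<kappa> * N t" using \<kappa>'(3) Nt by (intro mult_right_mono) auto
        ultimately have le: "\<kappa>' * N t \<le> max_r r P v t" using z(2) by linarith
        have "\<kappa>' * N t powr \<alpha> \<le> \<kappa>' powr \<alpha> * N t powr \<alpha>"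
        proof (rule mult_right_mono)
          have "1 * \<alpha> \<le> real m * \<alpha>" using m \<alpha>(1) by (intro mult_right_mono) auto
          then have "\<alpha> \<le> 1" using m\<alpha> by linarith
          then show "\<kappa>' \<le> \<kappa>' powr \<alpha>" using powr_mono'[of \<alpha> 1 \<kappa>'] \<kappa>' by simp
        qed simp
        also have "\<dots> = (\<kappa>' * N t) powr \<alpha>" using \<kappa>' Nt by (simp add: powr_mult)
        also have "\<dots> \<le> max_r r P v t powr \<alpha>"
          using le \<kappa>' Nt \<alpha>(1) by (intro powr_mono2) auto
        finally show "N t powr \<alpha> \<le> max_r r P v t powr \<alpha> / \<kappa>'"
          using \<kappa>'(1) by (simp add: le_divide_eq mult.commute)
        show "0 \<le> (17 * K' + 6 / (a' * T)) * ?L" using K' a' T L(1) by simp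
      qed
      also have "\<dots> = C * ?L * max_r r P v t powr \<alpha>" by (simp add: C_def)
      finally show ?thesis by (simp add: dist inner_point_def \<xi>(1) t_def norm_complex_smult v1)
    qed
  qed
  show ?thesis
    by (rule exI, rule conjI, rule \<alpha>0, rule exI, rule conjI, rule C, rule exI, rule conjI, rule \<delta>0)
      (use main in blast)
qed

end
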